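(* With $\mathcal{M}$, $d$, $\sigma_*$, $\kappa_*$, $\sigma$, $\bar x$, $\delta$ and $\mathcal{D}$ as in the context, the set $\lambda^{-1}(\mathcal{D})=\{X\in\mathbf{S}^n:\lambda(X)\in\mathcal{D}\}$ is an analytic submanifold of $\mathbf{S}^n$ around any $\bar X\in\mathbf{S}^n$ with $\lambda(\bar X)=\bar x$, of dimension $$\frac{n(n+1)}{2}+d+n^{\mathrm{red}}-\kappa_*-\sum_{I\in P(\sigma_* ),\,|I|\ge2}\frac{|I|(|I|+1)}{2},$$ where $n^{\mathrm{red}}=\dim N^{\mathrm{red}}_{\mathcal{M}}(\bar x)$.
   Context: $\mathbf{S}^n$ real symmetric matrices; $\lambda(X)$ nonincreasingly ordered eigenvalues. $\Sigma^n$ permutations of $\mathbb{N}_n$ acting by $(\sigma x)_i=x_{\sigma^{-1}(i)}$; $P(\sigma)$ orbit partition; $P(x)$ partition by equal coordinates; $\Delta(\sigma)=\{x:P(x)=P(\sigma)\}$; $\Delta(\sigma)^{\perp\perp}=\{x:x_i=x_j$ whenever $i,j$ in same set of $P(\sigma)\}$; $\mathbb{R}^n_\ge=\{x:x_1\ge\cdots\ge x_n\}$; $B$ open ball. A set $S$ is locally symmetric if $S\cap\mathbb{R}^n_\ge\ne\emptyset$ and each $x\in S$ has $\delta>0$ with $\sigma(S\cap B(x,\delta))=S\cap B(x,\delta)$ for all $y\in S\cap B(x,\delta)$, $\sigma y=y$; strongly locally symmetric: $\sigma S=S$ for all $y\in S$, $\sigma y=y$. $\mathcal{M}$ is a locally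 symmetric $C^2$ submanifold (connected, without boundary) of dimension $d$, with characteristic permutation $\sigma_*$ (i.e. $\mathcal{M}\cap B(y,\rho)\subset\Delta(\sigma_* )$ for some $y\in\mathcal{M}$, $\rho>0$), $\kappa_*=|\mathbb{N}_n\setminus\mathrm{supp}(\sigma_* )|$. For $x\in\mathbb{R}^n$, $x^F\in\mathbb{R}^{\kappa_*}$ collects coordinates with indices outside $\mathrm{supp}(\sigma_* )$, $x^M$ the rest, and $\otimes$ is the inverse reassembling. Fix $\bar x\in\mathcal{M}\cap\Delta(\sigma)$ and $\delta>0$ such that $B(\bar x,\delta)$ meets only strata $\Delta(\sigma')$ with $P(\sigma')$ refining $P(\sigma)$, $\mathcal{M}\cap B(\bar x,\delta)$ is strongly locally symmetric, and the orthogonal projection onto $\bar x+T_{\mathcal{M}}(\bar x)$ restricted to $\mathcal{M}\cap B(\bar x,\delta)$ is a diffeomorphism onto its image. Let $N^{\mathrm{red}}_{\mathcal{M}}(\bar x)=N_{\mathcal{M}}(\bar x)\cap\Delta(\sigma)^{\perp\perp}$, choose $\delta_1,\delta_2>0$ with $\mathcal{B}:=B(\bar x^F,\delta_1)\otimes B(\bar x^M,\delta_2)\subset B(\bar x,\delta)$ and let $\mathcal{D}=(\bar x+T_{\mathcal{M}}(\bar x)\oplus N^{\mathrm{red}}_{\mathcal{M}}(\bar x))\cap\mathcal{B}$. *)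

theory Defs
  imports "HOL-Analysis.Analysis" "HOL-Combinatorics.Permutations"
begin

text \<open>Index set N_n is a finite linearly ordered type 'n (n = CARD('n)).\<close>

definition sym_mats :: "(real^'n^'n) set" where
  "sym_mats = {X. transpose X = X}"

definition nonincr :: "(real^'n::{finite,linorder}) set" where
  "nonincr = {x. \<forall>i j. i \<le> j \<longrightarrow> x $ j \<le> x $ i}"

definition eigvals :: "real^'n::{finite,linorder}^'n::{finite,linorder} \<Rightarrow> real^'n::{finite,linorder}" where
  "eigvals X = (THE x. x \<in> nonincr \<and> (\<forall>t. det (mat t - X) = (\<Prod>i\<in>UNIV. t - x $ i)))"

definition perm_act :: "('n \<Rightarrow> 'n) \<Rightarrow> real^'n \<Rightarrow> real^'n" where
  "perm_act \<sigma> x = (\<chi> i. x $ (inv \<sigma> i))"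

definition perm_rel :: "('n \<Rightarrow> 'n) \<Rightarrow> ('n \<times> 'n) set" where
  "perm_rel \<sigma> = {(i, j). \<exists>k. (\<sigma> ^^ k) i = j}"

definition perm_partition :: "('n \<Rightarrow> 'n) \<Rightarrow> 'n set set" where
  "perm_partition \<sigma> = UNIV // perm_rel \<sigma>"

definition vec_partition :: "real^'n \<Rightarrow> 'n set set" where
  "vec_partition x = UNIV // {(i, j). x $ i = x $ j}"

definition stratum :: "('n \<Rightarrow> 'n) \<Rightarrow> (real^'n) set" where
  "stratum \<sigma> = {x. vec_partition x = perm_partition \<sigma>}"

definition stratum_perpperp :: "('n \<Rightarrow> 'n) \<Rightarrow> (real^'n) set" where
  "stratum_perpperp \<sigma> = {x. \<forall>I\<in>perm_partition \<sigma>. \<forall>i\<in>I. \<forall>j\<in>I. x $ i = x $ j}"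

definition refines :: "'a set set \<Rightarrow> 'a set set \<Rightarrow> bool" where
  "refines P Q \<longleftrightarrow> (\<forall>A\<in>P. \<exists>B\<in>Q. A \<subseteq> B)"

definition supp_perm :: "('n \<Rightarrow> 'n) \<Rightarrow> 'n set" where
  "supp_perm \<sigma> = {i. \<sigma> i \<noteq> i}"

definition locally_symmetric :: "(real^'n::{finite,linorder}) set \<Rightarrow> bool" where
  "locally_symmetric S \<longleftrightarrow> S \<inter> nonincr \<noteq> {} \<and>
     (\<forall>x\<in>S. \<exists>\<delta>>0. \<forall>\<sigma>. \<sigma> permutes UNIV \<longrightarrow>
        (\<forall>y\<in>S \<inter> ball x \<delta>. perm_act \<sigma> y = y \<longrightarrow>
            perm_act \<sigma> ` (S \<inter> ball x \<delta>) = S \<inter> ball x \<delta>))"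

definition strongly_locally_symmetric :: "(real^'n) set \<Rightarrow> bool" where
  "strongly_locally_symmetric S \<longleftrightarrow>
     (\<forall>\<sigma>. \<sigma> permutes UNIV \<longrightarrow>
        (\<forall>y\<in>S. perm_act \<sigma> y = y \<longrightarrow> perm_act \<sigma> ` S = S))"

definition C2_on :: "(real^'n) set \<Rightarrow> (real^'n \<Rightarrow> real) \<Rightarrow> bool" where
  "C2_on U g \<longleftrightarrow> (\<exists>G H. (\<forall>x\<in>U. (g has_derivative (\<lambda>h. G x \<bullet> h)) (at x) \<and>
                                 (G has_derivative (\<lambda>h. H x *v h)) (at x))
                       \<and> continuous_on U H)"

definition C2_submanifold :: "(real^'n) set \<Rightarrow> nat \<Rightarrow> bool" where
  "C2_submanifold M d \<longleftrightarrow> d \<le> CARD('n) \<and>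
     (\<forall>x\<in>M. \<exists>U g G. open U \<and> x \<in> U \<and>
        (\<forall>j<CARD('n) - d. C2_on U (g j) \<and> (g j has_derivative (\<lambda>h. G j \<bullet> h)) (at x)) \<and>
        inj_on G {..<CARD('n) - d} \<and> independent (G ` {..<CARD('n) - d}) \<and>
        M \<inter> U = {y\<in>U. \<forall>j<CARD('n) - d. g j y = 0})"

definition tangent_space :: "(real^'n) set \<Rightarrow> real^'n \<Rightarrow> (real^'n) set" where
  "tangent_space M x = {v. \<exists>\<gamma> e. e > 0 \<and> \<gamma> 0 = x \<and> (\<forall>t\<in>{-e<..<e}. \<gamma> t \<in> M) \<and>
                              (\<gamma> has_vector_derivative v) (at 0)}"

definition normal_space :: "(real^'n) set \<Rightarrow> real^'n \<Rightarrow> (real^'n) set" where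
  "normal_space M x = {w. \<forall>v\<in>tangent_space M x. w \<bullet> v = 0}"

definition orth_proj :: "(real^'n) set \<Rightarrow> real^'n \<Rightarrow> real^'n" where
  "orth_proj T y = (THE p. p \<in> T \<and> (\<forall>v\<in>T. (y - p) \<bullet> v = 0))"

definition diffeo_onto_image ::
  "(real^'n \<Rightarrow> real^'n) \<Rightarrow> (real^'n) set \<Rightarrow> (real^'n) set \<Rightarrow> bool" where
  "diffeo_onto_image f S A \<longleftrightarrow> f ` S \<subseteq> A \<and> openin (top_of_set A) (f ` S) \<and>
     (\<forall>x\<in>S. f differentiable (at x)) \<and>
     (\<exists>g. homeomorphism S (f ` S) f g \<and> g differentiable_on (f ` S))"

definition char_perm :: "(real^'n) set \<Rightarrow> ('n \<Rightarrow> 'n) \<Rightarrow> bool" where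
  "char_perm M \<sigma> \<longleftrightarrow> \<sigma> permutes UNIV \<and> (\<exists>y\<in>M. \<exists>\<rho>>0. M \<inter> ball y \<rho> \<subseteq> stratum \<sigma>)"

text \<open>Euclidean distance computed only over the coordinates in I
  (i.e. the distance of x^F, x^M in R^kappa, R^(n-kappa)).\<close>
definition part_dist :: "'n set \<Rightarrow> real^'n \<Rightarrow> real^'n \<Rightarrow> real" where
  "part_dist I x y = sqrt (\<Sum>i\<in>I. (x $ i - y $ i)\<^sup>2)"

definition real_analytic_at :: "('a::euclidean_space \<Rightarrow> real) \<Rightarrow> 'a \<Rightarrow> bool" where
  "real_analytic_at f x \<longleftrightarrow> (\<exists>r>0. \<exists>c :: ('a \<Rightarrow> nat) \<Rightarrow> real. \<forall>y\<in>ball x r.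
     ((\<lambda>\<alpha>. c \<alpha> * (\<Prod>b\<in>Basis. ((y - x) \<bullet> b) ^ \<alpha> b)) has_sum f y)
       {\<alpha>. \<forall>b. b \<notin> Basis \<longrightarrow> \<alpha> b = 0})"

definition analytic_submanifold_around :: "'a::euclidean_space set \<Rightarrow> 'a set \<Rightarrow> 'a \<Rightarrow> int \<Rightarrow> bool" where
  "analytic_submanifold_around S A X k \<longleftrightarrow> A \<subseteq> S \<and> X \<in> A \<and>
     (\<exists>p f f' U. k = int (dim S) - int p \<and> open U \<and> X \<in> U \<and>
        (\<forall>j<p. (\<forall>Y\<in>U. real_analytic_at (f j) Y) \<and> (f j has_derivative f' j) (at X)) \<and>
        (\<forall>v. \<exists>H\<in>S. \<forall>j<p. f' j H = v j) \<and>
        A \<inter> U = {Y\<in>S \<inter> U. \<forall>j<p. f j Y = 0})"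

end

theory Submission
  imports Defs "HOL-Computational_Algebra.Polynomial"
begin

text \<open>Invariance of the tangent space \<open>T\<close> at \<open>x\<close> under the stabiliser of \<open>x\<close> forces a dichotomy for every block
  of equal coordinates of \<open>x\<close>: either all tangent vectors are constant on it, or \<open>T\<close> contains all differences
  \<open>e\<^sub>i - e\<^sub>j\<close> of its unit vectors. Hence \<open>T\<close> plus the reduced normal space is the space of vectors that are
  constant on the blocks of the first kind (the tied ones). The relation of being tied is locally constant
  along the manifold, so by connectedness its classes are the orbits of the characteristic permutation.

  It remains to describe the symmetric matrices near \<open>X\<close> whose eigenvalues agree on each tied block. In an
  eigenframe of \<open>X\<close> the invariant subspaces of the perturbed blocks are spanned by columns of a matrix \<open>V\<close> that solves
  a quadratic fixed point equation; iterating it in a weighted \<open>\<ell>\<^sup>1\<close> norm on power series shows that \<open>V\<close> is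
  analytic. With \<open>S = V\<^sup>T Y V\<close> and \<open>G = V\<^sup>T V\<close>, the eigenvalues of a block agree iff \<open>S\<close> and \<open>G\<close> are
  proportional on it, which gives the defining equations; their differentials at \<open>X\<close> are differences of matrix entries.\<close>

section \<open>Power series with submultiplicative bounds\<close>

text \<open>Where eigenvalues coincide, neither the ordered eigenvalues nor their eigenvectors
  depend smoothly on the matrix; only the invariant subspace of a full cluster does. It is therefore
  essential that a tied class with more than one element is a whole block of equal coordinates of
  \<open>xbar\<close>, so that no class splits a cluster. The columns of V are normalised by an
  identity block and not orthonormalised, which keeps the fixed point equation quadratic; the price
  is the Gram matrix G in the equations. Bounds on coefficients prove convergence of the expansion
  itself, so analyticity in the sense of \<open>real_analytic_at\<close> comes directly out of the
  contraction. The dimension is a count: a class of size k costs k(k+1)/2 - 1 equations, so a fixed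
  point of the characteristic permutation costs none, and the number of classes is the dimension of
  the class-constant vectors, which is d plus the dimension of the reduced normal space.\<close>

definition multi_indices :: "('a::euclidean_space \<Rightarrow> nat) set" where
  "multi_indices = {\<alpha>. \<forall>b. b \<notin> Basis \<longrightarrow> \<alpha> b = 0}"

definition multi_degree :: "('a::euclidean_space \<Rightarrow> nat) \<Rightarrow> nat" where
  "multi_degree \<alpha> = (\<Sum>b\<in>Basis. \<alpha> b)"

definition monomial_at :: "'a::euclidean_space \<Rightarrow> ('a \<Rightarrow> nat) \<Rightarrow> real" where
  "monomial_at h \<alpha> = (\<Prod>b\<in>Basis. (h \<bullet> b) ^ \<alpha> b)"

text \<open>The closed cube matches the weight in the norm below: a bound r in every coordinate
  bounds each monomial by \<open>r ^ multi_degree \<alpha>\<close>, so one summable majorant serves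
  all points.\<close>

definition cube_at :: "'a::euclidean_space \<Rightarrow> real \<Rightarrow> 'a set" where
  "cube_at x r = {y. \<forall>b\<in>Basis. \<bar>(y - x) \<bullet> b\<bar> \<le> r}"

text \<open>The bound \<^term>\<open>M\<close> dominates the weighted \<open>\<ell>\<^sup>1\<close> norm of the coefficients, which makes it
  submultiplicative; contraction arguments can be run on it.\<close>
definition power_series_bound ::
  "('a::euclidean_space \<Rightarrow> real) \<Rightarrow> 'a \<Rightarrow> real \<Rightarrow> real \<Rightarrow> bool" where
  "power_series_bound f x r M \<longleftrightarrow> (\<exists>c N. N \<le> M \<and>
     ((\<lambda>\<alpha>. \<bar>c \<alpha>\<bar> * r ^ multi_degree \<alpha>) has_sum N) multi_indices \<and>
     (\<forall>y\<in>cube_at x r. ((\<lambda>\<alpha>. c \<alpha> * monomial_at (y - x) \<alpha>) has_sum f y) multi_indices))"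

lemma abs_monomial_at_le:
  assumes "y \<in> cube_at x r"
  shows "\<bar>monomial_at (y - x) \<alpha>\<bar> \<le> r ^ multi_degree \<alpha>"
proof -
  have "\<bar>monomial_at (y - x) \<alpha>\<bar> = (\<Prod>b\<in>Basis. \<bar>(y - x) \<bullet> b\<bar> ^ \<alpha> b)"
    by (simp add: monomial_at_def abs_prod power_abs)
  also have "\<dots> \<le> (\<Prod>b\<in>(Basis::'a set). r ^ \<alpha> b)"
    using assms by (intro prod_mono conjI power_mono) (auto simp: cube_at_def)
  finally show ?thesis by (simp add: multi_degree_def power_sum)
qed

lemma cube_at_self: "0 \<le> r \<Longrightarrow> x \<in> cube_at x r"
  by (simp add: cube_at_def)

lemma ball_subset_cube_at: "ball x r \<subseteq> cube_at x r"
proof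
  fix y assume "y \<in> ball x r"
  then show "y \<in> cube_at x r"
    using Basis_le_norm[of _ "y - x"]
    by (force simp: cube_at_def dist_norm norm_minus_commute)
qed

lemma power_series_bound_abs_le:
  assumes "power_series_bound f x r M" "y \<in> cube_at x r"
  shows "\<bar>f y\<bar> \<le> M"
proof -
  obtain c N where N: "N \<le> M" "((\<lambda>\<alpha>. \<bar>c \<alpha>\<bar> * r ^ multi_degree \<alpha>) has_sum N) multi_indices"
    and f: "((\<lambda>\<alpha>. c \<alpha> * monomial_at (y - x) \<alpha>) has_sum f y) multi_indices"
    using assms unfolding power_series_bound_def by blast
  have le: "norm (c \<alpha> * monomial_at (y - x) \<alpha>) \<le> \<bar>c \<alpha>\<bar> * r ^ multi_degree \<alpha>" for \<alpha>
    using abs_monomial_at_le[OF assms(2)] by (simp add: abs_mult mult_left_mono)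
  have s: "(\<lambda>\<alpha>. norm (c \<alpha> * monomial_at (y - x) \<alpha>)) summable_on multi_indices"
    by (subst summable_on_iff_abs_summable_on_real[symmetric]) (use f in \<open>auto simp: summable_on_def\<close>)
  have "norm (f y) \<le> infsum (\<lambda>\<alpha>. norm (c \<alpha> * monomial_at (y - x) \<alpha>)) multi_indices"
    by (rule norm_has_sum_bound[OF has_sum_infsum[OF s] f])
  also have "\<dots> \<le> N"
    using has_sum_mono[OF has_sum_infsum[OF s] N(2)] le by blast
  finally show ?thesis using N(1) by simp
qed

text \<open>Common source of the closure properties below: monomials indexed at will, if summable in
  the weighted norm, may be collected by exponent. Products use pairs of multi-indices, infinite
  sums use \<open>K \<times> multi_indices\<close>, constants and coordinates a single
  index.\<close>

lemma power_series_bound_regroup: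
  fixes \<mu> :: "'i \<Rightarrow> 'a::euclidean_space \<Rightarrow> nat"
  assumes r: "r > 0" and \<mu>: "\<And>i. i \<in> I \<Longrightarrow> \<mu> i \<in> multi_indices"
    and N: "((\<lambda>i. \<bar>a i\<bar> * r ^ multi_degree (\<mu> i)) has_sum N) I" and "N \<le> M"
    and f: "\<And>y. y \<in> cube_at x r \<Longrightarrow> ((\<lambda>i. a i * monomial_at (y - x) (\<mu> i)) has_sum f y) I"
  shows "power_series_bound f x r M"
proof -
  define F where "F \<beta> = {i\<in>I. \<mu> i = \<beta>}" for \<beta>
  define c where "c \<beta> = infsum a (F \<beta>)" for \<beta>
  define Nb where "Nb \<beta> = infsum (\<lambda>i. \<bar>a i\<bar> * r ^ multi_degree (\<mu> i)) (F \<beta>)" for \<beta>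
  \<comment> \<open>The fibres of \<open>\<mu>\<close> partition \<open>I\<close>, so a sum over
    \<open>I\<close> is a sum over a dependent product and can be iterated.\<close>
  have bij: "bij_betw snd (Sigma multi_indices F) I"
    by (rule bij_betwI[where g = "\<lambda>i. (\<mu> i, i)"]) (use \<mu> in \<open>auto simp: F_def\<close>)
  have regroup: "(b has_sum s) multi_indices"
    if "(g has_sum s) I" "\<And>\<beta>. \<beta> \<in> multi_indices \<Longrightarrow> (g has_sum b \<beta>) (F \<beta>)" for g b and s :: real
  proof (rule has_sum_SigmaD)
    show "((g \<circ> snd) has_sum s) (Sigma multi_indices F)"
      using has_sum_reindex_bij_betw[OF bij, of g s] that(1) by (simp add: o_def)
  qed (use that(2) in \<open>simp add: o_def\<close>)
  have sN: "(\<lambda>i. \<bar>a i\<bar> * r ^ multi_degree (\<mu> i)) summable_on F \<beta>" for \<beta>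
    by (rule summable_on_subset_banach[of _ I]) (use N in \<open>auto simp: F_def summable_on_def\<close>)
  have "((\<lambda>i. \<bar>a i\<bar> * r ^ multi_degree \<beta>) has_sum Nb \<beta>) (F \<beta>)" for \<beta>
    using has_sum_infsum[OF sN[of \<beta>]] unfolding Nb_def
    by (rule has_sum_cong[THEN iffD1, rotated]) (auto simp: F_def)
  \<comment> \<open>On one fibre the weight is a positive constant; dividing by it shows that the
    bare coefficients are absolutely summable.\<close>
  then have abs_a: "((\<lambda>i. norm (a i)) has_sum (Nb \<beta> / r ^ multi_degree \<beta>)) (F \<beta>)" for \<beta>
    using has_sum_cmult_left[where c = "1 / r ^ multi_degree \<beta>" and A = "F \<beta>" and a = "Nb \<beta>"
        and f = "\<lambda>i. \<bar>a i\<bar> * r ^ multi_degree \<beta>"] r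
    by simp
  have a: "(a has_sum c \<beta>) (F \<beta>)" for \<beta>
    unfolding c_def by (rule has_sum_infsum[OF abs_summable_summable]) (use abs_a in \<open>auto simp: summable_on_def\<close>)
  have Nb: "(Nb has_sum N) multi_indices"
    by (rule regroup[OF N]) (simp only: Nb_def has_sum_infsum[OF sN])
  have le: "\<bar>c \<beta>\<bar> * r ^ multi_degree \<beta> \<le> Nb \<beta>" for \<beta>
    using norm_has_sum_bound[OF abs_a a, of \<beta>] r by (simp add: field_simps)
  have sc: "(\<lambda>\<beta>. \<bar>c \<beta>\<bar> * r ^ multi_degree \<beta>) summable_on multi_indices"
    by (rule summable_on_comparison_test[where f = Nb]) (use Nb le r in \<open>auto simp: summable_on_def\<close>)
  have "infsum (\<lambda>\<beta>. \<bar>c \<beta>\<bar> * r ^ multi_degree \<beta>) multi_indices \<le> M"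
    using has_sum_mono[OF has_sum_infsum[OF sc] Nb] le \<open>N \<le> M\<close> by fastforce
  moreover have "((\<lambda>\<beta>. c \<beta> * monomial_at (y - x) \<beta>) has_sum f y) multi_indices"
    if "y \<in> cube_at x r" for y
  proof (rule regroup[OF f[OF that]])
    show "((\<lambda>i. a i * monomial_at (y - x) (\<mu> i)) has_sum c \<beta> * monomial_at (y - x) \<beta>) (F \<beta>)" for \<beta>
      using has_sum_cmult_left[OF a[of \<beta>], of "monomial_at (y - x) \<beta>"]
      by (rule has_sum_cong[THEN iffD1, rotated]) (auto simp: F_def)
  qed
  ultimately show ?thesis
    unfolding power_series_bound_def using has_sum_infsum[OF sc] by blast
qed

lemma power_series_bound_mono:
  "power_series_bound f x r M \<Longrightarrow> M \<le> M' \<Longrightarrow> power_series_bound f x r M'"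
  unfolding power_series_bound_def using order_trans by fast

lemma power_series_bound_const:
  fixes x :: "'a::euclidean_space"
  assumes "r > 0"
  shows "power_series_bound (\<lambda>_. k) x r \<bar>k\<bar>"
proof (rule power_series_bound_regroup[OF assms, where I = "{()}" and a = "\<lambda>_. k" and \<mu> = "\<lambda>_ _. 0"
      and N = "\<bar>k\<bar>"])
qed (auto simp: multi_indices_def multi_degree_def monomial_at_def intro!: has_sum_finiteI)

lemma power_series_bound_coord:
  fixes x :: "'a::euclidean_space"
  assumes "r > 0" and b: "b \<in> Basis"
  shows "power_series_bound (\<lambda>y. (y - x) \<bullet> b) x r r"
proof (rule power_series_bound_regroup[OF \<open>r > 0\<close>, where I = "{()}" and a = "\<lambda>_. 1"
      and \<mu> = "\<lambda>_ b'. if b' = b then 1 else 0" and N = r])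
  show "((\<lambda>i. 1 * monomial_at (y - x) (\<lambda>b'. if b' = b then 1 else 0)) has_sum (y - x) \<bullet> b) {()}" for y
  proof (rule has_sum_finiteI)
    show "(y - x) \<bullet> b = (\<Sum>i\<in>{()}. 1 * monomial_at (y - x) (\<lambda>b'. if b' = b then 1 else 0))"
      using b by (simp add: monomial_at_def if_distrib cong: if_cong)
  qed simp
qed (use b in \<open>auto simp: multi_indices_def multi_degree_def intro!: has_sum_finiteI\<close>)

lemma has_sum_times_Times:
  fixes f :: "'i \<Rightarrow> real" and g :: "'j \<Rightarrow> real"
  assumes f: "(f has_sum s) A" and g: "(g has_sum t) B"
  shows "((\<lambda>(i, j). f i * g j) has_sum (s * t)) (A \<times> B)"
proof (rule has_sum_SigmaI)
  show "((\<lambda>j. case (i, j) of (i, j) \<Rightarrow> f i * g j) has_sum f i * t) B" for i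
    using has_sum_cmult_right[OF g] by simp
  show "((\<lambda>i. f i * t) has_sum s * t) A"
    using has_sum_cmult_left[OF f] .
  have fa: "(\<lambda>i. \<bar>f i\<bar>) summable_on A" and ga: "(\<lambda>j. \<bar>g j\<bar>) summable_on B"
    using f g summable_on_iff_abs_summable_on_real[of f A] summable_on_iff_abs_summable_on_real[of g B]
    by (auto simp: summable_on_def)
  have "(\<lambda>p. \<bar>case p of (i, j) \<Rightarrow> f i * g j\<bar>) summable_on A \<times> B"
    using fa ga
    by (intro summable_on_SigmaI[where g = "\<lambda>i. \<bar>f i\<bar> * infsum (\<lambda>j. \<bar>g j\<bar>) B"])
       (auto simp: abs_mult intro!: has_sum_cmult_right summable_on_cmult_left has_sum_infsum)
  then show "(\<lambda>(i, j). f i * g j) summable_on A \<times> B"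
    using abs_summable_summable[of "\<lambda>(i, j). f i * g j"] by (simp only: real_norm_def)
qed

lemma power_series_bound_mult:
  fixes x :: "'a::euclidean_space"
  assumes r: "r > 0" and f: "power_series_bound f x r M" and g: "power_series_bound g x r M'"
  shows "power_series_bound (\<lambda>y. f y * g y) x r (M * M')"
proof -
  obtain c N where N: "N \<le> M" "((\<lambda>\<alpha>. \<bar>c \<alpha>\<bar> * r ^ multi_degree \<alpha>) has_sum N) multi_indices"
    and c: "\<And>y. y \<in> cube_at x r \<Longrightarrow> ((\<lambda>\<alpha>. c \<alpha> * monomial_at (y - x) \<alpha>) has_sum f y) multi_indices"
    using f unfolding power_series_bound_def by blast
  obtain d L where L: "L \<le> M'" "((\<lambda>\<alpha>. \<bar>d \<alpha>\<bar> * r ^ multi_degree \<alpha>) has_sum L) multi_indices"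
    and d: "\<And>y. y \<in> cube_at x r \<Longrightarrow> ((\<lambda>\<alpha>. d \<alpha> * monomial_at (y - x) \<alpha>) has_sum g y) multi_indices"
    using g unfolding power_series_bound_def by blast
  have deg: "multi_degree (\<lambda>b. \<alpha> b + \<beta> b) = multi_degree \<alpha> + multi_degree \<beta>" for \<alpha> \<beta> :: "'a \<Rightarrow> nat"
    by (simp add: multi_degree_def sum.distrib)
  have mon: "monomial_at h (\<lambda>b. \<alpha> b + \<beta> b) = monomial_at h \<alpha> * monomial_at h \<beta>" for \<alpha> \<beta> and h :: 'a
    by (simp add: monomial_at_def power_add prod.distrib)
  show ?thesis
  proof (rule power_series_bound_regroup[OF r, where I = "multi_indices \<times> multi_indices"
        and a = "\<lambda>(\<alpha>, \<beta>). c \<alpha> * d \<beta>" and \<mu> = "\<lambda>(\<alpha>, \<beta>) b. \<alpha> b + \<beta> b" and N = "N * L"])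
    show "(case i of (\<alpha>, \<beta>) \<Rightarrow> \<lambda>b. \<alpha> b + \<beta> b) \<in> multi_indices"
      if "i \<in> multi_indices \<times> multi_indices" for i :: "('a \<Rightarrow> nat) \<times> ('a \<Rightarrow> nat)"
      using that by (auto simp: multi_indices_def)
    show "((\<lambda>i. \<bar>case i of (\<alpha>, \<beta>) \<Rightarrow> c \<alpha> * d \<beta>\<bar> * r ^ multi_degree (case i of (\<alpha>, \<beta>) \<Rightarrow> \<lambda>b. \<alpha> b + \<beta> b))
        has_sum N * L) (multi_indices \<times> multi_indices)"
      using has_sum_times_Times[OF N(2) L(2)]
      by (rule has_sum_cong[THEN iffD1, rotated]) (auto simp: deg power_add abs_mult)
    show "((\<lambda>i. (case i of (\<alpha>, \<beta>) \<Rightarrow> c \<alpha> * d \<beta>) * monomial_at (y - x) (case i of (\<alpha>, \<beta>) \<Rightarrow> \<lambda>b. \<alpha> b + \<beta> b))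
        has_sum f y * g y) (multi_indices \<times> multi_indices)" if "y \<in> cube_at x r" for y
      using has_sum_times_Times[OF c[OF that] d[OF that]]
      by (rule has_sum_cong[THEN iffD1, rotated]) (auto simp: mon)
    have "0 \<le> N" "0 \<le> L"
      using has_sum_nonneg[OF N(2)] has_sum_nonneg[OF L(2)] r by auto
    then show "N * L \<le> M * M'"
      using N(1) L(1) by (intro mult_mono) auto
  qed
qed

text \<open>Completeness of the algebra of bounded series. This carries the bounds from the
  increments of the fixed point iteration to its limit.\<close>

lemma power_series_bound_has_sum:
  fixes x :: "'a::euclidean_space"
  assumes r: "r > 0" and f: "\<And>k. k \<in> K \<Longrightarrow> power_series_bound (f k) x r (M k)"
    and M: "(M has_sum S) K"
    and g: "\<And>y. y \<in> cube_at x r \<Longrightarrow> ((\<lambda>k. f k y) has_sum g y) K"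
  shows "power_series_bound g x r S"
proof -
  have "\<exists>c. \<forall>k\<in>K. \<exists>N. N \<le> M k \<and>
     ((\<lambda>\<alpha>. \<bar>c k \<alpha>\<bar> * r ^ multi_degree \<alpha>) has_sum N) multi_indices \<and>
     (\<forall>y\<in>cube_at x r. ((\<lambda>\<alpha>. c k \<alpha> * monomial_at (y - x) \<alpha>) has_sum f k y) multi_indices)"
    using f unfolding power_series_bound_def by (intro bchoice) blast
  then obtain c where c': "\<forall>k\<in>K. \<exists>N. N \<le> M k \<and>
     ((\<lambda>\<alpha>. \<bar>c k \<alpha>\<bar> * r ^ multi_degree \<alpha>) has_sum N) multi_indices \<and>
     (\<forall>y\<in>cube_at x r. ((\<lambda>\<alpha>. c k \<alpha> * monomial_at (y - x) \<alpha>) has_sum f k y) multi_indices)" ..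
  obtain N where N: "\<And>k. k \<in> K \<Longrightarrow> N k \<le> M k"
    "\<And>k. k \<in> K \<Longrightarrow> ((\<lambda>\<alpha>. \<bar>c k \<alpha>\<bar> * r ^ multi_degree \<alpha>) has_sum N k) multi_indices"
    and c: "\<And>k y. k \<in> K \<Longrightarrow> y \<in> cube_at x r \<Longrightarrow>
      ((\<lambda>\<alpha>. c k \<alpha> * monomial_at (y - x) \<alpha>) has_sum f k y) multi_indices"
    using bchoice[OF c'] by blast
  have N0: "0 \<le> N k" if "k \<in> K" for k
    using has_sum_nonneg[OF N(2)[OF that]] r by auto
  have sN: "N summable_on K"
    by (rule summable_on_comparison_test[where f = M]) (use M N(1) N0 in \<open>auto simp: summable_on_def\<close>)
  have abs_sum: "(\<lambda>(k, \<alpha>). \<bar>c k \<alpha>\<bar> * r ^ multi_degree \<alpha>) summable_on K \<times> multi_indices"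
    by (rule summable_on_SigmaI[where g = N]) (use sN N(2) r in auto)
  show ?thesis
  proof (rule power_series_bound_regroup[OF r, where I = "K \<times> multi_indices"
        and a = "\<lambda>(k, \<alpha>). c k \<alpha>" and \<mu> = snd and N = "infsum N K"])
    show "infsum N K \<le> S"
      using has_sum_mono[OF has_sum_infsum[OF sN] M] N(1) by blast
    show "((\<lambda>i. \<bar>case i of (k, \<alpha>) \<Rightarrow> c k \<alpha>\<bar> * r ^ multi_degree (snd i)) has_sum infsum N K)
       (K \<times> multi_indices)"
    proof (rule has_sum_SigmaI)
      show "(\<lambda>i. \<bar>case i of (k, \<alpha>) \<Rightarrow> c k \<alpha>\<bar> * r ^ multi_degree (snd i)) summable_on K \<times> multi_indices"
        using abs_sum by (simp add: case_prod_unfold)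
    qed (use N(2) has_sum_infsum[OF sN] in auto)
    show "((\<lambda>i. (case i of (k, \<alpha>) \<Rightarrow> c k \<alpha>) * monomial_at (y - x) (snd i)) has_sum g y) (K \<times> multi_indices)"
      if y: "y \<in> cube_at x r" for y
    proof (rule has_sum_SigmaI)
      have "(\<lambda>i. norm ((case i of (k, \<alpha>) \<Rightarrow> c k \<alpha>) * monomial_at (y - x) (snd i))) summable_on K \<times> multi_indices"
        by (rule summable_on_comparison_test[OF abs_sum])
           (use abs_monomial_at_le[OF y] in \<open>auto simp: abs_mult mult_left_mono\<close>)
      then show "(\<lambda>i. (case i of (k, \<alpha>) \<Rightarrow> c k \<alpha>) * monomial_at (y - x) (snd i)) summable_on K \<times> multi_indices"
        by (rule abs_summable_summable)
    qed (use c[OF _ y] g[OF y] in auto)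
  qed auto
qed

lemma power_series_bound_sum:
  fixes x :: "'a::euclidean_space"
  assumes "r > 0" "finite K" "\<And>k. k \<in> K \<Longrightarrow> power_series_bound (f k) x r (M k)"
  shows "power_series_bound (\<lambda>y. \<Sum>k\<in>K. f k y) x r (\<Sum>k\<in>K. M k)"
  by (rule power_series_bound_has_sum[where K = K and f = f and M = M])
     (use assms in \<open>auto intro: has_sum_finiteI\<close>)

lemma power_series_bound_cmult:
  fixes x :: "'a::euclidean_space"
  assumes "r > 0" "power_series_bound f x r M"
  shows "power_series_bound (\<lambda>y. k * f y) x r (\<bar>k\<bar> * M)"
  using power_series_bound_mult[OF assms(1) power_series_bound_const assms(2)] assms(1) .

lemma power_series_bound_add:
  fixes x :: "'a::euclidean_space"
  assumes "r > 0" "power_series_bound f x r M" "power_series_bound g x r M'"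
  shows "power_series_bound (\<lambda>y. f y + g y) x r (M + M')"
  using power_series_bound_sum[OF assms(1), where K = "{False, True}" and f = "\<lambda>b. if b then f else g"
      and M = "\<lambda>b. if b then M else M'" and x = x] assms(2,3) by (simp add: add.commute)

lemma power_series_bound_diff:
  fixes x :: "'a::euclidean_space"
  assumes "r > 0" "power_series_bound f x r M" "power_series_bound g x r M'"
  shows "power_series_bound (\<lambda>y. f y - g y) x r (M + M')"
  using power_series_bound_add[OF assms(1,2) power_series_bound_cmult[OF assms(1,3), of "-1"]] by simp

lemma power_series_bound_power:
  fixes x :: "'a::euclidean_space"
  assumes "r > 0" "power_series_bound f x r M"
  shows "power_series_bound (\<lambda>y. f y ^ k) x r (M ^ k)"
proof (induction k)
  case 0
  show ?case using power_series_bound_const[OF assms(1), of 1 x] by simp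
next
  case (Suc k)
  show ?case using power_series_bound_mult[OF assms Suc] by simp
qed

lemma power_series_bound_prod:
  fixes x :: "'a::euclidean_space"
  assumes "r > 0" "finite K" "\<And>k. k \<in> K \<Longrightarrow> power_series_bound (f k) x r (M k)"
  shows "power_series_bound (\<lambda>y. \<Prod>k\<in>K. f k y) x r (\<Prod>k\<in>K. M k)"
  using assms(2,3)
proof (induction K rule: finite_induct)
  case empty
  show ?case using power_series_bound_const[OF assms(1), of 1 x] by simp
next
  case (insert k K)
  have "power_series_bound (f k) x r (M k)" "power_series_bound (\<lambda>y. \<Prod>k\<in>K. f k y) x r (\<Prod>k\<in>K. M k)"
    using insert by auto
  then show ?case
    using power_series_bound_mult[OF assms(1)] insert.hyps by simp
qed

lemma power_series_bound_linear:
  fixes x :: "'a::euclidean_space"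
  assumes "linear f" "r > 0"
  shows "power_series_bound (\<lambda>y. f (y - x)) x r (r * (\<Sum>b\<in>Basis. \<bar>f b\<bar>))"
proof -
  have rep: "f v = (\<Sum>b\<in>Basis. f b * (v \<bullet> b))" for v :: 'a
  proof -
    have "f v = f (\<Sum>b\<in>Basis. (v \<bullet> b) *\<^sub>R b)" by (simp add: euclidean_representation)
    also have "\<dots> = (\<Sum>b\<in>Basis. f b * (v \<bullet> b))"
      by (simp add: linear_sum[OF assms(1)] linear_scale[OF assms(1)] mult.commute)
    finally show ?thesis .
  qed
  have "power_series_bound (\<lambda>y. \<Sum>b\<in>Basis. f b * ((y - x) \<bullet> b)) x r (\<Sum>b\<in>Basis. \<bar>f b\<bar> * r)"
    using assms(2) by (intro power_series_bound_sum power_series_bound_cmult power_series_bound_coord) auto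
  then show ?thesis
    unfolding rep[of "_ - x", symmetric] by (simp add: sum_distrib_left mult.commute)
qed

text \<open>In \<open>(y - x) \<bullet> b = (y - z) \<bullet> b + (z - x) \<bullet> b\<close> the
  right side has norm at most r about z, so every term of the series keeps its bound after
  substitution. This gives analyticity throughout a neighbourhood and not only at the
  centre.\<close>

lemma power_series_bound_recenter:
  fixes x :: "'a::euclidean_space"
  assumes f: "power_series_bound f x r M" and s: "s > 0" and z: "z \<in> cube_at x (r - s)"
  shows "power_series_bound f z s M"
proof -
  obtain c N where N: "N \<le> M" "((\<lambda>\<alpha>. \<bar>c \<alpha>\<bar> * r ^ multi_degree \<alpha>) has_sum N) multi_indices"
    and c: "\<And>y. y \<in> cube_at x r \<Longrightarrow> ((\<lambda>\<alpha>. c \<alpha> * monomial_at (y - x) \<alpha>) has_sum f y) multi_indices"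
    using f unfolding power_series_bound_def by blast
  have sub: "y \<in> cube_at x r" if y: "y \<in> cube_at z s" for y
  proof -
    have "\<bar>(y - x) \<bullet> b\<bar> \<le> r" if b: "b \<in> Basis" for b
    proof -
      have "(y - x) \<bullet> b = (y - z) \<bullet> b + (z - x) \<bullet> b" by (simp add: inner_diff_left)
      then show ?thesis using y z b unfolding cube_at_def by fastforce
    qed
    then show ?thesis by (simp add: cube_at_def)
  qed
  have coord: "power_series_bound (\<lambda>y. (y - x) \<bullet> b) z s r" if b: "b \<in> Basis" for b
  proof -
    have "power_series_bound (\<lambda>y. (y - z) \<bullet> b + (z - x) \<bullet> b) z s (s + \<bar>(z - x) \<bullet> b\<bar>)"
      by (intro power_series_bound_add power_series_bound_coord power_series_bound_const s b)
    moreover have "s + \<bar>(z - x) \<bullet> b\<bar> \<le> r" using z b by (auto simp: cube_at_def)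
    ultimately show ?thesis
      by (auto elim: power_series_bound_mono simp: inner_diff_left)
  qed
  have "power_series_bound f z s N"
  proof (rule power_series_bound_has_sum[OF s _ N(2)])
    fix \<alpha> :: "'a \<Rightarrow> nat"
    have "power_series_bound (\<lambda>y. c \<alpha> * (\<Prod>b\<in>Basis. ((y - x) \<bullet> b) ^ \<alpha> b)) z s
        (\<bar>c \<alpha>\<bar> * (\<Prod>b\<in>Basis. r ^ \<alpha> b))"
      by (intro power_series_bound_cmult power_series_bound_prod power_series_bound_power coord s) auto
    then show "power_series_bound (\<lambda>y. c \<alpha> * monomial_at (y - x) \<alpha>) z s (\<bar>c \<alpha>\<bar> * r ^ multi_degree \<alpha>)"
      by (simp add: monomial_at_def multi_degree_def power_sum)
  qed (use c sub in blast)
  then show ?thesis using N(1) power_series_bound_mono by blast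
qed

lemma power_series_bound_imp_real_analytic_at:
  assumes f: "power_series_bound f x r M" and r: "r > 0" and z: "z \<in> ball x (r / 2)"
  shows "real_analytic_at f z"
proof -
  have "power_series_bound f z (r / 2) M"
    using power_series_bound_recenter[OF f, of "r / 2" z] r z ball_subset_cube_at[of x "r / 2"] by auto
  then obtain c where c: "\<And>y. y \<in> cube_at z (r / 2) \<Longrightarrow>
      ((\<lambda>\<alpha>. c \<alpha> * monomial_at (y - z) \<alpha>) has_sum f y) multi_indices"
    unfolding power_series_bound_def by blast
  then have "\<forall>y\<in>ball z (r / 2). ((\<lambda>\<alpha>. c \<alpha> * (\<Prod>b\<in>Basis. ((y - z) \<bullet> b) ^ \<alpha> b)) has_sum f y)
       {\<alpha>. \<forall>b. b \<notin> Basis \<longrightarrow> \<alpha> b = 0}"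
    using ball_subset_cube_at[of z "r / 2"] by (auto simp: monomial_at_def multi_indices_def)
  then show ?thesis
    unfolding real_analytic_at_def using r by (intro exI[of _ "r / 2"] conjI exI[of _ c]) auto
qed

section \<open>Block diagonalisation as a fixed point\<close>

text \<open>For \<open>Y = diag D + E\<close>, a fixed point \<open>V\<close> of this map satisfies \<open>Y V = V L\<close> with \<open>L\<close> block diagonal
  along the level sets of \<open>D\<close>; the equation is solved for the entries of \<open>V\<close> outside the blocks, those
  inside being normalised to the identity.\<close>
definition block_map ::
  "real^'n \<Rightarrow> ('n \<Rightarrow> 'n \<Rightarrow> real) \<Rightarrow> ('n \<Rightarrow> 'n \<Rightarrow> real) \<Rightarrow> 'n \<Rightarrow> 'n \<Rightarrow> real" where
  "block_map D E V l j = (if D $ l = D $ j then (if l = j then 1 else 0)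
     else inverse (D $ j - D $ l) * ((\<Sum>k\<in>UNIV. E l k * V k j)
            - (\<Sum>i | D $ i = D $ j. V l i * (\<Sum>k\<in>UNIV. E i k * V k j))))"

text \<open>Lipschitz constant of \<open>block_map\<close> per unit of the bound on E, for n indices
  and entries of V bounded by 2: the linear part contributes n, the quadratic part at most n
  summands with 2n from each of its two factors, hence 4 n^2; g bounds the divisors from
  below.\<close>

definition block_const :: "'n itself \<Rightarrow> real \<Rightarrow> real" where
  "block_const _ g = (real CARD('n) + 4 * (real CARD('n))\<^sup>2) / g"

lemma block_map_zero: "block_map D E (\<lambda>_ _. 0) l j = (if l = j then 1 else 0)"
  by (auto simp: block_map_def)

lemma block_map_lipschitz:
  fixes D :: "real^'n" and E V V' :: "'n \<Rightarrow> 'n \<Rightarrow> 'a::euclidean_space \<Rightarrow> real"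
  assumes r: "r > 0" and g: "g > 0" and gap: "\<And>i j. D $ i \<noteq> D $ j \<Longrightarrow> g \<le> \<bar>D $ i - D $ j\<bar>"
    and E: "\<And>i j. power_series_bound (E i j) x r \<epsilon>"
    and V: "\<And>i j. power_series_bound (V i j) x r 2" and V': "\<And>i j. power_series_bound (V' i j) x r 2"
    and diff: "\<And>i j. power_series_bound (\<lambda>y. V i j y - V' i j y) x r \<delta>"
  shows "power_series_bound (\<lambda>y. block_map D (\<lambda>i j. E i j y) (\<lambda>i j. V i j y) l j
           - block_map D (\<lambda>i j. E i j y) (\<lambda>i j. V' i j y) l j) x r (block_const TYPE('n) g * \<epsilon> * \<delta>)"
proof -
  define n where "n = real CARD('n)"
  have pos: "0 \<le> \<epsilon>" "0 \<le> \<delta>"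
    using power_series_bound_abs_le[OF E cube_at_self] power_series_bound_abs_le[OF diff cube_at_self] r
    by (meson abs_ge_zero less_imp_le order_trans)+
  have bc: "block_const TYPE('n) g * \<epsilon> * \<delta> = inverse g * (n * (\<epsilon> * \<delta>) + n * (4 * n * \<epsilon> * \<delta>))"
    using g by (simp add: block_const_def n_def field_simps power2_eq_square)
  have n0: "0 \<le> n" by (simp add: n_def)
  show ?thesis
  proof (cases "D $ l = D $ j")
    case True
    have "0 \<le> block_const TYPE('n) g * \<epsilon> * \<delta>" unfolding bc using g pos n0 by simp
    then show ?thesis
      using power_series_bound_mono[OF power_series_bound_const[OF r, of 0 x]] True
      by (simp add: block_map_def)
  next
    case False
    \<comment> \<open>\<open>T1\<close> is the difference of the linear parts. \<open>T2\<close>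
      splits the difference of the quadratic parts as (V - V') E V + V' E (V - V'), so that each
      summand contains the bound \<open>\<delta>\<close> once.\<close>
    define T1 where "T1 y = (\<Sum>k\<in>UNIV. E l k y * (V k j y - V' k j y))" for y
    define T2 where "T2 y = (\<Sum>i | D $ i = D $ j. (V l i y - V' l i y) * (\<Sum>k\<in>UNIV. E i k y * V k j y)
       + V' l i y * (\<Sum>k\<in>UNIV. E i k y * (V k j y - V' k j y)))" for y
    have "power_series_bound T1 x r (\<Sum>k\<in>(UNIV::'n set). \<epsilon> * \<delta>)"
      unfolding T1_def by (intro power_series_bound_sum power_series_bound_mult r E diff) auto
    moreover have "power_series_bound T2 x r (\<Sum>i | D $ i = D $ j. \<delta> * (\<Sum>k\<in>(UNIV::'n set). \<epsilon> * 2)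
       + 2 * (\<Sum>k\<in>(UNIV::'n set). \<epsilon> * \<delta>))"
      unfolding T2_def
      by (intro power_series_bound_sum power_series_bound_add power_series_bound_mult r E diff V V') auto
    ultimately have "power_series_bound (\<lambda>y. inverse (D $ j - D $ l) * (T1 y - T2 y)) x r
        (\<bar>inverse (D $ j - D $ l)\<bar> * ((\<Sum>k\<in>(UNIV::'n set). \<epsilon> * \<delta>) +
           (\<Sum>i | D $ i = D $ j. \<delta> * (\<Sum>k\<in>(UNIV::'n set). \<epsilon> * 2) + 2 * (\<Sum>k\<in>(UNIV::'n set). \<epsilon> * \<delta>))))"
      by (intro power_series_bound_cmult power_series_bound_diff r)
    moreover have "\<bar>inverse (D $ j - D $ l)\<bar> * ((\<Sum>k\<in>(UNIV::'n set). \<epsilon> * \<delta>) +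
           (\<Sum>i | D $ i = D $ j. \<delta> * (\<Sum>k\<in>(UNIV::'n set). \<epsilon> * 2) + 2 * (\<Sum>k\<in>(UNIV::'n set). \<epsilon> * \<delta>)))
        \<le> block_const TYPE('n) g * \<epsilon> * \<delta>"
    proof -
      have "g \<le> \<bar>D $ j - D $ l\<bar>" using gap False by metis
      then have "\<bar>inverse (D $ j - D $ l)\<bar> \<le> inverse g"
        using g by (simp add: abs_inverse le_imp_inverse_le)
      moreover have "(\<Sum>i | D $ i = D $ j. \<delta> * (\<Sum>k\<in>(UNIV::'n set). \<epsilon> * 2) + 2 * (\<Sum>k\<in>(UNIV::'n set). \<epsilon> * \<delta>))
          \<le> n * (4 * n * \<epsilon> * \<delta>)"
      proof -
        have "real (card {i. D $ i = D $ j}) \<le> n" unfolding n_def by (simp add: card_mono)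
        then have "real (card {i. D $ i = D $ j}) * (4 * n * \<epsilon> * \<delta>) \<le> n * (4 * n * \<epsilon> * \<delta>)"
          using pos n0 by (intro mult_right_mono) auto
        then show ?thesis by (simp add: n_def[symmetric] algebra_simps)
      qed
      ultimately show ?thesis
        unfolding bc using pos g n0
        by (intro mult_mono add_mono) (auto intro!: sum_nonneg add_nonneg_nonneg simp: n_def)
    qed
    moreover have "block_map D (\<lambda>i j. E i j y) (\<lambda>i j. V i j y) l j
           - block_map D (\<lambda>i j. E i j y) (\<lambda>i j. V' i j y) l j = inverse (D $ j - D $ l) * (T1 y - T2 y)" for y
      using False
      by (simp add: block_map_def T1_def T2_def right_diff_distrib left_diff_distrib sum_subtractf sum.distrib)
    ultimately show ?thesis
      using power_series_bound_mono by simp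
  qed
qed

text \<open>Iteration from the zero matrix contracts with ratio 1/4 as long as the iterates have
  norm at most 2. The increments are bounded by powers of 1/4, and their partial sums in turn keep
  the iterates in that range; hence one joint induction for both bounds.\<close>

lemma block_map_fixed_point:
  fixes D :: "real^'n" and E :: "'n \<Rightarrow> 'n \<Rightarrow> 'a::euclidean_space \<Rightarrow> real"
  assumes r: "r > 0" and g: "g > 0" and gap: "\<And>i j. D $ i \<noteq> D $ j \<Longrightarrow> g \<le> \<bar>D $ i - D $ j\<bar>"
    and E: "\<And>i j. power_series_bound (E i j) x r \<epsilon>"
    and small: "block_const TYPE('n) g * \<epsilon> \<le> 1 / 4"
  obtains V where "\<And>i j. power_series_bound (V i j) x r 2"
    "\<And>i j y. y \<in> cube_at x r \<Longrightarrow> V i j y = block_map D (\<lambda>i j. E i j y) (\<lambda>i j. V i j y) i j"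
proof -
  define W where "W = rec_nat (\<lambda>_ _ _. 0) (\<lambda>_ V i j y. block_map D (\<lambda>i j. E i j y) (\<lambda>i j. V i j y) i j)"
  have W0: "W 0 i j y = 0" for i j y by (simp add: W_def)
  have WS: "W (Suc k) i j y = block_map D (\<lambda>i j. E i j y) (\<lambda>i j. W k i j y) i j" for k i j y
    by (simp add: W_def)
  have le2: "(\<Sum>m<k. (1 / 4) ^ m) \<le> (2::real)" for k
  proof -
    have "(\<Sum>m<k. (1 / 4) ^ m) * 3 = 4 - (1 / 4 :: real) ^ k * 4"
      using sum_gp_strict[of "1 / 4 :: real" k] by simp
    then show ?thesis using zero_le_power[of "1 / 4 :: real" k] by linarith
  qed
  have step: "(\<forall>i j. power_series_bound (\<lambda>y. W (Suc k) i j y - W k i j y) x r ((1 / 4) ^ k)) \<and>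
     (\<forall>i j. power_series_bound (W k i j) x r (\<Sum>m<k. (1 / 4) ^ m))" for k
  proof (induction k)
    case 0
    have "power_series_bound (\<lambda>_. if i = j then 1 else 0) x r 1" for i j :: 'n
      by (rule power_series_bound_mono[OF power_series_bound_const[OF r]]) auto
    moreover have "power_series_bound (\<lambda>_. 0) x r 0"
      using power_series_bound_const[OF r, of 0] by simp
    moreover have "W 0 = (\<lambda>_ _ _. 0)" by (intro ext W0)
    ultimately show ?case by (simp add: WS block_map_zero)
  next
    case (Suc k)
    have d: "power_series_bound (\<lambda>y. W (Suc k) i j y - W k i j y) x r ((1 / 4) ^ k)"
      and b: "power_series_bound (W k i j) x r (\<Sum>m<k. (1 / 4) ^ m)" for i j
      using Suc by auto
    have b': "power_series_bound (W (Suc k) i j) x r (\<Sum>m<Suc k. (1 / 4) ^ m)" for i j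
      using power_series_bound_add[OF r b[of i j] d[of i j]] by simp
    have "power_series_bound (\<lambda>y. block_map D (\<lambda>i j. E i j y) (\<lambda>i j. W (Suc k) i j y) i j
        - block_map D (\<lambda>i j. E i j y) (\<lambda>i j. W k i j y) i j) x r
        (block_const TYPE('n) g * \<epsilon> * (1 / 4) ^ k)" for i j
      by (rule block_map_lipschitz[OF r g gap E power_series_bound_mono[OF b' le2]
          power_series_bound_mono[OF b le2] d])
    then have "power_series_bound (\<lambda>y. W (Suc (Suc k)) i j y - W (Suc k) i j y) x r
        (block_const TYPE('n) g * \<epsilon> * (1 / 4) ^ k)" for i j
      unfolding WS[symmetric] .
    moreover have "block_const TYPE('n) g * \<epsilon> * (1 / 4) ^ k \<le> (1 / 4) ^ Suc k"
      using mult_right_mono[OF small, of "(1 / 4) ^ k"] by simp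
    ultimately show ?case using b' power_series_bound_mono by blast
  qed
  \<comment> \<open>The limit is written as a telescoping series so that the summable bounds on the
    increments pass to it.\<close>
  define V where "V i j y = (\<Sum>k. W (Suc k) i j y - W k i j y)" for i j y
  have abs_le: "norm (W (Suc k) i j y - W k i j y) \<le> (1 / 4) ^ k" if "y \<in> cube_at x r" for k i j y
    using power_series_bound_abs_le[OF _ that] step[of k] by fastforce
  have abs_sum: "summable (\<lambda>k. norm (W (Suc k) i j y - W k i j y))" if "y \<in> cube_at x r" for i j y
    by (rule summable_comparison_test'[where g = "\<lambda>k. (1 / 4) ^ k" and N = 0])
       (use abs_le[OF that] in auto)
  have sums: "(\<lambda>k. W (Suc k) i j y - W k i j y) sums V i j y" if "y \<in> cube_at x r" for i j y
    unfolding V_def using summable_norm_cancel[OF abs_sum[OF that]] by (rule summable_sums)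
  have lim: "(\<lambda>k. W k i j y) \<longlonglongrightarrow> V i j y" if "y \<in> cube_at x r" for i j y
    using sums[OF that, of i j] unfolding sums_def sum_lessThan_telescope[of "\<lambda>k. W k i j y"] W0 by simp
  have geo: "((\<lambda>k. (1 / 4 :: real) ^ k) has_sum (4 / 3)) UNIV"
    using norm_summable_imp_has_sum[OF _ geometric_sums[of "1 / 4 :: real"]] by simp
  show ?thesis
  proof
    fix i j
    have "power_series_bound (V i j) x r (4 / 3)"
    proof (rule power_series_bound_has_sum[OF r _ geo])
      show "power_series_bound (\<lambda>y. W (Suc k) i j y - W k i j y) x r ((1 / 4) ^ k)" for k
        using step by blast
      show "((\<lambda>k. W (Suc k) i j y - W k i j y) has_sum V i j y) UNIV" if "y \<in> cube_at x r" for y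
        using norm_summable_imp_has_sum[OF abs_sum[OF that] sums[OF that]] .
    qed
    then show "power_series_bound (V i j) x r 2" by (rule power_series_bound_mono) simp
    show "V i j y = block_map D (\<lambda>i j. E i j y) (\<lambda>i j. V i j y) i j" if y: "y \<in> cube_at x r" for y
    proof (rule LIMSEQ_unique[OF LIMSEQ_Suc[OF lim[OF y]]])
      show "(\<lambda>k. W (Suc k) i j y) \<longlonglongrightarrow> block_map D (\<lambda>i j. E i j y) (\<lambda>i j. V i j y) i j"
        unfolding WS block_map_def by (cases "D $ i = D $ j") (auto intro!: tendsto_intros lim[OF y])
    qed
  qed
qed

text \<open>\<open>block_map\<close> sends the zero matrix to the identity, so the Lipschitz
  estimate between V and 0 measures the distance of the fixed point from the identity; the factor 2
  is the bound on V.\<close>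

lemma block_map_fixed_point_near_id:
  fixes D :: "real^'n" and E V :: "'n \<Rightarrow> 'n \<Rightarrow> real"
  assumes g: "g > 0" and gap: "\<And>i j. D $ i \<noteq> D $ j \<Longrightarrow> g \<le> \<bar>D $ i - D $ j\<bar>"
    and E: "\<And>i j. \<bar>E i j\<bar> \<le> \<epsilon>" and V: "\<And>i j. \<bar>V i j\<bar> \<le> 2"
    and fixp: "\<And>i j. V i j = block_map D E V i j"
  shows "\<bar>V l j - (if l = j then 1 else 0)\<bar> \<le> block_const TYPE('n) g * \<epsilon> * 2"
proof -
  \<comment> \<open>Numbers enter the estimate for series as constant series in a dummy real
    variable.\<close>
  have c: "power_series_bound (\<lambda>_::real. a) 0 1 b" if "\<bar>a\<bar> \<le> b" for a b
    by (rule power_series_bound_mono[OF power_series_bound_const that]) simp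
  have "power_series_bound (\<lambda>_::real. block_map D E V l j - block_map D E (\<lambda>_ _. 0) l j) 0 1
      (block_const TYPE('n) g * \<epsilon> * 2)"
    using block_map_lipschitz[OF _ g gap, of 1 "\<lambda>i j _. E i j" "0::real" \<epsilon> "\<lambda>i j _. V i j" "\<lambda>_ _ _. 0" 2 l j]
    using E V c by simp
  from power_series_bound_abs_le[OF this cube_at_self] show ?thesis
    unfolding block_map_zero fixp[symmetric] by simp
qed

section \<open>Sorted spectra of symmetric matrices\<close>

lemma symmetric_matrix_inner:
  fixes X :: "real^'n^'n"
  assumes "transpose X = X"
  shows "(X *v u) \<bullet> v = u \<bullet> (X *v v)"
  using dot_lmul_matrix[of u X v] transpose_matrix_vector[of X u] assms by simp

text \<open>A maximiser v of the quadratic form on the unit sphere of W is an eigenvector: the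
  residual u of the eigenvalue equation lies in W and is orthogonal to v, and if it were nonzero,
  moving towards it would increase the form to first order.\<close>

lemma symmetric_matrix_eigenvector:
  fixes X :: "real^'n^'n"
  assumes sym: "transpose X = X" and W: "subspace W" "W \<noteq> {0}"
    and inv: "\<And>w. w \<in> W \<Longrightarrow> X *v w \<in> W"
  obtains v where "v \<in> W" "norm v = 1" "X *v v = (v \<bullet> (X *v v)) *\<^sub>R v"
proof -
  obtain w0 where w0: "w0 \<in> W" "w0 \<noteq> 0" using W subspace_0 by blast
  have "compact (W \<inter> sphere 0 1)"
    using closed_subspace[OF W(1)] by (simp add: closed_Int_compact)
  moreover have "w0 /\<^sub>R norm w0 \<in> W \<inter> sphere 0 1"
    using w0 W(1) by (simp add: subspace_scale)
  moreover have "continuous_on (W \<inter> sphere 0 1) (\<lambda>v. v \<bullet> (X *v v))"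
    by (intro continuous_intros matrix_vector_mult_linear_continuous_on)
  ultimately obtain v where v': "v \<in> W \<inter> sphere 0 1"
    and max': "\<forall>w\<in>W \<inter> sphere 0 1. w \<bullet> (X *v w) \<le> v \<bullet> (X *v v)"
    using continuous_attains_sup[of "W \<inter> sphere 0 1" "\<lambda>v. v \<bullet> (X *v v)"] by blast
  then have v: "v \<in> W" "norm v = 1"
    and max: "\<And>w. w \<in> W \<Longrightarrow> norm w = 1 \<Longrightarrow> w \<bullet> (X *v w) \<le> v \<bullet> (X *v v)" by auto
  define l where "l = v \<bullet> (X *v v)"
  define u where "u = X *v v - l *\<^sub>R v"
  have uW: "u \<in> W" unfolding u_def using inv[OF v(1)] v(1) W(1) by (simp add: subspace_diff subspace_scale)
  have vv: "v \<bullet> v = 1" using v(2) by (simp add: dot_square_norm)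
  have quad: "w \<bullet> (X *v w) \<le> l * (w \<bullet> w)" if "w \<in> W" for w
  proof (cases "w = 0")
    case False
    define z where "z = w /\<^sub>R norm w"
    have "z \<bullet> (X *v z) \<le> l"
      unfolding l_def using False that W(1) by (intro max) (auto simp: z_def subspace_scale)
    moreover have "w = norm w *\<^sub>R z" using False by (simp add: z_def)
    then have "w \<bullet> (X *v w) = (norm w)\<^sup>2 * (z \<bullet> (X *v z))"
      by (metis (no_types, lifting) inner_scaleR_left inner_scaleR_right matrix_vector_mult_scaleR mult.assoc power2_eq_square)
    ultimately show ?thesis
      by (simp add: dot_square_norm mult.commute mult_right_mono)
  qed simp
  have uv: "u \<bullet> v = 0" by (simp add: u_def l_def inner_diff_left inner_diff_right vv inner_commute)
  have uXv: "u \<bullet> (X *v v) = u \<bullet> u"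
    using uv by (simp add: u_def inner_diff_right)
  define c where "c = u \<bullet> (X *v u) - l * (u \<bullet> u)"
  have ineq: "2 * t * (u \<bullet> u) + t\<^sup>2 * c \<le> 0" for t
  proof -
    have "v + t *\<^sub>R u \<in> W" using v(1) uW W(1) by (simp add: subspace_add subspace_scale)
    from quad[OF this] have "l + 2 * t * (u \<bullet> (X *v v)) + t\<^sup>2 * (u \<bullet> (X *v u))
        \<le> l * (1 + t\<^sup>2 * (u \<bullet> u))"
      using symmetric_matrix_inner[OF sym, of v u] uv vv
      by (simp add: matrix_vector_right_distrib matrix_vector_mult_scaleR inner_add_left inner_add_right
          inner_commute power2_eq_square l_def algebra_simps)
    then show ?thesis unfolding c_def uXv by (simp add: algebra_simps)
  qed
  have "u \<bullet> u = 0"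
  proof (rule ccontr)
    assume "u \<bullet> u \<noteq> 0"
    then have a: "u \<bullet> u > 0" by simp
    \<comment> \<open>Small enough that the second order term \<open>t * c\<close> cannot outweigh
      \<open>2 * (u \<bullet> u)\<close>; the summand 1 keeps the denominator positive.\<close>
    define t where "t = (u \<bullet> u) / (1 + \<bar>c\<bar>)"
    have t: "t > 0" unfolding t_def using a by (simp add: add_pos_nonneg)
    have "t * \<bar>c\<bar> \<le> u \<bullet> u" unfolding t_def using a by (simp add: field_simps)
    moreover have "- (t * \<bar>c\<bar>) \<le> t * c" using mult_left_mono[of "- \<bar>c\<bar>" c t] t by simp
    ultimately have "2 * (u \<bullet> u) + t * c > 0" using a by linarith
    then have "t * (2 * (u \<bullet> u) + t * c) > 0" using t by simp
    then show False using ineq[of t] by (simp add: algebra_simps power2_eq_square)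
  qed
  then have "X *v v = l *\<^sub>R v" by (simp add: u_def)
  then show ?thesis using that v unfolding l_def by blast
qed

text \<open>By symmetry the orthogonal complement of an eigenvector inside W is again invariant; the
  formulation for subspaces lets the induction on the dimension descend to it.\<close>

lemma symmetric_matrix_eigenbasis_subspace:
  fixes X :: "real^'n^'n"
  assumes sym: "transpose X = X"
  shows "subspace W \<Longrightarrow> (\<And>w. w \<in> W \<Longrightarrow> X *v w \<in> W) \<Longrightarrow>
    \<exists>B. B \<subseteq> W \<and> finite B \<and> card B = dim W \<and> pairwise orthogonal B \<and>
      (\<forall>b\<in>B. norm b = 1 \<and> X *v b = (b \<bullet> (X *v b)) *\<^sub>R b)"
proof (induction "dim W" arbitrary: W)
  case 0
  then show ?case by (intro exI[of _ "{}"]) auto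
next
  case (Suc k)
  have "W \<noteq> {0}" using Suc.hyps(2) by force
  then obtain v where v: "v \<in> W" "norm v = 1" "X *v v = (v \<bullet> (X *v v)) *\<^sub>R v"
    using symmetric_matrix_eigenvector[OF sym Suc.prems(1) _ Suc.prems(2)] by metis
  define W' where "W' = {w\<in>W. \<forall>u\<in>span {v}. orthogonal u w}"
  have W'_iff: "w \<in> W' \<longleftrightarrow> w \<in> W \<and> v \<bullet> w = 0" for w
    unfolding W'_def orthogonal_def by (auto simp: span_singleton)
  have "span {v} \<subseteq> W" using v(1) Suc.prems(1) by (simp add: span_minimal)
  then have "dim W' + dim (span {v}) = dim W"
    unfolding W'_def by (intro dim_subspace_orthogonal_to_vectors) (use Suc.prems(1) in auto)
  moreover have "dim (span {v}) = 1" using v(2) by (auto simp: dim_singleton)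
  ultimately have dimW': "k = dim W'" using Suc.hyps(2) by simp
  have "subspace W'"
    using Suc.prems(1) by (auto simp: subspace_def W'_iff inner_add_right)
  moreover have "X *v w \<in> W'" if "w \<in> W'" for w
  proof -
    have "v \<bullet> (X *v w) = (X *v v) \<bullet> w" using symmetric_matrix_inner[OF sym] by simp
    also have "\<dots> = 0" using that by (subst v(3)) (simp add: W'_iff)
    finally show ?thesis using that Suc.prems(2) by (simp add: W'_iff)
  qed
  ultimately obtain B where B: "B \<subseteq> W'" "finite B" "card B = dim W'" "pairwise orthogonal B"
    "\<forall>b\<in>B. norm b = 1 \<and> X *v b = (b \<bullet> (X *v b)) *\<^sub>R b"
    using Suc.hyps(1)[OF dimW'] by blast
  have "v \<notin> B" using B(1) v(2) by (auto simp: W'_iff)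
  then show ?case
    using B v dimW' Suc.hyps(2)
    by (intro exI[of _ "insert v B"])
       (auto simp: W'_iff pairwise_insert orthogonal_def inner_commute subset_iff)
qed

text \<open>The rank in the order turns the abstract index type into positions of a list, so that a
  sorted list can be read as a vector in \<open>nonincr\<close>.\<close>

lemma bij_betw_card_less:
  "bij_betw (\<lambda>i::'n::{finite,linorder}. card {j. j < i}) UNIV {..<CARD('n)}"
proof -
  have mono: "card {j. j < i} < card {j. j < k}" if "i < k" for i k :: 'n
    using that by (intro psubset_card_mono) auto
  have "inj (\<lambda>i::'n. card {j. j < i})"
    by (rule linorder_injI) (metis mono less_irrefl)
  moreover have "card {j. j < i} < CARD('n)" for i :: 'n
    by (intro psubset_card_mono) auto
  ultimately show ?thesis
    by (intro bij_betw_imageI card_subset_eq) (auto simp: card_image)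
qed

lemma symmetric_matrix_sorted_eigenbasis:
  fixes X :: "real^'n::{finite,linorder}^'n::{finite,linorder}"
  assumes sym: "transpose X = X"
  obtains q :: "'n \<Rightarrow> real^'n::{finite,linorder}" and x where "\<And>i j. q i \<bullet> q j = (if i = j then 1 else 0)"
    "\<And>i. X *v q i = (x $ i) *\<^sub>R q i" "x \<in> nonincr"
proof -
  obtain B where B: "finite B" "card B = CARD('n)" "pairwise orthogonal B"
    "\<And>b. b \<in> B \<Longrightarrow> norm b = 1 \<and> X *v b = (b \<bullet> (X *v b)) *\<^sub>R b"
    using symmetric_matrix_eigenbasis_subspace[OF sym, of UNIV] by (auto simp: dim_UNIV)
  obtain l where l: "set l = B" "distinct l" using finite_distinct_list[OF B(1)] by blast
  \<comment> \<open>The minus sign turns ascending sorting into nonincreasing eigenvalues.\<close>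
  define f where "f b = - (b \<bullet> (X *v b))" for b
  define L where "L = sort_key f l"
  have L: "set L = B" "distinct L" "sorted (map f L)" using l by (auto simp: L_def)
  then have len: "length L = CARD('n)" using B(2) distinct_card by fastforce
  define rk where "rk i = card {j. j < i}" for i :: 'n
  have rk: "bij_betw rk UNIV {..<CARD('n)}" using bij_betw_card_less unfolding rk_def .
  have rk_lt: "rk i < length L" for i using rk len by (auto simp: bij_betw_def)
  define q where "q i = L ! rk i" for i
  have qB: "q i \<in> B" for i using rk_lt L(1) by (auto simp: q_def)
  have q_inj: "q i = q j \<longleftrightarrow> i = j" for i j
    using rk rk_lt L(2) by (auto simp: q_def nth_eq_iff_index_eq bij_betw_def inj_on_def)
  show ?thesis
  proof
    show "q i \<bullet> q j = (if i = j then 1 else 0)" for i j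
      using B(3,4) qB[of i] qB[of j] q_inj[of i j]
      by (auto simp: pairwise_def orthogonal_def dot_square_norm)
    show "X *v q i = ((\<chi> i. q i \<bullet> (X *v q i)) $ i) *\<^sub>R q i" for i
      using B(4)[OF qB] by simp
    have "f (q i) \<le> f (q j)" if "i \<le> j" for i j
    proof -
      have "rk i \<le> rk j" unfolding rk_def using that by (intro card_mono) auto
      then show ?thesis using sorted_nth_mono[OF L(3), of "rk i" "rk j"] rk_lt by (simp add: q_def)
    qed
    then show "(\<chi> i. q i \<bullet> (X *v q i)) \<in> nonincr"
      by (simp add: nonincr_def f_def)
  qed
qed

lemma charpoly_orthonormal_eigenbasis:
  fixes X :: "real^'n^'n" and q :: "'n \<Rightarrow> real^'n"
  assumes on: "\<And>i j. q i \<bullet> q j = (if i = j then 1 else 0)"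
    and eig: "\<And>i. X *v q i = (x $ i) *\<^sub>R q i"
  shows "det (mat t - X) = (\<Prod>i\<in>UNIV. t - x $ i)"
proof -
  define P :: "real^'n^'n" where "P = (\<chi> r c. q c $ r)"
  define D :: "real^'n^'n" where "D = (\<chi> i j. if i = j then t - x $ i else 0)"
  have "transpose P ** P = mat 1"
    using on by (simp add: P_def vec_eq_iff matrix_matrix_mult_def transpose_def mat_def inner_vec_def)
  then have "det P \<noteq> 0"
    by (metis det_mul det_I mult_zero_right zero_neq_one)
  have "((mat t - X) ** P) $ r $ c = (P ** D) $ r $ c" for r c
  proof -
    have "((mat t - X) ** P) $ r $ c = ((mat t - X) *v q c) $ r"
      by (simp add: matrix_matrix_mult_def matrix_vector_mult_def P_def)
    also have "mat t *v q c = t *\<^sub>R q c"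
      by (simp add: vec_eq_iff matrix_vector_mult_def mat_def if_distrib if_distribR cong: if_cong)
    then have "((mat t - X) *v q c) $ r = (t - x $ c) * q c $ r"
      by (simp add: matrix_vector_mult_diff_rdistrib eig algebra_simps)
    also have "\<dots> = (P ** D) $ r $ c"
      by (simp add: matrix_matrix_mult_def P_def D_def if_distrib if_distribR cong: if_cong)
    finally show ?thesis .
  qed
  then have "(mat t - X) ** P = P ** D" by (simp add: vec_eq_iff)
  then have "det (mat t - X) * det P = det P * det D" by (metis det_mul)
  then have "det (mat t - X) = det D" using \<open>det P \<noteq> 0\<close> by simp
  also have "\<dots> = (\<Prod>i\<in>UNIV. t - x $ i)"
    by (subst det_diagonal) (auto simp: D_def)
  finally show ?thesis .
qed

lemma size_filter_sum_singletons:
  "finite A \<Longrightarrow> size {#z \<in># (\<Sum>i\<in>A. {#f i#}). P z#} = card {i\<in>A. P (f i)}"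
proof (induction A rule: finite_induct)
  case (insert a A)
  have "{i \<in> insert a A. P (f i)} = (if P (f a) then insert a {i\<in>A. P (f i)} else {i\<in>A. P (f i)})"
    by auto
  then show ?case using insert by simp
qed simp

text \<open>Equal products are equal polynomials with equal root multisets, so superlevel sets of x
  and y have equal cardinality. For sorted vectors these sets are initial segments of the index
  order, hence nested, hence equal, and they determine the vector. This is the uniqueness behind the
  description operator in \<open>eigvals\<close>.\<close>

lemma nonincr_eqI:
  fixes x y :: "real^'n::{finite,linorder}"
  assumes x: "x \<in> nonincr" and y: "y \<in> nonincr"
    and eq: "\<And>t. (\<Prod>i\<in>UNIV. t - x $ i) = (\<Prod>i\<in>UNIV. t - y $ i)"
  shows "x = y"
proof -
  define p where "p z = (\<Prod>i\<in>UNIV. [:- z $ i, 1:])" for z :: "real^'n::{finite,linorder}"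
  have "poly (p z) t = (\<Prod>i\<in>UNIV. t - z $ i)" for z t
    by (simp add: p_def poly_prod)
  then have "poly (p x) = poly (p y)" using eq by auto
  then have pxy: "p x = p y" by (simp add: poly_eq_poly_eq_iff)
  have roots: "proots (p z) = (\<Sum>i\<in>UNIV. {#z $ i#})" for z
    unfolding p_def by (subst proots_prod) auto
  have card_eq: "card {i. x $ i > c} = card {i. y $ i > c}" for c
    using size_filter_sum_singletons[of UNIV "\<lambda>z. z > c" "\<lambda>i. x $ i"]
      size_filter_sum_singletons[of UNIV "\<lambda>z. z > c" "\<lambda>i. y $ i"] roots[of x] roots[of y] pxy
    by simp
  have set_eq: "{i. x $ i > c} = {i. y $ i > c}" for c
  proof -
    have down: "j \<in> {i. z $ i > c}" if "z \<in> nonincr" "i \<in> {i. z $ i > c}" "j \<le> i" for z :: "real^'n::{finite,linorder}" and i j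
      using that by (auto simp: nonincr_def intro: less_le_trans)
    have "{i. x $ i > c} \<subseteq> {i. y $ i > c} \<or> {i. y $ i > c} \<subseteq> {i. x $ i > c}"
      using down[OF x] down[OF y] by (meson linear subsetI)
    then show ?thesis
      using card_eq[of c] card_subset_eq[OF finite] by metis
  qed
  have "x $ i = y $ i" for i
  proof (rule ccontr)
    assume "x $ i \<noteq> y $ i"
    then consider "x $ i > y $ i" | "y $ i > x $ i" by linarith
    then show False using set_eq[of "x $ i"] set_eq[of "y $ i"] by cases auto
  qed
  then show ?thesis by (simp add: vec_eq_iff)
qed

section \<open>The ordered eigenvalue map and its continuity\<close>

lemma eigvals_eqI:
  assumes "x \<in> nonincr" "\<And>t. det (mat t - X) = (\<Prod>i\<in>UNIV. t - x $ i)"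
  shows "eigvals X = x"
  unfolding eigvals_def
proof (rule the_equality)
  show "x \<in> nonincr \<and> (\<forall>t. det (mat t - X) = (\<Prod>i\<in>UNIV. t - x $ i))" using assms by blast
  show "y = x" if "y \<in> nonincr \<and> (\<forall>t. det (mat t - X) = (\<Prod>i\<in>UNIV. t - y $ i))" for y
    using that assms by (intro nonincr_eqI) simp_all
qed

lemma eigvals_eigenbasis:
  fixes X :: "real^'n::{finite,linorder}^'n::{finite,linorder}"
  assumes "X \<in> sym_mats"
  obtains q :: "'n \<Rightarrow> real^'n::{finite,linorder}" where "\<And>i j. q i \<bullet> q j = (if i = j then 1 else 0)"
    "\<And>i. X *v q i = (eigvals X $ i) *\<^sub>R q i" "eigvals X \<in> nonincr"
    "\<And>t. det (mat t - X) = (\<Prod>i\<in>UNIV. t - eigvals X $ i)"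
proof -
  have "transpose X = X" using assms by (simp add: sym_mats_def)
  then obtain q :: "'n \<Rightarrow> real^'n::{finite,linorder}" and x where q: "\<And>i j. q i \<bullet> q j = (if i = j then 1 else 0)"
    "\<And>i. X *v q i = (x $ i) *\<^sub>R q i" "x \<in> nonincr"
    by (rule symmetric_matrix_sorted_eigenbasis) blast
  have d: "det (mat t - X) = (\<Prod>i\<in>UNIV. t - x $ i)" for t
    using charpoly_orthonormal_eigenbasis[OF q(1,2)] .
  then have "eigvals X = x" using eigvals_eqI q(3) by blast
  then show ?thesis using that[of q] q d by simp
qed

lemma abs_eigvals_le:
  fixes X :: "real^'n::{finite,linorder}^'n::{finite,linorder}"
  assumes "X \<in> sym_mats"
  shows "\<bar>eigvals X $ i\<bar> \<le> (\<Sum>i\<in>UNIV. \<Sum>j\<in>UNIV. \<bar>X $ i $ j\<bar>)"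
proof -
  obtain q :: "'n \<Rightarrow> real^'n::{finite,linorder}" where q: "\<And>i j. q i \<bullet> q j = (if i = j then 1 else 0)"
    "\<And>i. X *v q i = (eigvals X $ i) *\<^sub>R q i"
    using eigvals_eigenbasis[OF assms] by metis
  have nq: "norm (q i) = 1" using q(1)[of i i] by (simp add: norm_eq_1)
  have "\<bar>eigvals X $ i\<bar> = norm (X *v q i)" by (simp add: q(2) nq)
  also have "\<dots> \<le> onorm ((*v) X) * norm (q i)"
    by (intro onorm matrix_vector_mul_bounded_linear)
  also have "\<dots> \<le> (\<Sum>i\<in>UNIV. \<Sum>j\<in>UNIV. \<bar>X $ i $ j\<bar>)"
    using onorm_le_matrix_component_sum[of X] nq by simp
  finally show ?thesis .
qed

text \<open>Compactness: along a sequence violating continuity the spectra stay bounded, and a limit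
  of a subsequence is sorted and has the characteristic polynomial of A, so by uniqueness it is
  \<open>eigvals A\<close>.\<close>

lemma eigvals_continuous:
  fixes A :: "real^'n::{finite,linorder}^'n::{finite,linorder}"
  assumes A: "A \<in> sym_mats"
  shows "continuous (at A within sym_mats) eigvals"
proof (rule ccontr)
  assume "\<not> ?thesis"
  then obtain e where e: "e > 0"
    and bad: "\<And>d. d > 0 \<Longrightarrow> \<exists>X\<in>sym_mats. dist X A < d \<and> dist (eigvals X) (eigvals A) \<ge> e"
    unfolding continuous_within_eps_delta by (meson not_le)
  have "\<exists>X. \<forall>k. X k \<in> sym_mats \<and> dist (X k) A < 1 / real (Suc k) \<and> dist (eigvals (X k)) (eigvals A) \<ge> e"
    using bad[of "1 / real (Suc _)"] by (intro choice) (auto simp: Bex_def)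
  then obtain X where X: "\<And>k. X k \<in> sym_mats" "\<And>k. dist (X k) A < 1 / real (Suc k)"
    "\<And>k. dist (eigvals (X k)) (eigvals A) \<ge> e" by blast
  have lim: "X \<longlonglongrightarrow> A"
  proof (rule metric_tendsto_imp_tendsto[OF LIMSEQ_inverse_real_of_nat], intro always_eventually allI)
    show "dist (X k) A \<le> dist (inverse (real (Suc k))) 0" for k
      using X(2)[of k] by (simp add: inverse_eq_divide)
  qed
  have "(\<lambda>k. \<Sum>i\<in>UNIV. \<Sum>j\<in>UNIV. \<bar>X k $ i $ j\<bar>) \<longlonglongrightarrow> (\<Sum>i\<in>UNIV. \<Sum>j\<in>UNIV. \<bar>A $ i $ j\<bar>)"
    by (intro tendsto_intros lim)
  then have "Bseq (\<lambda>k. \<Sum>i\<in>UNIV. \<Sum>j\<in>UNIV. \<bar>X k $ i $ j\<bar>)"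
    by (intro convergent_imp_Bseq convergentI)
  then obtain K where K: "\<And>k. \<bar>\<Sum>i\<in>UNIV. \<Sum>j\<in>UNIV. \<bar>X k $ i $ j\<bar>\<bar> \<le> K"
    unfolding Bseq_def real_norm_def by blast
  have "\<bar>eigvals (X k) $ i\<bar> \<le> K" for k i
    using abs_eigvals_le[OF X(1), of k i] K[of k] by linarith
  then have "norm (eigvals (X k)) \<le> CARD('n) * K" for k
    by (intro order_trans[OF norm_le_l1_cart] order_trans[OF sum_bounded_above[of _ _ K]]) auto
  then have "bounded (range (\<lambda>k. eigvals (X k)))" by (auto simp: bounded_iff)
  then obtain l r where r: "strict_mono r" and l: "((\<lambda>k. eigvals (X k)) \<circ> r) \<longlonglongrightarrow> l"
    using bounded_imp_convergent_subsequence by blast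
  have Xr: "(X \<circ> r) \<longlonglongrightarrow> A" using lim r by (rule LIMSEQ_subseq_LIMSEQ)
  have l': "(\<lambda>k. eigvals (X (r k)) $ i) \<longlonglongrightarrow> l $ i" for i
    using l by (intro tendsto_vec_nth) (simp add: o_def)
  have "l $ j \<le> l $ i" if "i \<le> j" for i j
  proof (rule LIMSEQ_le[OF l' l'], intro exI[of _ 0] allI impI)
    fix k
    have "eigvals (X (r k)) \<in> nonincr" using eigvals_eigenbasis[OF X(1)] .
    then show "eigvals (X (r k)) $ j \<le> eigvals (X (r k)) $ i"
      using that by (simp add: nonincr_def)
  qed
  then have "l \<in> nonincr" by (simp add: nonincr_def)
  moreover have "det (mat t - A) = (\<Prod>i\<in>UNIV. t - l $ i)" for t
  proof (rule LIMSEQ_unique)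
    show "(\<lambda>k. det (mat t - X (r k))) \<longlonglongrightarrow> det (mat t - A)"
      unfolding det_def using Xr by (intro tendsto_intros) (simp add: o_def)
    have "det (mat t - X (r k)) = (\<Prod>i\<in>UNIV. t - eigvals (X (r k)) $ i)" for k
      using eigvals_eigenbasis[OF X(1)] .
    then show "(\<lambda>k. det (mat t - X (r k))) \<longlonglongrightarrow> (\<Prod>i\<in>UNIV. t - l $ i)"
      by (simp, intro tendsto_intros l')
  qed
  ultimately have "eigvals A = l" by (rule eigvals_eqI)
  then have "(\<lambda>k. dist (eigvals (X (r k))) (eigvals A)) \<longlonglongrightarrow> 0"
    using tendsto_dist[OF l tendsto_const[of l]] by (simp add: o_def)
  then have "e \<le> 0" by (rule LIMSEQ_le_const) (use X(3) in auto)
  then show False using e by simp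
qed

section \<open>Coinciding eigenvalues of a block diagonalised matrix\<close>

lemma abs_sum_max_le:
  fixes a c :: "'n::finite \<Rightarrow> real"
  assumes "\<And>i. i \<in> I \<Longrightarrow> \<bar>a i\<bar> \<le> A" "\<And>i. i \<in> I \<Longrightarrow> \<bar>c i\<bar> \<le> C" "0 \<le> A" "0 \<le> C"
  shows "\<bar>\<Sum>i\<in>I. a i * c i\<bar> \<le> real CARD('n) * A * C"
proof -
  have "\<bar>\<Sum>i\<in>I. a i * c i\<bar> \<le> (\<Sum>i\<in>I. A * C)"
    by (rule order_trans[OF sum_abs sum_mono]) (use assms in \<open>auto simp: abs_mult intro!: mult_mono\<close>)
  also have "\<dots> = real (card I) * (A * C)" by simp
  also have "\<dots> \<le> real CARD('n) * (A * C)"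
    using assms(3,4) by (intro mult_right_mono) (auto intro: card_mono)
  finally show ?thesis by (simp add: mult.assoc)
qed

lemma matrix_vector_mult_sum_columns:
  fixes A :: "real^'n^'m"
  shows "A *v c = (\<Sum>j\<in>UNIV. (c $ j) *\<^sub>R column j A)"
  by (simp add: vec_eq_iff matrix_vector_mult_def column_def mult.commute)

text \<open>\<open>small_V\<close> makes the matrix of V close enough to the identity to be
  invertible. \<open>small_E\<close> bounds row sums, which keeps the spectrum of each diagonal
  block of L within half a gap of its entry of D. Together with \<open>near\<close> this attaches
  every eigenvalue of Y to one block.\<close>

locale block_diagonalised =
  fixes Y :: "real^'n::{finite,linorder}^'n::{finite,linorder}"
    and D :: "real^'n::{finite,linorder}"
    and V :: "'n::{finite,linorder} \<Rightarrow> 'n::{finite,linorder} \<Rightarrow> real" and g \<epsilon> :: real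
  assumes sym: "Y \<in> sym_mats"
    and g: "g > 0" and gap: "\<And>i j. D $ i \<noteq> D $ j \<Longrightarrow> g \<le> \<bar>D $ i - D $ j\<bar>"
    and E_le: "\<And>i j. \<bar>Y $ i $ j - (if i = j then D $ i else 0)\<bar> \<le> \<epsilon>"
    and V_le: "\<And>i j. \<bar>V i j\<bar> \<le> 2"
    and fixp: "\<And>i j. V i j = block_map D (\<lambda>i j. Y $ i $ j - (if i = j then D $ i else 0)) V i j"
    and small_V: "real CARD('n) * (block_const TYPE('n) g * \<epsilon> * 2) < 1"
    and small_E: "real CARD('n) * (real CARD('n) * \<epsilon> * 2) < g / 2"
    and near: "\<And>i. \<bar>eigvals Y $ i - D $ i\<bar> < g / 2"
begin

definition Ve where "Ve = (\<chi> i j. V i j)"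

definition EV :: "'n \<Rightarrow> 'n \<Rightarrow> real" where
  "EV i j = (\<Sum>k\<in>UNIV. (Y $ i $ k - (if i = k then D $ i else 0)) * V k j)"

definition L where
  "L = (\<chi> i j. if D $ i = D $ j then (if i = j then D $ i else 0) + EV i j else 0)"

lemma \<epsilon>_nonneg: "0 \<le> \<epsilon>"
  using E_le abs_ge_zero order_trans by blast

lemma EV_le: "\<bar>EV i j\<bar> \<le> real CARD('n) * \<epsilon> * 2"
  unfolding EV_def by (rule abs_sum_max_le) (use E_le V_le \<epsilon>_nonneg in auto)

lemma V_block: "D $ i = D $ j \<Longrightarrow> V i j = (if i = j then 1 else 0)"
  by (subst fixp) (simp add: block_map_def)

lemma YV_entry: "(\<Sum>k\<in>UNIV. Y $ i $ k * V k j) = D $ i * V i j + EV i j"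
proof -
  have "EV i j = (\<Sum>k\<in>UNIV. Y $ i $ k * V k j - (if k = i then D $ i * V i j else 0))"
    unfolding EV_def by (intro sum.cong) (auto simp: left_diff_distrib)
  then show ?thesis by (simp add: sum_subtractf)
qed

text \<open>Outside the blocks this is the fixed point equation multiplied by
  \<open>D $ j - D $ i\<close>; inside them V is the identity and the claim reduces to the
  definition of L.\<close>

lemma YV_eq_VL: "Y ** Ve = Ve ** L"
proof -
  have "(Ve ** L) $ i $ j = (Y ** Ve) $ i $ j" for i j
  proof -
    have "(Ve ** L) $ i $ j = (\<Sum>k\<in>UNIV. if D $ k = D $ j then V i k * ((if k = j then D $ k else 0) + EV k j) else 0)"
      by (simp add: matrix_matrix_mult_def Ve_def L_def if_distrib cong: if_cong)
    also have "\<dots> = (\<Sum>k | D $ k = D $ j. V i k * ((if k = j then D $ k else 0) + EV k j))"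
      by (simp add: sum.If_cases)
    also have "\<dots> = (\<Sum>k | D $ k = D $ j. if k = j then V i j * D $ j else 0) + (\<Sum>k | D $ k = D $ j. V i k * EV k j)"
      by (subst sum.distrib[symmetric]) (auto intro!: sum.cong simp: distrib_left)
    also have "\<dots> = V i j * D $ j + (\<Sum>k | D $ k = D $ j. V i k * EV k j)"
      by simp
    also have "\<dots> = D $ i * V i j + EV i j"
    proof (cases "D $ i = D $ j")
      case True
      have "(\<Sum>k | D $ k = D $ j. V i k * EV k j) = (\<Sum>k | D $ k = D $ j. if k = i then EV i j else 0)"
        using V_block True by (intro sum.cong) auto
      then show ?thesis using True by simp
    next
      case False
      have "V i j = inverse (D $ j - D $ i) * (EV i j - (\<Sum>k | D $ k = D $ j. V i k * EV k j))"
        using False by (subst fixp) (simp add: block_map_def EV_def)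
      then have "(D $ j - D $ i) * V i j = EV i j - (\<Sum>k | D $ k = D $ j. V i k * EV k j)"
        using False by (simp add: field_simps)
      then show ?thesis by (simp add: algebra_simps)
    qed
    also have "\<dots> = (Y ** Ve) $ i $ j"
      unfolding YV_entry[symmetric] by (simp add: matrix_matrix_mult_def Ve_def)
    finally show ?thesis .
  qed
  then show ?thesis by (simp add: vec_eq_iff)
qed

text \<open>At a coordinate of c of largest absolute value, the deviation of V from the identity is
  too small to cancel it.\<close>

lemma Ve_inj: "Ve *v c = 0 \<Longrightarrow> c = 0"
proof (rule ccontr)
  assume Vc: "Ve *v c = 0" and "c \<noteq> 0"
  define m where "m = Max (range (\<lambda>j. \<bar>c $ j\<bar>))"
  have "m \<in> range (\<lambda>j. \<bar>c $ j\<bar>)" unfolding m_def by (rule Max_in) auto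
  then obtain j where j: "\<bar>c $ j\<bar> = m" by auto
  have le: "\<bar>c $ i\<bar> \<le> m" for i unfolding m_def by (rule Max_ge) auto
  obtain i0 where "c $ i0 \<noteq> 0" using \<open>c \<noteq> 0\<close> by (auto simp: vec_eq_iff)
  then have "m > 0" using le[of i0] by linarith
  define W where "W i = V j i - (if j = i then 1 else 0)" for i
  have W: "\<bar>W i\<bar> \<le> block_const TYPE('n) g * \<epsilon> * 2" for i
    unfolding W_def by (rule block_map_fixed_point_near_id[OF g gap E_le V_le fixp])
  have "(Ve *v c) $ j = (\<Sum>i\<in>UNIV. W i * c $ i) + (\<Sum>i\<in>UNIV. (if j = i then c $ i else 0))"
    unfolding sum.distrib[symmetric] matrix_vector_mult_def
    by (auto simp: Ve_def W_def algebra_simps intro!: sum.cong)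
  then have "c $ j = - (\<Sum>i\<in>UNIV. W i * c $ i)" using Vc by simp
  moreover have "\<bar>\<Sum>i\<in>UNIV. W i * c $ i\<bar> \<le> real CARD('n) * (block_const TYPE('n) g * \<epsilon> * 2) * m"
    using le W \<open>m > 0\<close> order_trans[OF abs_ge_zero W] by (intro abs_sum_max_le) auto
  ultimately have "m \<le> real CARD('n) * (block_const TYPE('n) g * \<epsilon> * 2) * m" using j by simp
  then show False using small_V \<open>m > 0\<close> by simp
qed

lemma Ve_surj: "\<exists>c. Ve *v c = w"
proof -
  have "inj ((*v) Ve)"
    using Ve_inj by (simp add: linear_injective_0[OF matrix_vector_mul_linear])
  then have "surj ((*v) Ve)"
    by (rule linear_inj_imp_surj[OF matrix_vector_mul_linear])
  then show ?thesis by (metis surjD)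
qed

lemma column_Ve_independent:
  shows "inj (\<lambda>j. column j Ve)" "independent ((\<lambda>j. column j Ve) ` I)"
proof -
  have ax: "column j Ve = Ve *v axis j 1" for j
    by (simp add: matrix_vector_mul_component column_def vec_eq_iff matrix_vector_mult_def axis_def
        if_distrib cong: if_cong)
  show inj: "inj (\<lambda>j. column j Ve)"
  proof (rule injI)
    fix i j assume "column i Ve = column j Ve"
    then have "Ve *v (axis i 1 - axis j 1) = 0" by (simp add: ax matrix_vector_mult_diff_distrib)
    then have "axis i 1 - axis j (1::real) = 0" by (rule Ve_inj)
    then show "i = j" by (simp add: axis_eq_axis)
  qed
  have "independent (range (\<lambda>j. column j Ve))"
  proof (rule independent_if_scalars_zero)
    fix f :: "real^'n::{finite,linorder} \<Rightarrow> real" and x :: "real^'n::{finite,linorder}"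
    assume "(\<Sum>x\<in>range (\<lambda>j. column j Ve). f x *\<^sub>R x) = 0" and x: "x \<in> range (\<lambda>j. column j Ve)"
    then have "(\<Sum>j\<in>UNIV. f (column j Ve) *\<^sub>R column j Ve) = 0"
      by (subst (asm) sum.reindex[OF inj]) (simp add: o_def)
    then have "Ve *v (\<chi> j. f (column j Ve)) = 0" by (simp add: matrix_vector_mult_sum_columns)
    then have "(\<chi> j. f (column j Ve)) = 0" by (rule Ve_inj)
    then show "f x = 0" using x by (auto simp: vec_eq_iff)
  qed simp
  then show "independent ((\<lambda>j. column j Ve) ` I)"
    by (rule independent_mono) auto
qed

lemma Y_column: "Y *v column j Ve = (\<Sum>i | D $ i = D $ j. L $ i $ j *\<^sub>R column i Ve)"
proof -
  have "Y *v column j Ve = column j (Y ** Ve)"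
    by (simp add: vec_eq_iff column_def matrix_vector_mult_def matrix_matrix_mult_def)
  also have "\<dots> = (\<Sum>i\<in>UNIV. L $ i $ j *\<^sub>R column i Ve)"
    unfolding YV_eq_VL by (simp add: vec_eq_iff column_def matrix_matrix_mult_def mult.commute)
  also have "\<dots> = (\<Sum>i | D $ i = D $ j. L $ i $ j *\<^sub>R column i Ve)"
    by (rule sum.mono_neutral_right) (auto simp: L_def)
  finally show ?thesis .
qed

text \<open>S and G represent Y and the identity on the columns. As these are not orthonormal, the
  eigenvalues of Y on the span of a block are those of the pencil S - \<open>\<mu>\<close>
  G.\<close>

definition S :: "'n \<Rightarrow> 'n \<Rightarrow> real" where "S i j = column i Ve \<bullet> (Y *v column j Ve)"
definition G :: "'n \<Rightarrow> 'n \<Rightarrow> real" where "G i j = column i Ve \<bullet> column j Ve"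

lemma G_diag_pos: "G i i > 0"
  unfolding G_def using V_block[of i i] by (auto simp: vec_eq_iff column_def Ve_def intro!: exI[of _ i])

lemma S_commute: "S i j = S j i"
  using symmetric_matrix_inner[of Y "column i Ve" "column j Ve"] sym
  by (simp add: S_def sym_mats_def inner_commute)

text \<open>If the eigenvalues of the block agree, the block columns span their eigenspace, so S is
  a multiple of G on the block. Conversely, proportionality makes the block columns eigenvectors for
  a single value, and a dimension count in an eigenbasis of Y leaves no room for another eigenvalue
  in the block.\<close>

lemma eigvals_const_on_block_iff:
  "(\<forall>i. D $ i = D $ a \<longrightarrow> eigvals Y $ i = eigvals Y $ a) \<longleftrightarrow>
   (\<forall>i j. D $ i = D $ a \<and> D $ j = D $ a \<longrightarrow> S i j * G a a = S a a * G i j)"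
proof -
  define I where "I = {i. D $ i = D $ a}"
  define v where "v j = column j Ve" for j
  obtain q :: "'n \<Rightarrow> real^'n::{finite,linorder}" where q: "\<And>i j. q i \<bullet> q j = (if i = j then 1 else 0)"
    and Yq: "\<And>i. Y *v q i = (eigvals Y $ i) *\<^sub>R q i"
    using eigvals_eigenbasis[OF sym] by metis
  have q_ne: "q i \<noteq> q j" if "i \<noteq> j" for i j
    using q[of i j] q[of i i] that by auto
  have q_inj: "inj q" using q_ne by (auto simp: inj_on_def)
  have q_ind: "independent (q ` J)" for J
  proof (rule pairwise_orthogonal_independent)
    show "pairwise orthogonal (q ` J)" using q by (auto simp: pairwise_def orthogonal_def)
    show "0 \<notin> q ` J" using q by (metis imageE inner_zero_left zero_neq_one)
  qed
  show ?thesis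
  proof
    assume const: "\<forall>i. D $ i = D $ a \<longrightarrow> eigvals Y $ i = eigvals Y $ a"
    define \<mu> where "\<mu> = eigvals Y $ a"
    \<comment> \<open>The coefficient vector of w is an eigenvector of L. At its largest entry
      outside the block of a, the row sum bound would put \<open>\<mu>\<close> within half a gap of
      the entry of D there, whereas \<open>\<mu>\<close> is that close to
      \<open>D $ a\<close>.\<close>
    have sub: "w \<in> span (v ` I)" if w: "Y *v w = \<mu> *\<^sub>R w" for w
    proof -
      obtain c where c: "Ve *v c = w" using Ve_surj by blast
      have "Ve *v (L *v c) = Y *v (Ve *v c)"
        unfolding matrix_vector_mul_assoc YV_eq_VL ..
      then have "Ve *v (L *v c - \<mu> *\<^sub>R c) = Y *v w - \<mu> *\<^sub>R w"
        unfolding matrix_vector_mult_diff_distrib matrix_vector_mult_scaleR c by simp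
      then have "Ve *v (L *v c - \<mu> *\<^sub>R c) = 0" using w by simp
      then have "L *v c - \<mu> *\<^sub>R c = 0" by (rule Ve_inj)
      then have Lc: "(L *v c) $ j = \<mu> * c $ j" for j by (simp add: vec_eq_iff)
      have zero: "c $ j = 0" if "j \<notin> I" for j
      proof (rule ccontr)
        assume "c $ j \<noteq> 0"
        define m where "m = Max ((\<lambda>j. \<bar>c $ j\<bar>) ` (- I))"
        have "m \<in> (\<lambda>j. \<bar>c $ j\<bar>) ` (- I)" unfolding m_def using that by (intro Max_in) auto
        then obtain k where k: "k \<notin> I" "\<bar>c $ k\<bar> = m" by auto
        have le: "\<bar>c $ i\<bar> \<le> m" if "i \<notin> I" for i unfolding m_def using that by (intro Max_ge) auto
        have m: "m > 0" using le[OF that] \<open>c $ j \<noteq> 0\<close> by linarith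
        have "(L *v c) $ k = (\<Sum>i\<in>UNIV. if D $ k = D $ i then (if i = k then D $ k * c $ k else 0) + EV k i * c $ i else 0)"
          unfolding matrix_vector_mult_def by (auto simp: L_def distrib_right intro!: sum.cong)
        also have "\<dots> = (\<Sum>i | D $ k = D $ i. (if i = k then D $ k * c $ k else 0) + EV k i * c $ i)"
          by (simp add: sum.If_cases)
        also have "\<dots> = D $ k * c $ k + (\<Sum>i | D $ k = D $ i. EV k i * c $ i)"
          by (simp add: sum.distrib)
        finally have "(\<mu> - D $ k) * c $ k = (\<Sum>i | D $ k = D $ i. EV k i * c $ i)"
          using Lc[of k] by (simp add: algebra_simps)
        moreover have "\<bar>\<Sum>i | D $ k = D $ i. EV k i * c $ i\<bar> \<le> real CARD('n) * (real CARD('n) * \<epsilon> * 2) * m"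
          using EV_le le k(1) m \<epsilon>_nonneg by (intro abs_sum_max_le) (auto simp: I_def)
        ultimately have "\<bar>\<mu> - D $ k\<bar> * m \<le> real CARD('n) * (real CARD('n) * \<epsilon> * 2) * m"
          using k(2) by (metis abs_mult)
        then have "\<bar>\<mu> - D $ k\<bar> < g / 2"
          using mult_right_le_imp_le[OF _ m] small_E by (meson le_less_trans)
        moreover have "\<bar>\<mu> - D $ a\<bar> < g / 2" using near[of a] by (simp add: \<mu>_def)
        moreover have "g \<le> \<bar>D $ k - D $ a\<bar>" using k(1) by (intro gap) (simp add: I_def)
        ultimately show False by linarith
      qed
      have "w = (\<Sum>j\<in>UNIV. (c $ j) *\<^sub>R v j)"
        unfolding v_def matrix_vector_mult_sum_columns[symmetric] c ..
      also have "\<dots> = (\<Sum>j\<in>I. (c $ j) *\<^sub>R v j)"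
        by (rule sum.mono_neutral_right) (use zero in auto)
      also have "\<dots> \<in> span (v ` I)"
        by (intro span_sum span_scale span_base) auto
      finally show ?thesis .
    qed
    have Yq_I: "Y *v q i = \<mu> *\<^sub>R q i" if "i \<in> I" for i
    proof -
      have "eigvals Y $ i = \<mu>" using const[rule_format, of i] that by (simp add: I_def \<mu>_def)
      then show ?thesis by (simp add: Yq)
    qed
    then have "q ` I \<subseteq> span (v ` I)" using sub by blast
    then have "span (q ` I) \<subseteq> span (v ` I)" by (simp add: span_minimal)
    moreover have "dim (span (v ` I)) \<le> dim (span (q ` I))"
    proof -
      have "dim (span (v ` I)) \<le> card I"
        using dim_le_card'[of "v ` I"] card_image_le[of I v] by (simp add: dim_span)
      also have "\<dots> = dim (span (q ` I))"
        using q_ind[of I] card_image[OF inj_on_subset[OF q_inj], of I] by (simp add: dim_span dim_eq_card_independent)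
      finally show ?thesis .
    qed
    ultimately have eq: "span (q ` I) = span (v ` I)"
      by (intro subspace_dim_equal) auto
    have "subspace {w. Y *v w = \<mu> *\<^sub>R w}"
      by (auto simp: subspace_def matrix_vector_right_distrib matrix_vector_mult_scaleR scaleR_add_right)
    moreover have "q ` I \<subseteq> {w. Y *v w = \<mu> *\<^sub>R w}"
      using Yq_I by blast
    ultimately have "span (v ` I) \<subseteq> {w. Y *v w = \<mu> *\<^sub>R w}"
      using span_minimal eq by blast
    then have "Y *v v j = \<mu> *\<^sub>R v j" if "j \<in> I" for j
      using span_base[of "v j" "v ` I"] that by blast
    then have S_eq: "S i j = \<mu> * G i j" if "j \<in> I" for i j
      using that by (simp add: S_def G_def v_def)
    have "S i j * G a a = S a a * G i j" if "D $ j = D $ a" for i j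
      using S_eq[of a a] S_eq[of j i] that by (simp add: I_def)
    then show "\<forall>i j. D $ i = D $ a \<and> D $ j = D $ a \<longrightarrow> S i j * G a a = S a a * G i j"
      by blast
  next
    assume eqs: "\<forall>i j. D $ i = D $ a \<and> D $ j = D $ a \<longrightarrow> S i j * G a a = S a a * G i j"
    define \<mu> where "\<mu> = S a a / G a a"
    have Saa: "S i j = \<mu> * G i j" if "i \<in> I" "j \<in> I" for i j
      using eqs[rule_format, of i j] that G_diag_pos[of a] by (simp add: \<mu>_def I_def field_simps)
    have Yv: "Y *v v j = \<mu> *\<^sub>R v j" if j: "j \<in> I" for j
    proof -
      define w where "w = Y *v v j - \<mu> *\<^sub>R v j"
      have vw: "v i \<bullet> w = 0" if "i \<in> I" for i
        using Saa[OF that j] by (simp add: w_def v_def S_def G_def inner_diff_right)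
      have "Y *v v j \<in> span (v ` I)"
        unfolding v_def Y_column
        by (rule span_sum, rule span_scale, rule span_base) (use j in \<open>auto simp: I_def\<close>)
      then have "w \<in> span (v ` I)"
        unfolding w_def using j by (intro span_diff span_scale) (auto intro: span_base)
      \<comment> \<open>The residual lies in the span of the block columns and is orthogonal to each
        of them.\<close>
      then have "orthogonal w w"
        by (rule orthogonal_to_span) (use vw in \<open>auto simp: orthogonal_def inner_commute\<close>)
      then show ?thesis by (simp add: w_def orthogonal_self)
    qed
    \<comment> \<open>Coordinate a of \<open>v a\<close> is 1 by the normalisation of V, so reading
      this coordinate of the eigenvalue equation locates \<open>\<mu>\<close> near
      \<open>D $ a\<close>.\<close>
    have "(Y *v v a) $ a = D $ a + EV a a"
      using YV_entry[of a a] V_block[of a a]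
      by (simp add: v_def matrix_vector_mult_def column_def Ve_def)
    moreover have "(v a) $ a = 1" using V_block[of a a] by (simp add: v_def column_def Ve_def)
    ultimately have "\<mu> = D $ a + EV a a" using Yv[of a] by (simp add: I_def)
    moreover have "real CARD('n) * \<epsilon> * 2 \<le> real CARD('n) * (real CARD('n) * \<epsilon> * 2)"
      using \<epsilon>_nonneg mult_right_mono[of 1 "real CARD('n)" "real CARD('n) * \<epsilon> * 2"] by (simp add: Suc_leI)
    ultimately have \<mu>: "\<bar>\<mu> - D $ a\<bar> < g / 2"
      using EV_le[of a a] small_E by linarith
    define K where "K = {i. eigvals Y $ i = \<mu>}"
    have "K \<subseteq> I"
    proof
      fix i assume "i \<in> K"
      then have "\<bar>\<mu> - D $ i\<bar> < g / 2" using near[of i] by (auto simp: K_def)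
      then have "\<not> g \<le> \<bar>D $ i - D $ a\<bar>" using \<mu> by linarith
      then show "i \<in> I" using gap[of i a] by (auto simp: I_def)
    qed
    \<comment> \<open>In the eigenbasis only components with eigenvalue \<open>\<mu>\<close>
      survive. The independent columns indexed by I thus force K, a subset of I, to be all of
      I.\<close>
    have "v j \<in> span (q ` K)" if j: "j \<in> I" for j
    proof -
      have span_q: "span (range q) = UNIV"
        using q_ind[of UNIV] card_image[OF q_inj] dim_eq_full[of "range q"]
        by (simp add: dim_eq_card_independent)
      have "(v j \<bullet> q i) = 0" if "i \<notin> K" for i
      proof -
        have "eigvals Y $ i * (v j \<bullet> q i) = v j \<bullet> (Y *v q i)" by (simp add: Yq)
        also have "\<dots> = (Y *v v j) \<bullet> q i"
          using symmetric_matrix_inner[of Y "v j" "q i"] sym by (simp add: sym_mats_def)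
        also have "\<dots> = \<mu> * (v j \<bullet> q i)" using Yv[OF j] by simp
        finally show ?thesis using that by (auto simp: K_def)
      qed
      moreover have "v j = (\<Sum>i\<in>UNIV. (v j \<bullet> q i) *\<^sub>R q i)"
      proof -
        define z where "z = v j - (\<Sum>i\<in>UNIV. (v j \<bullet> q i) *\<^sub>R q i)"
        have "z \<bullet> q k = 0" for k
          by (simp add: z_def inner_diff_left inner_sum_left q if_distrib cong: if_cong)
        then have "orthogonal z z"
          using orthogonal_to_span[of z "range q" z] span_q by (auto simp: orthogonal_def)
        then show ?thesis by (simp add: z_def orthogonal_self)
      qed
      ultimately have "v j = (\<Sum>i\<in>K. (v j \<bullet> q i) *\<^sub>R q i)"
        using sum.mono_neutral_right[of UNIV K "\<lambda>i. (v j \<bullet> q i) *\<^sub>R q i"] by simp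
      also have "\<dots> \<in> span (q ` K)" by (intro span_sum span_scale span_base) auto
      finally show ?thesis .
    qed
    then have "v ` I \<subseteq> span (q ` K)" by blast
    then have "card (v ` I) \<le> card (q ` K)"
      using independent_span_bound[of "q ` K" "v ` I"] column_Ve_independent(2)[of I] by (simp add: v_def)
    also have "card (q ` K) \<le> card K" by (simp add: card_image_le)
    also have "card (v ` I) = card I"
      unfolding v_def by (intro card_image inj_on_subset[OF column_Ve_independent(1)]) auto
    finally have "card I \<le> card K" .
    then have "K = I" using \<open>K \<subseteq> I\<close> by (intro card_seteq) auto
    then have "eigvals Y $ i = \<mu>" if "D $ i = D $ a" for i
      using that by (auto simp: K_def I_def)
    then show "\<forall>i. D $ i = D $ a \<longrightarrow> eigvals Y $ i = eigvals Y $ a" by simp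
  qed
qed

end

section \<open>Charts of submanifolds\<close>

text \<open>\<open>\<Phi>\<close> straightens M near x onto the subspace T and has the identity as
  its derivative on T at x. \<open>transverse\<close> is the graph property: within U a point of M
  is determined by its orthogonal projection to T. The symmetry arguments rest on it.\<close>

locale submanifold_chart =
  fixes M :: "(real^'n) set" and d :: nat and x :: "real^'n"
    and U :: "(real^'n) set" and \<Phi> :: "real^'n \<Rightarrow> real^'n" and \<Phi>' :: "real^'n \<Rightarrow> ((real^'n) \<Rightarrow>\<^sub>L (real^'n))"
    and W :: "(real^'n) set" and \<Psi> :: "real^'n \<Rightarrow> real^'n" and \<Psi>' :: "real^'n \<Rightarrow> real^'n \<Rightarrow> real^'n"
    and K T :: "(real^'n) set"
  assumes open_U: "open U" and x_in: "x \<in> M" "x \<in> U"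
    and deriv: "\<And>y. y \<in> U \<Longrightarrow> (\<Phi> has_derivative blinfun_apply (\<Phi>' y)) (at y)"
    and cont: "continuous_on U \<Phi>'"
    and open_W: "open W" and hom: "homeomorphism U W \<Phi> \<Psi>"
    and inv_deriv: "\<And>z. z \<in> W \<Longrightarrow> (\<Psi> has_derivative \<Psi>' z) (at z)"
    and inv_deriv_eq: "\<And>z. z \<in> W \<Longrightarrow> \<Psi>' z = inv (blinfun_apply (\<Phi>' (\<Psi> z)))"
    and bij_deriv: "\<And>z. z \<in> W \<Longrightarrow> bij (blinfun_apply (\<Phi>' (\<Psi> z)))"
    and T_eq: "T = {v. \<forall>u\<in>K. u \<bullet> v = 0}" and dim_T: "dim T = d"
    and M_eq: "M \<inter> U = {y\<in>U. \<Phi> y \<in> T}"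
    and deriv_id: "\<And>v. v \<in> T \<Longrightarrow> blinfun_apply (\<Phi>' x) v = v"
    and transverse: "\<And>y y'. y \<in> M \<inter> U \<Longrightarrow> y' \<in> M \<inter> U \<Longrightarrow> (\<And>v. v \<in> T \<Longrightarrow> (y - y') \<bullet> v = 0) \<Longrightarrow> y = y'"
begin

lemma subspace_T: "subspace T"
  by (auto simp: T_eq subspace_def inner_add_right)

lemma bij_deriv_U: "y \<in> U \<Longrightarrow> bij (blinfun_apply (\<Phi>' y))"
  using bij_deriv hom by (metis homeomorphism_def imageI)

text \<open>From left to right, differentiate the vanishing of
  \<open>u \<bullet> \<Phi> (\<gamma> t)\<close> for normals u in K; from right to left, pull a
  straight segment in T back through \<open>\<Psi>\<close> to obtain a curve in M.\<close>

lemma tangent_space_eq: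
  assumes y: "y \<in> M" "y \<in> U"
  shows "tangent_space M y = {v. blinfun_apply (\<Phi>' y) v \<in> T}"
proof (intro Set.equalityI subsetI)
  fix v assume "v \<in> tangent_space M y"
  then obtain \<gamma> e where e: "e > 0" and \<gamma>: "\<gamma> 0 = y" "\<And>t. t \<in> {-e<..<e} \<Longrightarrow> \<gamma> t \<in> M"
    and der: "(\<gamma> has_vector_derivative v) (at 0)"
    unfolding tangent_space_def by blast
  have "continuous (at 0) \<gamma>" using der has_vector_derivative_continuous by blast
  then have "\<forall>\<^sub>F t in at 0. \<gamma> t \<in> U"
    using open_U y(2) \<gamma>(1) by (simp add: continuous_within topological_tendstoD)
  moreover have "\<forall>\<^sub>F t in at (0::real). t \<in> {-e<..<e}"
    using e by (intro eventually_at_in_open') auto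
  ultimately have ev: "\<forall>\<^sub>F t in at 0. \<Phi> (\<gamma> t) \<in> T"
  proof eventually_elim
    case (elim t)
    then show ?case using \<gamma>(2)[of t] M_eq by blast
  qed
  have "((\<lambda>t. \<Phi> (\<gamma> t)) has_derivative (\<lambda>t. blinfun_apply (\<Phi>' y) (t *\<^sub>R v))) (at 0)"
    using has_derivative_compose[OF der[unfolded has_vector_derivative_def], of \<Phi> "blinfun_apply (\<Phi>' y)"] deriv[OF y(2)] \<gamma>(1)
    by simp
  then have dPhi: "((\<lambda>t. \<Phi> (\<gamma> t)) has_derivative (\<lambda>t. t *\<^sub>R blinfun_apply (\<Phi>' y) v)) (at 0)"
    by (simp add: blinfun.scaleR_right)
  have "u \<bullet> blinfun_apply (\<Phi>' y) v = 0" if u: "u \<in> K" for u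
  proof -
    have "((\<lambda>t. u \<bullet> \<Phi> (\<gamma> t)) has_derivative (\<lambda>t. u \<bullet> (t *\<^sub>R blinfun_apply (\<Phi>' y) v))) (at 0)"
      by (intro has_derivative_inner_right dPhi)
    moreover have "\<forall>\<^sub>F t in at 0. u \<bullet> \<Phi> (\<gamma> t) = 0"
      using ev by eventually_elim (use u in \<open>auto simp: T_eq\<close>)
    moreover have "u \<bullet> \<Phi> (\<gamma> 0) = 0"
      using y M_eq u \<gamma>(1) by (auto simp: T_eq)
    ultimately have "((\<lambda>t. 0) has_derivative (\<lambda>t. u \<bullet> (t *\<^sub>R blinfun_apply (\<Phi>' y) v))) (at (0::real))"
      by (rule has_derivative_transform_eventually) auto
    then have "(\<lambda>t. u \<bullet> (t *\<^sub>R blinfun_apply (\<Phi>' y) v)) = (\<lambda>t. 0)"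
      using has_derivative_unique has_derivative_const by blast
    from fun_cong[OF this, of 1] show ?thesis by simp
  qed
  then show "v \<in> {v. blinfun_apply (\<Phi>' y) v \<in> T}" by (simp add: T_eq)
next
  fix v assume "v \<in> {v. blinfun_apply (\<Phi>' y) v \<in> T}"
  then have w: "blinfun_apply (\<Phi>' y) v \<in> T" by simp
  define p where "p t = \<Phi> y + t *\<^sub>R blinfun_apply (\<Phi>' y) v" for t :: real
  have yW: "\<Phi> y \<in> W" using hom y(2) by (auto simp: homeomorphism_def)
  have \<Psi>y: "\<Psi> (\<Phi> y) = y" using hom y(2) by (auto simp: homeomorphism_def)
  have "open (p -` W)"
    unfolding p_def by (intro open_vimage open_W continuous_intros)
  moreover have "0 \<in> p -` W" using yW by (simp add: p_def)
  ultimately obtain e where e: "e > 0" "ball 0 e \<subseteq> p -` W" by (meson open_contains_ball)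
  have \<gamma>M: "\<Psi> (p t) \<in> M" if "t \<in> {-e<..<e}" for t
  proof -
    have pW: "p t \<in> W" using e(2) that by (auto simp: dist_real_def subset_iff)
    then have "\<Psi> (p t) \<in> U" "\<Phi> (\<Psi> (p t)) = p t" using hom by (auto simp: homeomorphism_def)
    moreover have "p t \<in> T"
      unfolding p_def using y M_eq w subspace_T by (auto intro!: subspace_add subspace_scale)
    ultimately show ?thesis using M_eq by (metis (mono_tags, lifting) IntD1 mem_Collect_eq)
  qed
  have "(p has_vector_derivative blinfun_apply (\<Phi>' y) v) (at 0)"
    unfolding p_def by (auto intro!: derivative_eq_intros)
  then have "((\<lambda>t. \<Psi> (p t)) has_derivative (\<lambda>t. \<Psi>' (\<Phi> y) (t *\<^sub>R blinfun_apply (\<Phi>' y) v))) (at 0)"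
    using has_derivative_compose[of p "\<lambda>t. t *\<^sub>R blinfun_apply (\<Phi>' y) v" 0 UNIV \<Psi> "\<Psi>' (\<Phi> y)"] inv_deriv[OF yW]
    by (simp add: has_vector_derivative_def p_def)
  moreover have "\<Psi>' (\<Phi> y) (t *\<^sub>R blinfun_apply (\<Phi>' y) v) = t *\<^sub>R v" for t
  proof -
    have "\<Psi>' (\<Phi> y) (blinfun_apply (\<Phi>' y) (t *\<^sub>R v)) = t *\<^sub>R v"
      using inv_deriv_eq[OF yW] bij_deriv_U[OF y(2)] \<Psi>y by (simp add: bij_is_inj)
    then show ?thesis by (simp add: blinfun.scaleR_right)
  qed
  ultimately have "((\<lambda>t. \<Psi> (p t)) has_vector_derivative v) (at 0)"
    by (simp add: has_vector_derivative_def)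
  moreover have "\<Psi> (p 0) = y" by (simp add: p_def \<Psi>y)
  ultimately show "v \<in> tangent_space M y"
    unfolding tangent_space_def using e(1) \<gamma>M
    by (intro CollectI exI[of _ "\<lambda>t. \<Psi> (p t)"] exI[of _ e]) simp
qed

lemma tangent_space_center: "tangent_space M x = T"
proof -
  have "blinfun_apply (\<Phi>' x) v \<in> T \<longleftrightarrow> v \<in> T" for v
  proof
    assume "blinfun_apply (\<Phi>' x) v \<in> T"
    then have "blinfun_apply (\<Phi>' x) (blinfun_apply (\<Phi>' x) v) = blinfun_apply (\<Phi>' x) v" by (rule deriv_id)
    then have "blinfun_apply (\<Phi>' x) v = v" using bij_deriv_U[OF x_in(2)] by (simp add: bij_is_inj inj_eq)
    then show "v \<in> T" using \<open>blinfun_apply (\<Phi>' x) v \<in> T\<close> by simp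
  qed (simp add: deriv_id)
  then show ?thesis using tangent_space_eq[OF x_in] by simp
qed

text \<open>Lower semicontinuity of tangent spaces: u solves
  \<open>blinfun_apply (\<Phi>' y) u = v\<close>, and \<open>\<Phi>'\<close> is continuous and
  invertible. It serves to show that two coordinates separated by a tangent vector stay separated
  nearby.\<close>

lemma tangent_space_near:
  assumes v: "v \<in> tangent_space M x" and e: "e > 0"
  obtains \<rho> where "\<rho> > 0"
    "\<And>y. y \<in> M \<Longrightarrow> y \<in> ball x \<rho> \<Longrightarrow> \<exists>u\<in>tangent_space M y. norm (u - v) < e"
proof -
  have vT: "v \<in> T" using v tangent_space_center by simp
  obtain \<kappa> where \<kappa>: "\<kappa> > 0" "\<And>h. \<kappa> * norm h \<le> norm (blinfun_apply (\<Phi>' x) h)"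
    using linear_inj_bounded_below_pos[OF bounded_linear.linear[OF blinfun.bounded_linear_right]
        bij_is_inj[OF bij_deriv_U[OF x_in(2)]]] by blast
  \<comment> \<open>The first bound absorbs \<open>\<theta> * norm (u - v)\<close> into half of the
    lower bound given by \<open>\<kappa>\<close>; the second makes the remaining
    \<open>\<theta> * norm v\<close> less than \<open>\<kappa> / 2 * e\<close>, the summand 1
    covering v = 0.\<close>
  define \<theta> where "\<theta> = min (\<kappa> / 2) (\<kappa> * e / (2 * (norm v + 1)))"
  have \<theta>: "\<theta> > 0"
    unfolding \<theta>_def using \<kappa>(1) e by (simp add: add_nonneg_pos)
  have "isCont \<Phi>' x" using cont open_U x_in(2) by (simp add: continuous_on_eq_continuous_at)
  then obtain \<rho>1 where \<rho>1: "\<rho>1 > 0" "\<And>y. dist y x < \<rho>1 \<Longrightarrow> dist (\<Phi>' y) (\<Phi>' x) < \<theta>"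
    using \<theta> unfolding continuous_at_eps_delta by blast
  obtain \<rho>2 where \<rho>2: "\<rho>2 > 0" "ball x \<rho>2 \<subseteq> U" using open_U x_in(2) by (meson open_contains_ball)
  show ?thesis
  proof
    show "min \<rho>1 \<rho>2 > 0" using \<rho>1 \<rho>2 by simp
    fix y assume yM: "y \<in> M" and "y \<in> ball x (min \<rho>1 \<rho>2)"
    then have yU: "y \<in> U" and close: "norm (\<Phi>' y - \<Phi>' x) < \<theta>"
      using \<rho>1(2)[of y] \<rho>2(2) by (auto simp: dist_norm norm_minus_commute subset_iff)
    obtain u where u: "blinfun_apply (\<Phi>' y) u = v" using bij_deriv_U[OF yU] by (metis bij_pointE)
    have "u \<in> tangent_space M y" using tangent_space_eq[OF yM yU] u vT by simp
    moreover have "norm (u - v) < e"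
    proof -
      have "blinfun_apply (\<Phi>' x) (u - v) = blinfun_apply (\<Phi>' x - \<Phi>' y) (u - v) + blinfun_apply (\<Phi>' x - \<Phi>' y) v"
        using deriv_id[OF vT] u by (simp add: blinfun.diff_right blinfun.diff_left)
      then have "norm (blinfun_apply (\<Phi>' x) (u - v)) \<le> norm (blinfun_apply (\<Phi>' x - \<Phi>' y) (u - v)) + norm (blinfun_apply (\<Phi>' x - \<Phi>' y) v)"
        by (simp add: norm_triangle_ineq)
      also have "\<dots> \<le> \<theta> * norm (u - v) + \<theta> * norm v"
        using close
        by (intro add_mono order_trans[OF norm_blinfun] mult_right_mono) (auto simp: norm_minus_commute)
      finally have "\<kappa> * norm (u - v) \<le> \<theta> * norm (u - v) + \<theta> * norm v"
        using \<kappa>(2)[of "u - v"] by linarith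
      moreover have "\<theta> * norm (u - v) \<le> \<kappa> / 2 * norm (u - v)"
        by (intro mult_right_mono) (simp_all only: \<theta>_def min.cobounded1 norm_ge_zero)
      ultimately have "\<kappa> / 2 * norm (u - v) \<le> \<theta> * norm v" by linarith
      also have "\<dots> < \<theta> * (norm v + 1)" using \<theta> by simp
      also have "\<dots> \<le> \<kappa> * e / (2 * (norm v + 1)) * (norm v + 1)"
        by (intro mult_right_mono) (simp_all only: \<theta>_def min.cobounded2 add_nonneg_nonneg norm_ge_zero zero_le_one)
      also have "\<dots> = \<kappa> / 2 * e"
      proof -
        have "c \<noteq> 0 \<Longrightarrow> \<kappa> * e / (2 * c) * c = \<kappa> / 2 * e" for c :: real by simp
        moreover have "norm v + 1 \<noteq> 0" using norm_ge_zero[of v] by linarith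
        ultimately show ?thesis .
      qed
      finally show ?thesis using \<kappa>(1) by simp
    qed
    ultimately show "\<exists>u\<in>tangent_space M y. norm (u - v) < e" by blast
  qed
qed

end

text \<open>The inverse function theorem is applied to the sum of two maps: the orthogonal
  projection to the common kernel T of the gradients at x, and the defining functions multiplied by
  these gradients. On M only the projection remains, and injectivity of \<open>\<Phi>\<close> then
  gives \<open>transverse\<close>.\<close>

lemma submanifold_chart_exists:
  fixes M :: "(real^'n) set"
  assumes M: "C2_submanifold M d" and x: "x \<in> M"
  shows "\<exists>U \<Phi> \<Phi>' W \<Psi> \<Psi>' K T. submanifold_chart M d x U \<Phi> \<Phi>' W \<Psi> \<Psi>' K T"
proof -
  define q where "q = CARD('n) - d"
  have "\<exists>U g G. open U \<and> x \<in> U \<and>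
        (\<forall>j<q. C2_on U (g j) \<and> (g j has_derivative (\<lambda>h. G j \<bullet> h)) (at x)) \<and>
        inj_on G {..<q} \<and> independent (G ` {..<q}) \<and> M \<inter> U = {y\<in>U. \<forall>j<q. g j y = 0}"
    and dn: "d \<le> CARD('n)"
    using M x unfolding C2_submanifold_def q_def by (simp_all only: Ball_def)
  then obtain U g G where U: "open U" "x \<in> U"
    and C2: "\<And>j. j < q \<Longrightarrow> C2_on U (g j)" and gx: "\<And>j. j < q \<Longrightarrow> (g j has_derivative (\<lambda>h. G j \<bullet> h)) (at x)"
    and inj: "inj_on G {..<q}" and ind: "independent (G ` {..<q})"
    and MU: "M \<inter> U = {y\<in>U. \<forall>j<q. g j y = 0}"
    by (elim exE conjE) (rule that; simp)
  have "\<forall>j. \<exists>gr. j < q \<longrightarrow> (\<forall>y\<in>U. (g j has_derivative (\<lambda>h. gr y \<bullet> h)) (at y)) \<and> continuous_on U gr"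
  proof
    fix j
    show "\<exists>gr. j < q \<longrightarrow> (\<forall>y\<in>U. (g j has_derivative (\<lambda>h. gr y \<bullet> h)) (at y)) \<and> continuous_on U gr"
    proof (cases "j < q")
      case True
      then obtain gr H where *: "\<And>y. y \<in> U \<Longrightarrow> (g j has_derivative (\<lambda>h. gr y \<bullet> h)) (at y)"
        "\<And>y. y \<in> U \<Longrightarrow> (gr has_derivative (\<lambda>h. H y *v h)) (at y)"
        using C2 unfolding C2_on_def by blast
      have "continuous_on U gr"
        using *(2) by (intro continuous_at_imp_continuous_on ballI has_derivative_continuous) blast
      then show ?thesis using * by blast
    qed simp
  qed
  from choice[OF this] obtain gr
    where grad: "\<And>j y. j < q \<Longrightarrow> y \<in> U \<Longrightarrow> (g j has_derivative (\<lambda>h. gr j y \<bullet> h)) (at y)"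
      and grad_cont: "\<And>j. j < q \<Longrightarrow> continuous_on U (gr j)" by blast
  have grad_x: "gr j x = G j" if "j < q" for j
  proof -
    have "(\<lambda>h. gr j x \<bullet> h) = (\<lambda>h. G j \<bullet> h)"
      using has_derivative_unique[OF grad[OF that U(2)] gx[OF that]] .
    then show ?thesis by (metis vector_eq_rdot)
  qed
  define K where "K = G ` {..<q}"
  define T where "T = {v. \<forall>u\<in>K. u \<bullet> v = 0}"
  have subT: "subspace T" by (auto simp: T_def subspace_def inner_add_right)
  have G_indep: "c j = 0" if "(\<Sum>j<q. c j *\<^sub>R G j) = 0" "j < q" for c j
  proof -
    define f where "f u = c (the_inv_into {..<q} G u)" for u
    have "(\<Sum>u\<in>K. f u *\<^sub>R u) = (\<Sum>j<q. c j *\<^sub>R G j)"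
      unfolding K_def by (subst sum.reindex[OF inj]) (auto simp: f_def the_inv_into_f_f[OF inj] intro!: sum.cong)
    then have "(\<Sum>u\<in>K. f u *\<^sub>R u) = 0" using that by simp
    then have "f (G j) = 0"
      using independentD[OF ind, of K f "G j"] that(2) by (auto simp: K_def)
    then show ?thesis using that(2) by (simp add: f_def the_inv_into_f_f[OF inj])
  qed
  have T_span: "T = {v\<in>UNIV. \<forall>u\<in>span K. orthogonal u v}"
  proof -
    have "orthogonal u v" if "\<forall>u\<in>K. u \<bullet> v = 0" "u \<in> span K" for u v :: "real^'n"
      using orthogonal_to_span[of u K v] that by (simp add: orthogonal_def inner_commute)
    then show ?thesis by (auto simp: T_def orthogonal_def intro: span_base)
  qed
  have "dim T + dim (span K) = dim (UNIV :: (real^'n) set)"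
    unfolding T_span by (intro dim_subspace_orthogonal_to_vectors) auto
  moreover have "dim (span K) = q"
    using ind card_image[OF inj] unfolding K_def by (simp add: dim_eq_card_independent)
  ultimately have dimT: "dim T = d" using dn by (simp add: q_def)
  obtain B where B: "B \<subseteq> T" "pairwise orthogonal B" "\<And>b. b \<in> B \<Longrightarrow> norm b = 1" "finite B" "span B = T"
    using orthonormal_basis_subspace[OF subT] by (metis independent_imp_finite)
  define P where "P v = (\<Sum>b\<in>B. (v \<bullet> b) *\<^sub>R b)" for v
  have P_in: "P v \<in> T" for v
    unfolding P_def using B(1) subT by (auto intro!: subspace_sum subspace_scale)
  have P_perp: "(v - P v) \<bullet> w = 0" if "w \<in> T" for v w
  proof -
    have "(v - P v) \<bullet> b = 0" if b: "b \<in> B" for b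
    proof -
      have "P v \<bullet> b = (\<Sum>b'\<in>B. if b' = b then v \<bullet> b else 0)"
        unfolding P_def inner_sum_left using B(2,3) b
        by (intro sum.cong) (auto simp: pairwise_def orthogonal_def dot_square_norm)
      then show ?thesis using b B(4) by (simp add: inner_diff_left)
    qed
    then show ?thesis
      using orthogonal_to_span[of w B "v - P v"] that B(5) by (simp add: orthogonal_def)
  qed
  have P_id: "P v = v" if "v \<in> T" for v
  proof -
    have "(v - P v) \<bullet> (v - P v) = 0" using P_perp[of "v - P v" v] P_in that subT by (simp add: subspace_diff)
    then show ?thesis by simp
  qed
  have P_zero: "P v = 0" if "\<And>w. w \<in> T \<Longrightarrow> v \<bullet> w = 0" for v
    unfolding P_def using that B(1) by (auto intro!: sum.neutral)
  have P_diff: "P (v - w) = P v - P w" for v w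
    unfolding P_def by (simp add: inner_diff_left scaleR_left_diff_distrib sum_subtractf)
  define \<Phi> where "\<Phi> y = P (y - x) + (\<Sum>j<q. g j y *\<^sub>R G j)" for y
  define \<Phi>' where "\<Phi>' y = (\<Sum>b\<in>B. blinfun_scaleR_left b o\<^sub>L blinfun_inner_left b)
      + (\<Sum>j<q. blinfun_scaleR_left (G j) o\<^sub>L blinfun_inner_right (gr j y))" for y
  have \<Phi>'_apply: "blinfun_apply (\<Phi>' y) h = P h + (\<Sum>j<q. (gr j y \<bullet> h) *\<^sub>R G j)" for y h
    by (simp add: \<Phi>'_def P_def blinfun.add_left blinfun.sum_left inner_commute)
  have der: "(\<Phi> has_derivative blinfun_apply (\<Phi>' y)) (at y)" if "y \<in> U" for y
  proof -
    have "((\<lambda>y. P (y - x)) has_derivative P) (at y)"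
      unfolding P_def by (auto intro!: derivative_eq_intros)
    moreover have "((\<lambda>y. \<Sum>j<q. g j y *\<^sub>R G j) has_derivative (\<lambda>h. \<Sum>j<q. (gr j y \<bullet> h) *\<^sub>R G j)) (at y)"
      by (intro has_derivative_sum has_derivative_scaleR_left grad that) auto
    ultimately have "(\<Phi> has_derivative (\<lambda>h. P h + (\<Sum>j<q. (gr j y \<bullet> h) *\<^sub>R G j))) (at y)"
      unfolding \<Phi>_def by (rule has_derivative_add)
    then show ?thesis unfolding \<Phi>'_apply[symmetric] .
  qed
  have cont: "continuous_on U \<Phi>'"
    unfolding \<Phi>'_def
    by (intro continuous_intros bounded_bilinear.continuous_on[OF bounded_bilinear_blinfun_compose]
        bounded_linear.continuous_on[OF bounded_linear_blinfun_inner_right] grad_cont) auto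
  have lin: "linear (blinfun_apply (\<Phi>' x))"
    by (rule bounded_linear.linear[OF blinfun.bounded_linear_right])
  \<comment> \<open>\<open>P h\<close> lies in T and the gradient sum is orthogonal to T, so both
    vanish. By independence the gradients then annihilate h, which puts h into T, where P is the
    identity.\<close>
  have \<Phi>'x_inj: "inj (blinfun_apply (\<Phi>' x))"
  proof -
    have "h = 0" if h: "blinfun_apply (\<Phi>' x) h = 0" for h
    proof -
      have sumT: "(\<Sum>j<q. (gr j x \<bullet> h) *\<^sub>R G j) = - P h"
        using h unfolding \<Phi>'_apply by (simp add: eq_neg_iff_add_eq_0 add.commute)
      define s where "s = (\<Sum>j<q. (gr j x \<bullet> h) *\<^sub>R G j)"
      have "s \<in> T" unfolding s_def sumT using P_in subT by (simp add: subspace_neg)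
      then have "s \<bullet> s = 0"
        by (subst (1) s_def) (auto simp: inner_sum_left T_def K_def intro!: sum.neutral)
      then have s0: "s = 0" by simp
      have "gr j x \<bullet> h = 0" if "j < q" for j
        using G_indep[of "\<lambda>j. gr j x \<bullet> h"] s0 that unfolding s_def by blast
      then have "h \<in> T" using grad_x by (auto simp: T_def K_def)
      moreover have "P h = 0" using sumT s0 unfolding s_def by simp
      ultimately show "h = 0" using P_id by metis
    qed
    then show ?thesis
      using linear_injective_0[OF lin] by blast
  qed
  then obtain f where f: "linear f" "f \<circ> blinfun_apply (\<Phi>' x) = id"
    using linear_injective_left_inverse[OF lin] by blast
  have left_inv: "Blinfun f o\<^sub>L \<Phi>' x = id_blinfun"
  proof (rule blinfun_eqI)
    fix h
    have "bounded_linear f" using f(1) linear_conv_bounded_linear by blast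
    then show "blinfun_apply (Blinfun f o\<^sub>L \<Phi>' x) h = blinfun_apply id_blinfun h"
      using fun_cong[OF f(2), of h] by (simp add: bounded_linear_Blinfun_apply)
  qed
  obtain U' W \<Psi> \<Psi>' where U': "open U'" "U' \<subseteq> U" "x \<in> U'" "open W" "\<Phi> x \<in> W" "homeomorphism U' W \<Phi> \<Psi>"
    "\<And>y. y \<in> W \<Longrightarrow> (\<Psi> has_derivative (\<Psi>' y)) (at y)"
    "\<And>y. y \<in> W \<Longrightarrow> \<Psi>' y = inv (blinfun_apply (\<Phi>' (\<Psi> y)))"
    "\<And>y. y \<in> W \<Longrightarrow> bij (blinfun_apply (\<Phi>' (\<Psi> y)))"
    by (rule inverse_function_theorem[OF U(1) der cont U(2) left_inv], assumption) (rule that)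
  have M_iff: "y \<in> M \<longleftrightarrow> (\<forall>j<q. g j y = 0)" if "y \<in> U'" for y using MU U'(2) that by blast
  have "submanifold_chart M d x U' \<Phi> \<Phi>' W \<Psi> \<Psi>' K T"
  proof (unfold_locales, goal_cases)
    case 4 then show ?case using der U'(2) by blast
  next
    case 5 then show ?case using cont U'(2) continuous_on_subset by blast
  next
    case 13
    have "\<Phi> y \<in> T \<longleftrightarrow> (\<forall>j<q. g j y = 0)" for y
    proof
      assume \<Phi>T: "\<Phi> y \<in> T"
      define s where "s = (\<Sum>j<q. g j y *\<^sub>R G j)"
      have "s = \<Phi> y - P (y - x)" by (simp add: s_def \<Phi>_def)
      then have "s \<in> T" using \<Phi>T P_in subT by (simp add: subspace_diff)
      then have "s \<bullet> s = 0"
        by (subst (1) s_def) (auto simp: inner_sum_left T_def K_def intro!: sum.neutral)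
      then have "s = 0" by simp
      then show "\<forall>j<q. g j y = 0" unfolding s_def using G_indep[of "\<lambda>j. g j y"] by blast
    qed (simp add: \<Phi>_def P_in)
    then show ?case using M_iff by blast
  next
    case (14 v)
    then have "gr j x \<bullet> v = 0" if "j < q" for j using that grad_x by (auto simp: T_def K_def)
    then show ?case using P_id[OF 14] by (simp add: \<Phi>'_apply)
  next
    case (15 y y')
    have "P (y - x) - P (y' - x) = P (y - y')" unfolding P_diff[symmetric] by simp
    also have "\<dots> = 0" using 15(3) by (rule P_zero)
    finally have "P (y - x) = P (y' - x)" by simp
    moreover have "g j y = 0" "g j y' = 0" if "j < q" for j using 15(1,2) M_iff that by blast+
    ultimately have "\<Phi> y = \<Phi> y'" by (simp add: \<Phi>_def)
    then show ?case using 15(1,2) U'(6) by (metis IntD2 homeomorphism_apply1)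
  qed (use U' x T_def dimT in auto)
  then show ?thesis by blast
qed

section \<open>Tied coordinates of locally symmetric submanifolds\<close>

lemma tangent_space_subspace:
  assumes "C2_submanifold M d" "x \<in> M"
  shows "subspace (tangent_space M x)" "dim (tangent_space M x) = d"
proof -
  obtain U \<Phi> \<Phi>' W \<Psi> \<Psi>' K T where "submanifold_chart M d x U \<Phi> \<Phi>' W \<Psi> \<Psi>' K T"
    using submanifold_chart_exists[OF assms] by blast
  then interpret submanifold_chart M d x U \<Phi> \<Phi>' W \<Psi> \<Psi>' K T .
  show "subspace (tangent_space M x)" "dim (tangent_space M x) = d"
    using tangent_space_center subspace_T dim_T by simp_all
qed

section \<open>Permutations of coordinates acting on tangent vectors\<close>

lemma norm_perm_act:
  assumes "\<sigma> permutes UNIV"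
  shows "norm (perm_act \<sigma> v) = norm v"
proof -
  have "(\<Sum>i\<in>UNIV. (norm (v $ inv \<sigma> i))\<^sup>2) = (\<Sum>i\<in>UNIV. (norm (v $ i))\<^sup>2)"
    using sum.permute[OF permutes_inv[OF assms], of "\<lambda>i. (norm (v $ i))\<^sup>2"] by (simp add: o_def)
  then show ?thesis by (simp add: norm_vec_def L2_set_def perm_act_def)
qed

lemma bounded_linear_perm_act: "bounded_linear (perm_act \<sigma>)"
  by (rule linear_conv_bounded_linear[THEN iffD1], rule linearI) (simp_all add: perm_act_def vec_eq_iff)

text \<open>A transposition is the reflection along the difference of two unit vectors; in this form
  it interacts with orthogonality to tangent spaces.\<close>

lemma perm_act_transpose:
  "perm_act (Transposition.transpose i j) v = v - (v $ i - v $ j) *\<^sub>R (axis i 1 - axis j 1)"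
  by (auto simp: vec_eq_iff perm_act_def axis_def Transposition.transpose_def)

lemma inner_axis_diff: "(axis i 1 - axis j 1) \<bullet> v = v $ i - (v::real^'n) $ j"
  by (simp add: inner_diff_left inner_axis_axis inner_axis')

lemma tangent_space_coords_eq:
  assumes "open U" "y \<in> U" "\<And>z. z \<in> M \<inter> U \<Longrightarrow> z $ i = z $ j" "v \<in> tangent_space M y"
  shows "v $ i = v $ j"
proof -
  obtain \<gamma> e where e: "e > 0" and \<gamma>: "\<gamma> 0 = y" "\<And>t. t \<in> {-e<..<e} \<Longrightarrow> \<gamma> t \<in> M"
    and der: "(\<gamma> has_vector_derivative v) (at 0)"
    using assms(4) unfolding tangent_space_def by blast
  have "continuous (at 0) \<gamma>" using der has_vector_derivative_continuous by blast
  then have "\<forall>\<^sub>F t in at 0. \<gamma> t \<in> U"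
    using assms(1,2) \<gamma>(1) by (simp add: continuous_within topological_tendstoD)
  moreover have "\<forall>\<^sub>F t in at (0::real). t \<in> {-e<..<e}"
    using e by (intro eventually_at_in_open') auto
  ultimately have ev: "\<forall>\<^sub>F t in at 0. \<gamma> t $ i - \<gamma> t $ j = 0"
    by eventually_elim (use \<gamma>(2) assms(3) in auto)
  have d: "((\<lambda>t. \<gamma> t $ i - \<gamma> t $ j) has_derivative (\<lambda>t. (t *\<^sub>R v) $ i - (t *\<^sub>R v) $ j)) (at 0)"
    using der unfolding has_vector_derivative_def
    by (intro has_derivative_diff bounded_linear.has_derivative[OF bounded_linear_vec_nth])
  have "\<gamma> 0 $ i - \<gamma> 0 $ j = 0"
    using assms(3)[of y] \<gamma>(2)[of 0] e \<gamma>(1) assms(2) by simp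
  with d ev have "((\<lambda>t. 0) has_derivative (\<lambda>t. (t *\<^sub>R v) $ i - (t *\<^sub>R v) $ j)) (at (0::real))"
    by (rule has_derivative_transform_eventually) auto
  then have "(\<lambda>t. (t *\<^sub>R v) $ i - (t *\<^sub>R v) $ j) = (\<lambda>t. 0)"
    using has_derivative_unique has_derivative_const by blast
  from fun_cong[OF this, of 1] show ?thesis by simp
qed

lemma tangent_space_perm_act:
  assumes \<delta>: "\<delta> > 0" and stab: "perm_act \<sigma> x = x"
    and inv: "\<And>y. y \<in> M \<inter> ball x \<delta> \<Longrightarrow> perm_act \<sigma> y \<in> M" and v: "v \<in> tangent_space M x"
  shows "perm_act \<sigma> v \<in> tangent_space M x"
proof -
  obtain \<gamma> e where e: "e > 0" and \<gamma>: "\<gamma> 0 = x" "\<And>t. t \<in> {-e<..<e} \<Longrightarrow> \<gamma> t \<in> M"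
    and der: "(\<gamma> has_vector_derivative v) (at 0)"
    using v unfolding tangent_space_def by blast
  have "continuous (at 0) \<gamma>" using der has_vector_derivative_continuous by blast
  then obtain e' where e': "e' > 0" "\<And>t. dist t 0 < e' \<Longrightarrow> dist (\<gamma> t) (\<gamma> 0) < \<delta>"
    using \<delta> unfolding continuous_at_eps_delta by blast
  have "perm_act \<sigma> (\<gamma> t) \<in> M" if "t \<in> {-(min e e')<..<min e e'}" for t
    using that e'(2)[of t] \<gamma> by (intro inv) (auto simp: dist_real_def dist_commute)
  moreover have "((\<lambda>t. perm_act \<sigma> (\<gamma> t)) has_vector_derivative perm_act \<sigma> v) (at 0)"
    by (rule bounded_linear.has_vector_derivative[OF bounded_linear_perm_act der])
  ultimately show ?thesis
    unfolding tangent_space_def using e e'(1) \<gamma>(1) stab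
    by (intro CollectI exI[of _ "\<lambda>t. perm_act \<sigma> (\<gamma> t)"] exI[of _ "min e e'"]) simp
qed

text \<open>For a connected locally symmetric submanifold this relation does not depend on \<^term>\<open>x\<close>, and its classes are
  the orbits of the characteristic permutation.\<close>
definition tied_coords :: "(real^'n) set \<Rightarrow> real^'n \<Rightarrow> ('n \<times> 'n) set" where
  "tied_coords M x = {(i, j). x $ i = x $ j \<and> (\<forall>v\<in>tangent_space M x. v $ i = v $ j)}"

lemma equiv_tied_coords: "equiv UNIV (tied_coords M x)"
  by (rule equivI) (auto simp: tied_coords_def refl_on_def sym_def trans_def)

text \<open>For y in M near x the image of y under the transposition of i and j lies in M too. Their
  difference is a multiple of e_i - e_j, which is orthogonal to T because i and j are tied. By
  \<open>transverse\<close> the two points coincide.\<close>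

lemma tied_coords_locally_equal:
  fixes M :: "(real^'n::{finite,linorder}) set"
  assumes M: "C2_submanifold M d" and ls: "locally_symmetric M" and x: "x \<in> M"
    and tied: "(i, j) \<in> tied_coords M x"
  obtains \<rho> where "\<rho> > 0" "\<And>y. y \<in> M \<inter> ball x \<rho> \<Longrightarrow> y $ i = y $ j"
proof -
  obtain U \<Phi> \<Phi>' W \<Psi> \<Psi>' K T where "submanifold_chart M d x U \<Phi> \<Phi>' W \<Psi> \<Psi>' K T"
    using submanifold_chart_exists[OF M x] by blast
  then interpret submanifold_chart M d x U \<Phi> \<Phi>' W \<Psi> \<Psi>' K T .
  define \<tau> where "\<tau> = Transposition.transpose i j"
  have \<tau>: "\<tau> permutes UNIV" by (simp add: \<tau>_def permutes_swap_id)
  have "x $ i = x $ j" using tied by (simp add: tied_coords_def)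
  then have \<tau>x: "perm_act \<tau> x = x" by (simp add: \<tau>_def perm_act_transpose)
  obtain \<delta> where \<delta>: "\<delta> > 0" and "\<forall>\<sigma>. \<sigma> permutes UNIV \<longrightarrow>
        (\<forall>y\<in>M \<inter> ball x \<delta>. perm_act \<sigma> y = y \<longrightarrow> perm_act \<sigma> ` (M \<inter> ball x \<delta>) = M \<inter> ball x \<delta>)"
    using ls x unfolding locally_symmetric_def by blast
  moreover have "x \<in> M \<inter> ball x \<delta>" using x \<delta> by simp
  ultimately have inv: "perm_act \<tau> ` (M \<inter> ball x \<delta>) = M \<inter> ball x \<delta>"
    using \<tau> \<tau>x by blast
  obtain \<rho> where \<rho>: "\<rho> > 0" "ball x \<rho> \<subseteq> U" using open_U x_in(2) by (meson open_contains_ball)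
  show ?thesis
  proof
    show "min \<delta> \<rho> > 0" using \<delta> \<rho> by simp
    fix y assume y: "y \<in> M \<inter> ball x (min \<delta> \<rho>)"
    then have yM: "perm_act \<tau> y \<in> M" using inv by auto
    have "perm_act \<tau> y - x = perm_act \<tau> (y - x)"
      using \<tau>x bounded_linear_perm_act[of \<tau>] by (metis bounded_linear.linear linear_diff)
    then have "dist x (perm_act \<tau> y) = dist x y"
      using norm_perm_act[OF \<tau>, of "y - x"] by (metis dist_commute dist_norm)
    then have yU: "perm_act \<tau> y \<in> U" "y \<in> U" using y \<rho>(2) by (auto simp: subset_iff)
    have "y = perm_act \<tau> y"
    proof (rule transverse)
      fix v assume "v \<in> T"
      then have "v $ i = v $ j" using tied tangent_space_center by (simp add: tied_coords_def)
      then show "(y - perm_act \<tau> y) \<bullet> v = 0"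
        by (simp add: \<tau>_def perm_act_transpose inner_axis_diff)
    qed (use y yM yU in auto)
    then have "(y $ i - y $ j) *\<^sub>R (axis i 1 - axis j 1 :: real^'n::{finite,linorder}) = 0"
      by (simp add: \<tau>_def perm_act_transpose)
    then show "y $ i = y $ j" by (auto simp: axis_eq_axis)
  qed
qed

text \<open>Both being tied and not being tied are open conditions on M. For a tied pair, equality
  of the coordinates near x passes to the tangent vectors there. For an untied pair, either the
  coordinates of x differ, or a separating tangent vector at x is approximated by tangent vectors at
  nearby points.\<close>

lemma tied_coords_const:
  fixes M :: "(real^'n::{finite,linorder}) set"
  assumes M: "C2_submanifold M d" and ls: "locally_symmetric M" and conn: "connected M"
    and xy: "x \<in> M" "y \<in> M"
  shows "tied_coords M x = tied_coords M y"
proof -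
  have "(i, j) \<in> tied_coords M x \<longleftrightarrow> (i, j) \<in> tied_coords M y" for i j
  proof (rule connected_equivalence_relation[OF conn xy])
    fix x assume x: "x \<in> M"
    show "\<exists>Q. openin (top_of_set M) Q \<and> x \<in> Q \<and>
      (\<forall>y\<in>Q. ((i, j) \<in> tied_coords M x \<longleftrightarrow> (i, j) \<in> tied_coords M y))"
    proof (cases "(i, j) \<in> tied_coords M x")
      case True
      obtain \<rho> where \<rho>: "\<rho> > 0" "\<And>y. y \<in> M \<inter> ball x \<rho> \<Longrightarrow> y $ i = y $ j"
        using tied_coords_locally_equal[OF M ls x True] by blast
      have "(i, j) \<in> tied_coords M y" if "y \<in> M \<inter> ball x \<rho>" for y
        using tangent_space_coords_eq[OF open_ball, of y x \<rho> M i j] \<rho>(2) that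
        by (auto simp: tied_coords_def)
      then show ?thesis using True \<rho>(1) x by (intro exI[of _ "M \<inter> ball x \<rho>"]) auto
    next
      case False
      show ?thesis
      proof (cases "x $ i = x $ j")
        case True
        then obtain v where v: "v \<in> tangent_space M x" "v $ i \<noteq> v $ j"
          using False by (auto simp: tied_coords_def)
        obtain U \<Phi> \<Phi>' W \<Psi> \<Psi>' K T where "submanifold_chart M d x U \<Phi> \<Phi>' W \<Psi> \<Psi>' K T"
          using submanifold_chart_exists[OF M x] by blast
        then interpret submanifold_chart M d x U \<Phi> \<Phi>' W \<Psi> \<Psi>' K T .
        obtain \<rho> where \<rho>: "\<rho> > 0" "\<And>y. y \<in> M \<Longrightarrow> y \<in> ball x \<rho> \<Longrightarrow>
            \<exists>u\<in>tangent_space M y. norm (u - v) < \<bar>v $ i - v $ j\<bar> / 2"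
          using tangent_space_near[OF v(1), of "\<bar>v $ i - v $ j\<bar> / 2"] v(2) by auto
        have "(i, j) \<notin> tied_coords M y" if y: "y \<in> M \<inter> ball x \<rho>" for y
        proof -
          obtain u where u: "u \<in> tangent_space M y" "norm (u - v) < \<bar>v $ i - v $ j\<bar> / 2"
            using \<rho>(2) y by blast
          have "\<bar>u $ i - v $ i\<bar> < \<bar>v $ i - v $ j\<bar> / 2" "\<bar>u $ j - v $ j\<bar> < \<bar>v $ i - v $ j\<bar> / 2"
            using component_le_norm_cart[of "u - v" i] component_le_norm_cart[of "u - v" j] u(2) by auto
          then have "u $ i \<noteq> u $ j"
            using abs_triangle_ineq4[of "u $ j - v $ j" "u $ i - v $ i"] by (intro notI) simp
          then show ?thesis using u(1) by (auto simp: tied_coords_def)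
        qed
        then show ?thesis using False \<rho>(1) x by (intro exI[of _ "M \<inter> ball x \<rho>"]) auto
      next
        case neq: False
        have "open {y::real^'n::{finite,linorder}. y $ i \<noteq> y $ j}"
          by (intro open_Collect_neq continuous_intros)
        then show ?thesis
          using False neq x
          by (intro exI[of _ "M \<inter> {y. y $ i \<noteq> y $ j}"]) (auto simp: tied_coords_def openin_open_Int)
      qed
    qed
  qed auto
  then show ?thesis by auto
qed

text \<open>Recovers classes from an equality of quotients when Q is known to be reflexive only at
  i; the intended Q is \<open>perm_rel\<close>, whose definition by nonnegative powers does not
  display symmetry.\<close>

lemma equiv_quotient_class:
  assumes "equiv UNIV R" "UNIV // R = UNIV // Q" "(i, i) \<in> Q"
  shows "Q `` {i} = R `` {i}"
proof -
  have "Q `` {i} \<in> UNIV // R" using assms(2) by (auto simp: quotient_def)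
  then obtain k where k: "Q `` {i} = R `` {k}" by (auto simp: quotient_def)
  then have "(k, i) \<in> R" using assms(3) by auto
  then show ?thesis using k equiv_class_eq[OF assms(1)] by simp
qed

lemma equiv_vec_eq: "equiv UNIV {(i, j). (x::real^'n) $ i = x $ j}"
  by (rule equivI) (auto simp: refl_on_def sym_def trans_def)

text \<open>Around a point y where M stays in one stratum, all points have the same pattern of equal
  coordinates. Tangent vectors inherit it, so at y being tied is just having equal coordinates;
  \<open>tied_coords_const\<close> carries this to x.\<close>

lemma tied_coords_char_perm:
  fixes M :: "(real^'n::{finite,linorder}) set"
  assumes M: "C2_submanifold M d" and ls: "locally_symmetric M" and conn: "connected M"
    and char: "char_perm M \<sigma>s" and x: "x \<in> M"
  shows "perm_partition \<sigma>s = UNIV // tied_coords M x"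
proof -
  obtain y \<rho> where y: "y \<in> M" "\<rho> > 0" "M \<inter> ball y \<rho> \<subseteq> stratum \<sigma>s"
    using char unfolding char_perm_def by blast
  then have part: "vec_partition z = perm_partition \<sigma>s" if "z \<in> M \<inter> ball y \<rho>" for z
    using that by (auto simp: stratum_def)
  have "{(i, j). z $ i = z $ j} = {(i, j). y $ i = y $ j}" if z: "z \<in> M \<inter> ball y \<rho>" for z
  proof -
    have "UNIV // {(i, j). z $ i = z $ j} = UNIV // {(i, j). y $ i = y $ j}"
      using part[OF z] part[of y] y(1,2) by (simp add: vec_partition_def)
    from equiv_quotient_class[OF equiv_vec_eq this]
    show ?thesis by (auto simp: set_eq_iff)
  qed
  then have same: "z $ i = z $ j" if "z \<in> M \<inter> ball y \<rho>" "y $ i = y $ j" for z i j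
    using that by blast
  have "v $ i = v $ j" if "y $ i = y $ j" "v \<in> tangent_space M y" for i j v
  proof (rule tangent_space_coords_eq[OF open_ball _ _ that(2)])
    show "y \<in> ball y \<rho>" using y(2) by simp
    show "z $ i = z $ j" if "z \<in> M \<inter> ball y \<rho>" for z using same[OF that] \<open>y $ i = y $ j\<close> .
  qed
  then have "tied_coords M y = {(i, j). y $ i = y $ j}"
    unfolding tied_coords_def by blast
  then have "perm_partition \<sigma>s = UNIV // tied_coords M y"
    using part[of y] y(1,2) by (simp add: vec_partition_def)
  then show ?thesis using tied_coords_const[OF M ls conn x y(1)] by simp
qed

section \<open>Dichotomy for blocks, and the sum of tangent and reduced normal space\<close>

lemma stratum_perpperp_iff:
  assumes "x \<in> stratum \<sigma>"
  shows "m \<in> stratum_perpperp \<sigma> \<longleftrightarrow> (\<forall>i j. x $ i = x $ j \<longrightarrow> m $ i = m $ j)"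
proof -
  have part: "perm_partition \<sigma> = range (\<lambda>k. {j. x $ k = x $ j})"
    using assms by (auto simp: stratum_def vec_partition_def quotient_def)
  show ?thesis
  proof (intro iffI allI impI)
    fix i j assume m: "m \<in> stratum_perpperp \<sigma>" and "x $ i = x $ j"
    then have ij: "i \<in> {k. x $ i = x $ k}" "j \<in> {k. x $ i = x $ k}" by simp_all
    have "{k. x $ i = x $ k} \<in> perm_partition \<sigma>" unfolding part by (rule rangeI)
    moreover have "\<forall>I\<in>perm_partition \<sigma>. \<forall>i\<in>I. \<forall>j\<in>I. m $ i = m $ j"
      using m by (simp only: stratum_perpperp_def mem_Collect_eq)
    ultimately show "m $ i = m $ j" using ij by (metis (no_types, lifting))
  next
    assume eq: "\<forall>i j. x $ i = x $ j \<longrightarrow> m $ i = m $ j"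
    have "m $ i = m $ j" if "x $ k = x $ i" "x $ k = x $ j" for k i j
      using eq[rule_format, of i j] that by simp
    then show "m \<in> stratum_perpperp \<sigma>"
      unfolding stratum_perpperp_def part by blast
  qed
qed

text \<open>The transposition of i and j fixes x and hence preserves the tangent space. If a tangent
  vector v separates i and j, then v minus its image is a nonzero multiple of e_i - e_j.\<close>

lemma axis_diff_tangent:
  fixes M :: "(real^'n::{finite,linorder}) set"
  assumes M: "C2_submanifold M d" and x: "x \<in> M" and \<delta>: "\<delta> > 0"
    and sls: "strongly_locally_symmetric (M \<inter> ball x \<delta>)"
    and ij: "x $ i = x $ j" "(i, j) \<notin> tied_coords M x"
  shows "axis i 1 - axis j 1 \<in> tangent_space M x"
proof -
  define T where "T = tangent_space M x"
  have subT: "subspace T" using tangent_space_subspace[OF M x] by (simp add: T_def)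
  obtain v where v: "v \<in> T" "v $ i \<noteq> v $ j" using ij unfolding tied_coords_def T_def by blast
  define \<tau> where "\<tau> = Transposition.transpose i j"
  have \<tau>: "\<tau> permutes UNIV" by (simp add: \<tau>_def permutes_swap_id)
  have \<tau>x: "perm_act \<tau> x = x" using ij(1) by (simp add: \<tau>_def perm_act_transpose)
  have "x \<in> M \<inter> ball x \<delta>" using x \<delta> by simp
  then have "perm_act \<tau> ` (M \<inter> ball x \<delta>) = M \<inter> ball x \<delta>"
    using sls \<tau> \<tau>x unfolding strongly_locally_symmetric_def by blast
  then have "perm_act \<tau> v \<in> T"
    using tangent_space_perm_act[OF \<delta> \<tau>x] v(1) unfolding T_def by blast
  then have "v - perm_act \<tau> v \<in> T" using v(1) subT by (simp add: subspace_diff)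
  then have "(1 / (v $ i - v $ j)) *\<^sub>R (v - perm_act \<tau> v) \<in> T" using subT by (rule subspace_scale[rotated])
  then show ?thesis using v(2) by (simp add: T_def \<tau>_def perm_act_transpose)
qed

text \<open>If some k with the same coordinate were not tied to i, then e_i - e_k would be tangent
  and would separate i from j. So a tied class with two elements exhausts its block of equal
  coordinates.\<close>

lemma tied_coords_whole_block:
  fixes M :: "(real^'n::{finite,linorder}) set"
  assumes M: "C2_submanifold M d" and x: "x \<in> M" and \<delta>: "\<delta> > 0"
    and sls: "strongly_locally_symmetric (M \<inter> ball x \<delta>)"
    and ij: "(i, j) \<in> tied_coords M x" "i \<noteq> j" and k: "x $ k = x $ i"
  shows "(i, k) \<in> tied_coords M x"
proof (rule ccontr)
  assume ik: "(i, k) \<notin> tied_coords M x"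
  then have "axis i 1 - axis k 1 \<in> tangent_space M x"
    using axis_diff_tangent[OF M x \<delta> sls] k by simp
  then have "(axis i 1 - axis k 1 :: real^'n::{finite,linorder}) $ i = (axis i 1 - axis k 1 :: real^'n::{finite,linorder}) $ j"
    using ij(1) unfolding tied_coords_def by blast
  moreover have "k \<noteq> j" "k \<noteq> i" using ik ij(1) equiv_tied_coords[of M x] by (auto simp: tied_coords_def)
  ultimately show False using ij(2) by (simp add: axis_def)
qed

definition class_const :: "('n \<times> 'n) set \<Rightarrow> (real^'n) set" where
  "class_const R = {z. \<forall>(i, j)\<in>R. z $ i = z $ j}"

text \<open>For the harder inclusion, split z orthogonally into a tangent part t and a normal part
  m. On a tied pair m is constant because z and t are; on an untied pair with equal coordinates of x
  it is constant because the tangent vector e_i - e_j is orthogonal to m. Hence m is a reduced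
  normal vector.\<close>

lemma tangent_plus_reduced_normal:
  fixes M :: "(real^'n::{finite,linorder}) set"
  assumes M: "C2_submanifold M d" and x: "x \<in> M" "x \<in> stratum \<sigma>" and \<delta>: "\<delta> > 0"
    and sls: "strongly_locally_symmetric (M \<inter> ball x \<delta>)"
  defines "T \<equiv> tangent_space M x" and "N \<equiv> normal_space M x \<inter> stratum_perpperp \<sigma>"
  shows "{t + m | t m. t \<in> T \<and> m \<in> N} = class_const (tied_coords M x)"
    and "dim (class_const (tied_coords M x)) = d + dim N"
proof -
  have subT: "subspace T" and dimT: "dim T = d" using tangent_space_subspace[OF M x(1)] by (simp_all add: T_def)
  have subN: "subspace N"
    unfolding N_def
  proof (rule subspace_inter)
    show "subspace (normal_space M x)"
      by (simp add: subspace_def normal_space_def inner_add_left)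
    show "subspace (stratum_perpperp \<sigma>)"
    proof (rule subspaceI)
      show "a + b \<in> stratum_perpperp \<sigma>"
        if "a \<in> stratum_perpperp \<sigma>" "b \<in> stratum_perpperp \<sigma>" for a b :: "real^'n::{finite,linorder}"
      proof -
        have "a $ i = a $ j \<and> b $ i = b $ j" if "x $ i = x $ j" for i j
          using \<open>a \<in> _\<close> \<open>b \<in> _\<close> that stratum_perpperp_iff[OF x(2)] by blast
        then show ?thesis unfolding stratum_perpperp_iff[OF x(2)] by (metis vector_add_component)
      qed
      show "c *\<^sub>R a \<in> stratum_perpperp \<sigma>"
        if "a \<in> stratum_perpperp \<sigma>" for c and a :: "real^'n::{finite,linorder}"
        using that unfolding stratum_perpperp_iff[OF x(2)] by (metis vector_scaleR_component)
    qed (simp add: stratum_perpperp_def)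
  qed
  note free = axis_diff_tangent[OF M x(1) \<delta> sls, folded T_def]
  show eq: "{t + m | t m. t \<in> T \<and> m \<in> N} = class_const (tied_coords M x)"
  proof (intro Set.equalityI subsetI)
    fix z assume "z \<in> {t + m | t m. t \<in> T \<and> m \<in> N}"
    then show "z \<in> class_const (tied_coords M x)"
    proof -
      obtain t m where tm: "z = t + m" "t \<in> T" "m \<in> N" using \<open>z \<in> _\<close> by blast
      have "t $ i = t $ j \<and> m $ i = m $ j" if "(i, j) \<in> tied_coords M x" for i j
        using tm that stratum_perpperp_iff[OF x(2), of m] unfolding tied_coords_def T_def N_def by blast
      then show ?thesis using tm(1) by (auto simp: class_const_def)
    qed
  next
    fix z assume z: "z \<in> class_const (tied_coords M x)"
    obtain t m where tm: "t \<in> span T" "\<And>w. w \<in> span T \<Longrightarrow> orthogonal m w" "z = t + m"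
      using orthogonal_subspace_decomp_exists[of T z] by blast
    have t: "t \<in> T" and m_perp: "\<And>w. w \<in> T \<Longrightarrow> m \<bullet> w = 0"
      using tm subT by (simp_all add: span_eq_iff[THEN iffD2] orthogonal_def)
    have "m $ i = m $ j" if "x $ i = x $ j" for i j
    proof (cases "(i, j) \<in> tied_coords M x")
      case True
      then have "z $ i = z $ j" "t $ i = t $ j" using z t unfolding class_const_def tied_coords_def T_def by blast+
      then show ?thesis using tm(3) by simp
    next
      case False
      then show ?thesis
        using m_perp[OF free[OF that]] inner_axis_diff[of i j m] by (simp add: inner_commute)
    qed
    then have "m \<in> stratum_perpperp \<sigma>" using stratum_perpperp_iff[OF x(2), of m] by blast
    moreover have "m \<in> normal_space M x" using m_perp by (simp add: normal_space_def T_def)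
    ultimately have "m \<in> N" by (simp add: N_def)
    then show "z \<in> {t + m | t m. t \<in> T \<and> m \<in> N}" using t tm(3) by blast
  qed
  have "dim {t + m | t m. t \<in> T \<and> m \<in> N} + dim (T \<inter> N) = dim T + dim N"
    using dim_sums_Int[OF subT subN] by simp
  moreover have "T \<inter> N = {0}"
  proof -
    have "v = 0" if "v \<in> T" "v \<in> N" for v
      using that by (simp add: N_def normal_space_def T_def) (metis inner_eq_zero_iff)
    then show ?thesis using subspace_0[OF subT] subspace_0[OF subN] by blast
  qed
  ultimately show "dim (class_const (tied_coords M x)) = d + dim N"
    using dimT eq by simp
qed

section \<open>Dimension counts\<close>

text \<open>The indicator vectors of the classes are an orthogonal basis.\<close>

lemma dim_class_const:
  fixes R :: "('n::finite \<times> 'n) set"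
  assumes R: "equiv UNIV R"
  shows "dim (class_const R) = card (UNIV // R)"
proof -
  define e where "e I = (\<chi> i. if i \<in> I then 1 else (0::real))" for I :: "'n set"
  define P where "P = UNIV // R"
  have disj: "I = J" if "I \<in> P" "J \<in> P" "i \<in> I" "i \<in> J" for I J i
    using quotient_disj[OF R] that unfolding P_def by blast
  have ne: "\<exists>i. i \<in> I" if "I \<in> P" for I
    using in_quotient_imp_non_empty[OF R] that unfolding P_def by blast
  have e_orth: "e I \<bullet> e J = 0" if "I \<in> P" "J \<in> P" "I \<noteq> J" for I J
  proof -
    have "i \<notin> I \<or> i \<notin> J" for i using disj[OF that(1,2)] that(3) by blast
    then show ?thesis unfolding inner_vec_def by (intro sum.neutral) (simp add: e_def)
  qed
  have e_ne: "e I \<noteq> 0" if "I \<in> P" for I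
    using ne[OF that] by (auto simp: e_def vec_eq_iff)
  have e_inj: "inj_on e P"
  proof (rule inj_onI, rule ccontr)
    fix I J assume "I \<in> P" "J \<in> P" "e I = e J" "I \<noteq> J"
    then show False using e_orth[of I J] e_ne[of I] by simp
  qed
  have ind: "independent (e ` P)"
  proof (rule pairwise_orthogonal_independent)
    show "pairwise orthogonal (e ` P)"
      unfolding pairwise_def orthogonal_def using e_orth by blast
    show "0 \<notin> e ` P" using e_ne by (metis imageE)
  qed
  have sub: "e ` P \<subseteq> class_const R"
  proof
    fix z assume "z \<in> e ` P"
    then obtain I where I: "I \<in> P" "z = e I" by blast
    have "i \<in> I \<longleftrightarrow> j \<in> I" if "(i, j) \<in> R" for i j
      using in_quotient_imp_closed[OF R, of I] I(1) that R unfolding P_def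
      by (metis equiv_def symE)
    then show "z \<in> class_const R" unfolding class_const_def I(2) e_def by auto
  qed
  have span: "class_const R \<subseteq> span (e ` P)"
  proof
    fix z assume z: "z \<in> class_const R"
    have "z = (\<Sum>I\<in>P. z $ (SOME i. i \<in> I) *\<^sub>R e I)"
    proof (subst vec_eq_iff, rule allI)
      fix k
      define C where "C = R `` {k}"
      have C: "C \<in> P" "k \<in> C" unfolding C_def P_def
        using equiv_class_self[OF R, of k] by (simp_all add: quotientI)
      have "(SOME i. i \<in> C) \<in> C" using C(2) by (rule someI)
      then have "(k, SOME i. i \<in> C) \<in> R" by (simp add: C_def)
      then have zk: "z $ (SOME i. i \<in> C) = z $ k" using z unfolding class_const_def by force
      have "(\<Sum>I\<in>P. z $ (SOME i. i \<in> I) *\<^sub>R e I) $ k = (\<Sum>I\<in>P. if I = C then z $ k else 0)"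
        unfolding sum_component
      proof (rule sum.cong)
        fix I assume I: "I \<in> P"
        show "(z $ (SOME i. i \<in> I) *\<^sub>R e I) $ k = (if I = C then z $ k else 0)"
        proof (cases "I = C")
          case True
          then show ?thesis using zk C(2) by (simp add: e_def)
        next
          case False
          then have "k \<notin> I" using disj[OF I C(1) _ C(2)] by blast
          then show ?thesis using False by (simp add: e_def)
        qed
      qed simp
      also have "\<dots> = z $ k" using C(1) by (simp add: P_def)
      finally show "z $ k = (\<Sum>I\<in>P. z $ (SOME i. i \<in> I) *\<^sub>R e I) $ k" ..
    qed
    also have "\<dots> \<in> span (e ` P)" by (intro span_sum span_scale span_base) auto
    finally show "z \<in> span (e ` P)" .
  qed
  have "card (e ` P) = dim (class_const R)"
    using basis_card_eq_dim[OF sub span ind] by simp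
  then show ?thesis using card_image[OF e_inj] by (simp add: P_def)
qed

lemma card_ordered_pairs:
  fixes I :: "'n::linorder set"
  assumes "finite I"
  shows "card {(i, j). i \<in> I \<and> j \<in> I \<and> i \<le> j} = card I * (card I + 1) div 2"
proof -
  define A where "A = {(i, j). i \<in> I \<and> j \<in> I \<and> i \<le> j}"
  define B where "B = {(i, j). i \<in> I \<and> j \<in> I \<and> j \<le> i}"
  have AB: "A \<union> B = I \<times> I" "A \<inter> B = (\<lambda>i. (i, i)) ` I" "B = prod.swap ` A"
    by (auto simp: A_def B_def)
  have fin: "finite A" "finite B"
    using finite_subset[OF _ finite_cartesian_product[OF assms assms]] AB(1) by blast+
  have "card A + card B = card (I \<times> I) + card ((\<lambda>i. (i, i)) ` I)"
    using card_Un_Int[OF fin] unfolding AB(1,2) .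
  moreover have "card B = card A" unfolding AB(3) by (intro card_image) (auto simp: inj_on_def)
  moreover have "card ((\<lambda>i. (i, i)) ` I) = card I" by (intro card_image) (auto simp: inj_on_def)
  ultimately have "2 * card A = card I * (card I + 1)" by (simp add: card_cartesian_product)
  then show ?thesis unfolding A_def by simp
qed

text \<open>The symmetrised matrix units, indexed by pairs on or above the diagonal, are an
  orthogonal basis.\<close>

lemma dim_sym_mats:
  "dim (sym_mats :: (real^'n::{finite,linorder}^'n::{finite,linorder}) set) = CARD('n) * (CARD('n) + 1) div 2"
proof -
  define P where "P = {(i, j). i \<in> (UNIV :: 'n set) \<and> j \<in> UNIV \<and> i \<le> j}"
  define b :: "'n \<times> 'n \<Rightarrow> real^'n::{finite,linorder}^'n::{finite,linorder}"
    where "b p = (\<chi> r c. if (r, c) = p \<or> (c, r) = p then 1 else 0)" for p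
  have b_orth: "b p \<bullet> b p' = 0" if "p \<in> P" "p' \<in> P" "p \<noteq> p'" for p p'
    unfolding inner_vec_def b_def using that by (intro sum.neutral ballI) (auto simp: P_def)
  have b_ne: "b p \<noteq> 0" for p
    by (cases p) (auto simp: b_def vec_eq_iff)
  have b_inj: "inj_on b P"
  proof (rule inj_onI, rule ccontr)
    fix p p' assume "p \<in> P" "p' \<in> P" "b p = b p'" "p \<noteq> p'"
    then show False using b_orth[of p p'] b_ne[of p] by simp
  qed
  have ind: "independent (b ` P)"
  proof (rule pairwise_orthogonal_independent)
    show "pairwise orthogonal (b ` P)"
      unfolding pairwise_def orthogonal_def using b_orth by blast
    show "0 \<notin> b ` P" using b_ne by (metis imageE)
  qed
  have sub: "b ` P \<subseteq> sym_mats"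
    by (auto simp: sym_mats_def b_def vec_eq_iff transpose_def)
  have span: "sym_mats \<subseteq> span (b ` P)"
  proof
    fix X :: "real^'n::{finite,linorder}^'n::{finite,linorder}" assume "X \<in> sym_mats"
    then have X: "X $ r $ c = X $ c $ r" for r c
      by (metis (mono_tags, lifting) mem_Collect_eq sym_mats_def transpose_def vec_lambda_beta)
    have "X = (\<Sum>p\<in>P. X $ fst p $ snd p *\<^sub>R b p)"
    proof (subst vec_eq_iff, rule allI, subst vec_eq_iff, rule allI)
      fix r c
      have "(\<Sum>p\<in>P. X $ fst p $ snd p *\<^sub>R b p) $ r $ c = (\<Sum>p\<in>P. if p = (min r c, max r c) then X $ r $ c else 0)"
        unfolding sum_component
      proof (rule sum.cong)
        fix p assume "p \<in> P"
        then have "(r, c) = p \<or> (c, r) = p \<longleftrightarrow> p = (min r c, max r c)"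
          by (cases p) (auto simp: P_def min_def max_def)
        moreover have "X $ min r c $ max r c = X $ r $ c" using X[of r c] by (simp add: min_def max_def)
        ultimately show "(X $ fst p $ snd p *\<^sub>R b p) $ r $ c = (if p = (min r c, max r c) then X $ r $ c else 0)"
          by (simp add: b_def)
      qed simp
      also have "(min r c, max r c) \<in> P" by (auto simp: P_def min_def max_def)
      then have "(\<Sum>p\<in>P. if p = (min r c, max r c) then X $ r $ c else 0) = X $ r $ c" by simp
      finally show "X $ r $ c = (\<Sum>p\<in>P. X $ fst p $ snd p *\<^sub>R b p) $ r $ c" ..
    qed
    also have "\<dots> \<in> span (b ` P)" by (intro span_sum span_scale span_base) auto
    finally show "X \<in> span (b ` P)" .
  qed
  have "card (b ` P) = dim (sym_mats :: (real^'n::{finite,linorder}^'n::{finite,linorder}) set)"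
    using basis_card_eq_dim[OF sub span ind] by simp
  moreover have "card P = CARD('n) * (CARD('n) + 1) div 2"
    unfolding P_def by (rule card_ordered_pairs) simp
  ultimately show ?thesis using card_image[OF b_inj] by simp
qed

text \<open>Equations are indexed by unordered pairs within a class; one diagonal pair per class is dropped because
  the common eigenvalue of the class is free.\<close>
definition equation_indices :: "('n::{finite,linorder} \<times> 'n) set \<Rightarrow> ('n \<times> 'n) set" where
  "equation_indices R = {(i, j). (i, j) \<in> R \<and> i \<le> j \<and> \<not> (i = j \<and> i = Min (R `` {i}))}"

text \<open>Each class of size k has k(k+1)/2 ordered pairs and gives up exactly one of them. The
  additive form avoids truncated subtraction.\<close>

lemma card_equation_indices:
  fixes R :: "('n::{finite,linorder} \<times> 'n) set"
  assumes R: "equiv UNIV R"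
  shows "card (equation_indices R) + card (UNIV // R) = (\<Sum>I\<in>UNIV // R. card I * (card I + 1) div 2)"
proof -
  define P where "P = UNIV // R"
  define A where "A I = {(i, j). i \<in> I \<and> j \<in> I \<and> i \<le> j}" for I :: "'n set"
  have disj: "I = J" if "I \<in> P" "J \<in> P" "i \<in> I" "i \<in> J" for I J i
    using quotient_disj[OF R] that unfolding P_def by blast
  have ne: "I \<noteq> {}" if "I \<in> P" for I
    using in_quotient_imp_non_empty[OF R] that unfolding P_def by blast
  have cls: "R `` {i} = I" if "I \<in> P" "i \<in> I" for I i
    using disj[of "R `` {i}" I i] that quotientI[of i UNIV R] equiv_class_self[OF R, of i]
    by (simp add: P_def)
  have "card (\<Union>I\<in>P. A I) = (\<Sum>I\<in>P. card (A I))"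
    by (rule card_UN_disjoint) (use disj in \<open>auto simp: A_def\<close>)
  also have "\<dots> = (\<Sum>I\<in>P. card I * (card I + 1) div 2)"
    unfolding A_def by (intro sum.cong refl card_ordered_pairs) simp
  finally have cardA: "card (\<Union>I\<in>P. A I) = (\<Sum>I\<in>P. card I * (card I + 1) div 2)" .
  define m where "m I = (Min I, Min I)" for I :: "'n set"
  have Min_in: "Min I \<in> I" if "I \<in> P" for I using ne[OF that] by simp
  have "inj_on m P"
    using disj Min_in by (intro inj_onI) (metis m_def prod.inject)
  then have cardm: "card (m ` P) = card P" by (rule card_image)
  have UA: "(\<Union>I\<in>P. A I) = {(i, j). (i, j) \<in> R \<and> i \<le> j}"
  proof (intro Set.equalityI subsetI)
    fix p assume "p \<in> (\<Union>I\<in>P. A I)"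
    then obtain I i j where "I \<in> P" "p = (i, j)" "i \<in> I" "j \<in> I" "i \<le> j" by (auto simp: A_def)
    then show "p \<in> {(i, j). (i, j) \<in> R \<and> i \<le> j}" using cls[of I i] by auto
  next
    fix p assume "p \<in> {(i, j). (i, j) \<in> R \<and> i \<le> j}"
    then obtain i j where p: "p = (i, j)" "(i, j) \<in> R" "i \<le> j" by auto
    then have "p \<in> A (R `` {i})" using equiv_class_self[OF R, of i] by (auto simp: A_def)
    then show "p \<in> (\<Union>I\<in>P. A I)" unfolding P_def using quotientI[of i UNIV R] by blast
  qed
  have "equation_indices R = (\<Union>I\<in>P. A I) - m ` P"
  proof -
    have "(i, j) \<in> m ` P \<longleftrightarrow> i = j \<and> i = Min (R `` {i})" for i j
    proof
      assume "(i, j) \<in> m ` P"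
      then obtain I where "I \<in> P" "i = Min I" "j = Min I" by (auto simp: m_def)
      then show "i = j \<and> i = Min (R `` {i})" using cls[of I i] Min_in[of I] by simp
    next
      assume "i = j \<and> i = Min (R `` {i})"
      then have "(i, j) = m (R `` {i})" unfolding m_def by metis
      then show "(i, j) \<in> m ` P" using quotientI[of i UNIV R] by (auto simp: P_def)
    qed
    then have "m ` P = {(i, j). i = j \<and> i = Min (R `` {i})}"
      by (simp only: set_eq_iff split_paired_All mem_Collect_eq prod.case) simp
    then show ?thesis unfolding UA equation_indices_def by auto
  qed
  moreover have "m ` P \<subseteq> (\<Union>I\<in>P. A I)" using Min_in by (auto simp: m_def A_def)
  ultimately have "card (equation_indices R) = card (\<Union>I\<in>P. A I) - card (m ` P)"
    by (simp add: card_Diff_subset)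
  moreover have "card (m ` P) \<le> card (\<Union>I\<in>P. A I)"
    using \<open>m ` P \<subseteq> (\<Union>I\<in>P. A I)\<close> by (intro card_mono) auto
  ultimately show ?thesis using cardA cardm by (simp add: P_def)
qed

text \<open>One-element classes are the fixed points of the permutation and contribute 1 each; they
  produce the number of fixed points in the dimension formula.\<close>

lemma perm_partition_sum:
  fixes R :: "('n::finite \<times> 'n) set"
  assumes R: "equiv UNIV R" and part: "perm_partition \<sigma> = UNIV // R"
  shows "(\<Sum>I\<in>UNIV // R. card I * (card I + 1) div 2) = card (- supp_perm \<sigma>)
     + (\<Sum>I\<in>{I\<in>perm_partition \<sigma>. card I \<ge> 2}. card I * (card I + 1) div 2)"
proof -
  have cls: "perm_rel \<sigma> `` {i} = R `` {i}" for i
  proof (rule equiv_quotient_class[OF R])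
    show "UNIV // R = UNIV // perm_rel \<sigma>" using part by (simp add: perm_partition_def)
    show "(i, i) \<in> perm_rel \<sigma>" by (auto simp: perm_rel_def intro: exI[of _ 0])
  qed
  have single: "R `` {i} = {i} \<longleftrightarrow> \<sigma> i = i" for i
  proof
    assume "R `` {i} = {i}"
    moreover have "\<sigma> i \<in> perm_rel \<sigma> `` {i}" by (auto simp: perm_rel_def intro: exI[of _ 1])
    ultimately show "\<sigma> i = i" unfolding cls by simp
  next
    assume "\<sigma> i = i"
    then have "(\<sigma> ^^ k) i = i" for k by (induction k) auto
    then have "perm_rel \<sigma> `` {i} = {i}" by (auto simp: perm_rel_def)
    then show "R `` {i} = {i}" unfolding cls .
  qed
  have pos: "card I \<noteq> 0" if "I \<in> UNIV // R" for I
    using in_quotient_imp_non_empty[OF R that] by simp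
  define A where "A = {I\<in>UNIV // R. card I = 1}"
  define B where "B = {I\<in>UNIV // R. card I \<ge> 2}"
  have "card I = 1 \<or> card I \<ge> 2" if "I \<in> UNIV // R" for I using pos[OF that] by linarith
  then have "UNIV // R = A \<union> B" "A \<inter> B = {}" by (auto simp: A_def B_def)
  then have "(\<Sum>I\<in>UNIV // R. card I * (card I + 1) div 2) =
      (\<Sum>I\<in>A. card I * (card I + 1) div 2) + (\<Sum>I\<in>B. card I * (card I + 1) div 2)"
    by (simp add: sum.union_disjoint)
  also have "(\<Sum>I\<in>A. card I * (card I + 1) div 2) = (\<Sum>I\<in>A. 1)"
    by (intro sum.cong) (auto simp: A_def)
  also have "\<dots> = card A" by simp
  also have "A = (\<lambda>i. {i}) ` (- supp_perm \<sigma>)"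
  proof (intro Set.equalityI subsetI)
    fix I assume "I \<in> A"
    then obtain i where i: "I = {i}" "I \<in> UNIV // R" by (auto simp: A_def card_1_singleton_iff)
    then obtain k where k: "I = R `` {k}" by (auto simp: quotient_def)
    have "k \<in> I" using k equiv_class_self[OF R] by simp
    then show "I \<in> (\<lambda>i. {i}) ` (- supp_perm \<sigma>)" using i k single[of k] by (auto simp: supp_perm_def)
  next
    fix I assume "I \<in> (\<lambda>i. {i}) ` (- supp_perm \<sigma>)"
    then obtain i where "I = {i}" "\<sigma> i = i" by (auto simp: supp_perm_def)
    then show "I \<in> A" using single[of i] quotientI[of i UNIV R] by (simp add: A_def)
  qed
  also have "card \<dots> = card (- supp_perm \<sigma>)" by (intro card_image) (auto simp: inj_on_def)
  finally show ?thesis using part by (simp add: B_def)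
qed

section \<open>Lifting to symmetric matrices\<close>

text \<open>Where u vanishes, continuity of v suffices for the product rule. Hence differentiability
  of the fixed point V at A can be read off its own equation, in which every term carries an entry
  of E vanishing at A.\<close>

lemma has_derivative_mult_vanishing:
  fixes u v :: "'a::real_normed_vector \<Rightarrow> real"
  assumes u: "(u has_derivative u') (at x)" "u x = 0" and v: "isCont v x"
  shows "((\<lambda>y. u y * v y) has_derivative (\<lambda>h. u' h * v x)) (at x)"
  unfolding has_derivative_at_alt
proof (intro conjI allI impI)
  have bl: "bounded_linear u'" using u(1) by (rule has_derivative_bounded_linear)
  then show "bounded_linear (\<lambda>h. u' h * v x)" by (rule bounded_linear_mult_const)
  fix e :: real assume e: "0 < e"
  obtain K where K: "K > 0" "\<And>h. norm (u' h) \<le> norm h * K" using bounded_linear.pos_bounded[OF bl] by blast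
  define c where "c = \<bar>v x\<bar> + 1"
  have c: "c > 0" by (simp add: c_def)
  have "e / (2 * c) > 0" using e c by simp
  then obtain d1 where d1: "d1 > 0" "\<And>y. norm (y - x) < d1 \<Longrightarrow> norm (u y - u x - u' (y - x)) \<le> e / (2 * c) * norm (y - x)"
    using u(1) unfolding has_derivative_at_alt by blast
  have pos2: "0 < min 1 (e / (2 * K))" using e K(1) by simp
  obtain d2 where d2: "d2 > 0" "\<And>y. dist y x < d2 \<Longrightarrow> dist (v y) (v x) < min 1 (e / (2 * K))"
    using v pos2 unfolding continuous_at_eps_delta by blast
  show "\<exists>d>0. \<forall>y. norm (y - x) < d \<longrightarrow>
     norm (u y * v y - u x * v x - u' (y - x) * v x) \<le> e * norm (y - x)"
  proof (intro exI[of _ "min d1 d2"] conjI allI impI)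
    show "0 < min d1 d2" using d1 d2 by simp
    fix y assume "norm (y - x) < min d1 d2"
    then have a: "\<bar>u y - u' (y - x)\<bar> \<le> e / (2 * c) * norm (y - x)" and b: "\<bar>v y - v x\<bar> < 1" "\<bar>v y - v x\<bar> < e / (2 * K)"
      using d1(2)[of y] d2(2)[of y] u(2) by (auto simp: dist_norm)
    have vy: "\<bar>v y\<bar> \<le> c" using b(1) unfolding c_def by linarith
    have "u y * v y - u x * v x - u' (y - x) * v x = (u y - u' (y - x)) * v y + u' (y - x) * (v y - v x)"
      using u(2) by (simp add: algebra_simps)
    also have "\<bar>\<dots>\<bar> \<le> \<bar>u y - u' (y - x)\<bar> * \<bar>v y\<bar> + \<bar>u' (y - x)\<bar> * \<bar>v y - v x\<bar>"
      by (simp add: abs_mult[symmetric] abs_triangle_ineq)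
    also have "\<dots> \<le> (e / (2 * c) * norm (y - x)) * c + (norm (y - x) * K) * (e / (2 * K))"
      using a vy b(2) K e c by (intro add_mono mult_mono) (auto intro: less_imp_le)
    also have "\<dots> = e * norm (y - x)" using K(1) c by (simp add: field_simps)
    finally show "norm (u y * v y - u x * v x - u' (y - x) * v x) \<le> e * norm (y - x)" by simp
  qed
qed

section \<open>Matrix entries in an orthonormal frame\<close>

definition frame_coords :: "('n \<Rightarrow> real^'n) \<Rightarrow> real^'n^'n \<Rightarrow> real^'n^'n" where
  "frame_coords q X = (\<chi> i j. q i \<bullet> (X *v q j))"

lemma frame_coords_eq_conj:
  "frame_coords q X = transpose (\<chi> r c. q c $ r) ** X ** (\<chi> r c. q c $ r)"
proof -
  have "(transpose (\<chi> r c. q c $ r) ** X ** (\<chi> r c. q c $ r)) $ i $ j = frame_coords q X $ i $ j" for i j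
    unfolding matrix_mul_assoc[symmetric]
    by (simp add: frame_coords_def matrix_matrix_mult_def matrix_vector_mult_def transpose_def inner_vec_def)
  then show ?thesis by (simp add: vec_eq_iff)
qed

lemma orthonormal_frame_matrix:
  fixes q :: "'n \<Rightarrow> real^'n"
  assumes "\<And>i j. q i \<bullet> q j = (if i = j then 1 else 0)"
  shows "transpose (\<chi> r c. q c $ r) ** (\<chi> r c. q c $ r) = mat 1"
  using assms by (simp add: vec_eq_iff matrix_matrix_mult_def transpose_def mat_def inner_vec_def)

lemma frame_coords_sym: "X \<in> sym_mats \<Longrightarrow> frame_coords q X \<in> sym_mats"
proof -
  assume "X \<in> sym_mats"
  then have "transpose X = X" by (simp add: sym_mats_def)
  then have "q j \<bullet> (X *v q i) = q i \<bullet> (X *v q j)" for i j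
    using symmetric_matrix_inner[of X "q i" "q j"] by (metis inner_commute)
  then have "transpose (frame_coords q X) $ i $ j = frame_coords q X $ i $ j" for i j
    by (simp add: frame_coords_def transpose_def)
  then show ?thesis by (simp add: sym_mats_def vec_eq_iff)
qed

lemma eigvals_frame_coords:
  fixes q :: "'n::{finite,linorder} \<Rightarrow> real^'n::{finite,linorder}"
  assumes on: "\<And>i j. q i \<bullet> q j = (if i = j then 1 else 0)"
  shows "eigvals (frame_coords q X) = eigvals X"
proof -
  define P where "P = (\<chi> r c. q c $ r)"
  have PP: "transpose P ** P = mat 1" unfolding P_def using orthonormal_frame_matrix[OF on] .
  have "det (mat t - frame_coords q X) = det (mat t - X)" for t
  proof -
    have "mat t *v v = t *\<^sub>R v" for v :: "real^'n::{finite,linorder}"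
      by (simp add: vec_eq_iff matrix_vector_mult_def mat_def if_distrib if_distribR cong: if_cong)
    then have "frame_coords q (mat t - X) $ i $ j = t * (q i \<bullet> q j) - frame_coords q X $ i $ j" for i j
      by (simp add: frame_coords_def matrix_vector_mult_diff_rdistrib inner_diff_right)
    then have "mat t - frame_coords q X = frame_coords q (mat t - X)"
      by (simp add: vec_eq_iff mat_def on)
    then have "mat t - frame_coords q X = transpose P ** (mat t - X) ** P"
      unfolding frame_coords_eq_conj P_def[symmetric] .
    then have "det (mat t - frame_coords q X) = det (transpose P) * det (mat t - X) * det P"
      by (simp add: det_mul)
    also have "\<dots> = det (mat t - X) * det (transpose P ** P)" by (simp add: det_mul)
    finally show ?thesis by (simp add: PP)
  qed
  then show ?thesis unfolding eigvals_def by simp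
qed

lemma frame_coords_surj:
  fixes q :: "'n \<Rightarrow> real^'n"
  assumes on: "\<And>i j. q i \<bullet> q j = (if i = j then 1 else 0)" and Z: "Z \<in> sym_mats"
  obtains H where "H \<in> sym_mats" "frame_coords q H = Z"
proof -
  define P where "P = (\<chi> r c. q c $ r)"
  have PP: "transpose P ** P = mat 1" unfolding P_def using orthonormal_frame_matrix[OF on] .
  show ?thesis
  proof
    show "P ** Z ** transpose P \<in> sym_mats"
      using Z by (simp add: sym_mats_def matrix_transpose_mul matrix_mul_assoc)
    have "frame_coords q (P ** Z ** transpose P) = (transpose P ** P) ** Z ** (transpose P ** P)"
      unfolding frame_coords_eq_conj P_def[symmetric] by (simp only: matrix_mul_assoc)
    then show "frame_coords q (P ** Z ** transpose P) = Z" by (simp add: PP)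
  qed
qed

section \<open>Analytic equations for coinciding eigenvalues near a given matrix\<close>

locale spectral_chart =
  fixes A :: "real^'n::{finite,linorder}^'n::{finite,linorder}"
    and q :: "'n::{finite,linorder} \<Rightarrow> real^'n::{finite,linorder}"
    and g \<epsilon> r :: real and V :: "'n \<Rightarrow> 'n \<Rightarrow> real^'n::{finite,linorder}^'n::{finite,linorder} \<Rightarrow> real"
  assumes A: "A \<in> sym_mats"
    and on: "\<And>i j. q i \<bullet> q j = (if i = j then 1 else 0)"
    and eig: "\<And>i. A *v q i = (eigvals A $ i) *\<^sub>R q i"
    and g: "g > 0" and gap: "\<And>i j. eigvals A $ i \<noteq> eigvals A $ j \<Longrightarrow> g \<le> \<bar>eigvals A $ i - eigvals A $ j\<bar>"
    and r: "r > 0"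
    and E_bound: "\<And>i j. power_series_bound (\<lambda>X. q i \<bullet> ((X - A) *v q j)) A r \<epsilon>"
    and small_V: "real CARD('n) * (block_const TYPE('n) g * \<epsilon> * 2) < 1"
    and small_E: "real CARD('n) * (real CARD('n) * \<epsilon> * 2) < g / 2"
    and V_bound: "\<And>i j. power_series_bound (V i j) A r 2"
    and V_fix: "\<And>i j X. X \<in> cube_at A r \<Longrightarrow>
        V i j X = block_map (eigvals A) (\<lambda>i j. q i \<bullet> ((X - A) *v q j)) (\<lambda>i j. V i j X) i j"
begin

abbreviation "D \<equiv> eigvals A"

definition E where "E i j X = q i \<bullet> ((X - A) *v q j)"

lemma frame_coords_eq: "frame_coords q X $ i $ j = (if i = j then D $ i else 0) + E i j X"
  by (simp add: frame_coords_def E_def matrix_vector_mult_diff_rdistrib inner_diff_right eig on)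

lemma E_eq: "E i j X = frame_coords q X $ i $ j - (if i = j then D $ i else 0)"
  by (simp add: frame_coords_eq)

lemma E_A: "E i j A = 0"
  by (simp add: E_def)

lemma E_le: "X \<in> cube_at A r \<Longrightarrow> \<bar>E i j X\<bar> \<le> \<epsilon>"
  unfolding E_def using power_series_bound_abs_le[OF E_bound] .

lemma V_le: "X \<in> cube_at A r \<Longrightarrow> \<bar>V i j X\<bar> \<le> 2"
  using power_series_bound_abs_le[OF V_bound] .

lemma V_fix': "X \<in> cube_at A r \<Longrightarrow> V i j X = block_map D (\<lambda>i j. E i j X) (\<lambda>i j. V i j X) i j"
  unfolding E_def by (rule V_fix)

lemma block_diagonalised:
  assumes "X \<in> sym_mats" "X \<in> cube_at A r" "\<And>i. \<bar>eigvals X $ i - D $ i\<bar> < g / 2"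
  shows "block_diagonalised (frame_coords q X) D (\<lambda>i j. V i j X) g \<epsilon>"
proof
  show "frame_coords q X \<in> sym_mats" using frame_coords_sym[OF assms(1)] .
  show "\<bar>frame_coords q X $ i $ j - (if i = j then D $ i else 0)\<bar> \<le> \<epsilon>" for i j
    using E_le[OF assms(2)] unfolding E_eq .
  show "V i j X = block_map D (\<lambda>i j. frame_coords q X $ i $ j - (if i = j then D $ i else 0)) (\<lambda>i j. V i j X) i j" for i j
    using V_fix'[OF assms(2)] unfolding E_eq .
  show "\<bar>eigvals (frame_coords q X) $ i - D $ i\<bar> < g / 2" for i
    using assms(3) by (simp add: eigvals_frame_coords[OF on])
qed (rule g gap small_V small_E V_le[OF assms(2)]; assumption)+

text \<open>The matrix S of the block diagonalisation, split along \<open>frame_coords q X\<close> =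
  diag D + E. For i, j in one block the first sum is constant to first order at A, and every term of
  the second has a factor vanishing at A.\<close>

definition Sf where "Sf i j X = (\<Sum>k\<in>UNIV. D $ k * (V k i X * V k j X))
    + (\<Sum>k\<in>UNIV. \<Sum>l\<in>UNIV. E k l X * (V k i X * V l j X))"

definition Gf where "Gf i j X = (\<Sum>k\<in>UNIV. V k i X * V k j X)"

lemma frame_inner:
  defines "v \<equiv> \<lambda>j X. column j (\<chi> i j. V i j X)"
  shows "v i X \<bullet> (frame_coords q X *v v j X) = Sf i j X" "v i X \<bullet> v j X = Gf i j X"
proof -
  have "v i X \<bullet> (frame_coords q X *v v j X) = (\<Sum>k\<in>UNIV. V k i X * (\<Sum>l\<in>UNIV. frame_coords q X $ k $ l * V l j X))"
    by (simp add: v_def inner_vec_def column_def matrix_vector_mult_def)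
  also have "\<dots> = (\<Sum>k\<in>UNIV. D $ k * (V k i X * V k j X) + (\<Sum>l\<in>UNIV. E k l X * (V k i X * V l j X)))"
  proof (intro sum.cong refl)
    fix k
    have "(\<Sum>l\<in>UNIV. frame_coords q X $ k $ l * V l j X) = (\<Sum>l\<in>UNIV. (if l = k then D $ k * V k j X else 0) + E k l X * V l j X)"
      unfolding frame_coords_eq by (intro sum.cong) (auto simp: distrib_right)
    also have "\<dots> = D $ k * V k j X + (\<Sum>l\<in>UNIV. E k l X * V l j X)"
      by (simp add: sum.distrib)
    finally show "V k i X * (\<Sum>l\<in>UNIV. frame_coords q X $ k $ l * V l j X)
        = D $ k * (V k i X * V k j X) + (\<Sum>l\<in>UNIV. E k l X * (V k i X * V l j X))"
      by (simp add: distrib_left sum_distrib_left mult.left_commute)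
  qed
  finally show "v i X \<bullet> (frame_coords q X *v v j X) = Sf i j X" by (simp add: Sf_def sum.distrib)
  show "v i X \<bullet> v j X = Gf i j X" by (simp add: v_def inner_vec_def column_def Gf_def)
qed

lemma eigvals_const_on_block_iff:
  assumes X: "X \<in> sym_mats" "X \<in> cube_at A r" "\<And>i. \<bar>eigvals X $ i - D $ i\<bar> < g / 2"
  shows "(\<forall>i. D $ i = D $ a \<longrightarrow> eigvals X $ i = eigvals X $ a) \<longleftrightarrow>
   (\<forall>i j. D $ i = D $ a \<and> D $ j = D $ a \<longrightarrow> Sf i j X * Gf a a X = Sf a a X * Gf i j X)"
    and "Sf i j X = Sf j i X" "Gf i j X = Gf j i X"
proof -
  interpret B: block_diagonalised "frame_coords q X" D "\<lambda>i j. V i j X" g \<epsilon>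
    using block_diagonalised[OF X] .
  have S: "B.S = (\<lambda>i j. Sf i j X)" and G: "B.G = (\<lambda>i j. Gf i j X)"
    using frame_inner by (simp_all add: fun_eq_iff B.S_def B.G_def B.Ve_def)
  show "(\<forall>i. D $ i = D $ a \<longrightarrow> eigvals X $ i = eigvals X $ a) \<longleftrightarrow>
   (\<forall>i j. D $ i = D $ a \<and> D $ j = D $ a \<longrightarrow> Sf i j X * Gf a a X = Sf a a X * Gf i j X)"
    using B.eigvals_const_on_block_iff[of a] unfolding S G eigvals_frame_coords[OF on] .
  show "Sf i j X = Sf j i X" using B.S_commute[of i j] unfolding S .
  show "Gf i j X = Gf j i X" by (simp add: Gf_def mult.commute)
qed

text \<open>Proportionality of S and G, with the common eigenvalue
  \<open>Sf a a X / Gf a a X\<close> inserted and its denominator cleared, so that F is polynomial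
  in D, E and V.\<close>

definition F where "F a i j X = Sf i j X * Gf a a X - Sf a a X * Gf i j X"

lemma F_real_analytic:
  assumes "X \<in> ball A (r / 2)"
  shows "real_analytic_at (F a i j) X"
proof -
  have E: "power_series_bound (E i j) A r \<epsilon>" for i j unfolding E_def using E_bound .
  have "power_series_bound (Sf i j) A r ((\<Sum>k\<in>UNIV. \<bar>D $ k\<bar> * (2 * 2))
      + (\<Sum>k\<in>(UNIV::'n set). \<Sum>l\<in>(UNIV::'n set). \<epsilon> * (2 * 2)))" for i j
    unfolding Sf_def
    by (intro power_series_bound_add power_series_bound_sum power_series_bound_mult
        power_series_bound_const r V_bound E finite)
  moreover have "power_series_bound (Gf i j) A r (\<Sum>k\<in>(UNIV::'n set). 2 * 2)" for i j
    unfolding Gf_def by (intro power_series_bound_sum power_series_bound_mult r V_bound finite)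
  ultimately obtain M1 M2 M3 M4 where "power_series_bound (Sf i j) A r M1" "power_series_bound (Gf a a) A r M2"
    "power_series_bound (Sf a a) A r M3" "power_series_bound (Gf i j) A r M4" by metis
  then have "power_series_bound (F a i j) A r (M1 * M2 + M3 * M4)"
    unfolding F_def by (intro power_series_bound_diff power_series_bound_mult r)
  then show ?thesis using power_series_bound_imp_real_analytic_at r assms by blast
qed

lemma E_has_derivative: "(E i j has_derivative (\<lambda>H. frame_coords q H $ i $ j)) (at A)"
proof -
  have "linear (\<lambda>H. frame_coords q H $ i $ j)"
    by (rule linearI) (simp_all add: frame_coords_def matrix_vector_mult_add_rdistrib inner_add_right
        scaleR_matrix_vector_assoc[symmetric])
  then have "bounded_linear (\<lambda>H. frame_coords q H $ i $ j)" by (simp add: linear_conv_bounded_linear)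
  then have "((\<lambda>X. frame_coords q X $ i $ j) has_derivative (\<lambda>H. frame_coords q H $ i $ j)) (at A)"
    by (rule bounded_linear_imp_has_derivative)
  then have "((\<lambda>X. frame_coords q X $ i $ j - (if i = j then D $ i else 0)) has_derivative (\<lambda>H. frame_coords q H $ i $ j - 0)) (at A)"
    by (intro has_derivative_diff has_derivative_const)
  then show ?thesis by (simp add: E_eq[abs_def])
qed

lemma eventually_cube: "\<forall>\<^sub>F X in nhds A. X \<in> cube_at A r"
proof -
  have "\<forall>\<^sub>F X in nhds A. X \<in> ball A r" using r by (intro eventually_nhds_in_open) auto
  then show ?thesis by (rule eventually_mono) (use ball_subset_cube_at[of A r] in blast)
qed

lemma eventually_cube_at: "\<forall>\<^sub>F X in at A. X \<in> cube_at A r"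
  using eventually_cube by (simp add: eventually_nhds_conv_at)

lemma A_in_cube: "A \<in> cube_at A r"
  by (simp add: cube_at_self less_imp_le r)

text \<open>The size of E at the individual X takes the place of the uniform
  \<open>\<epsilon>\<close>. The bound therefore tends to 0 as X tends to A, which yields the value
  and the continuity of V at A.\<close>

lemma V_near:
  assumes "X \<in> cube_at A r"
  shows "\<bar>V i j X - (if i = j then 1 else 0)\<bar> \<le> block_const TYPE('n) g * (\<Sum>k\<in>UNIV. \<Sum>l\<in>UNIV. \<bar>E k l X\<bar>) * 2"
proof -
  have le: "\<bar>E k l X\<bar> \<le> (\<Sum>k\<in>UNIV. \<Sum>l\<in>UNIV. \<bar>E k l X\<bar>)" for k l
  proof -
    have "\<bar>E k l X\<bar> \<le> (\<Sum>l\<in>UNIV. \<bar>E k l X\<bar>)" by (rule member_le_sum) auto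
    also have "\<dots> \<le> (\<Sum>k\<in>UNIV. \<Sum>l\<in>UNIV. \<bar>E k l X\<bar>)"
      by (rule member_le_sum[of k UNIV "\<lambda>k. \<Sum>l\<in>UNIV. \<bar>E k l X\<bar>"]) (auto intro: sum_nonneg)
    finally show ?thesis .
  qed
  show ?thesis
    by (rule block_map_fixed_point_near_id[OF g gap le V_le[OF assms] V_fix'[OF assms]])
qed

lemma V_A: "V i j A = (if i = j then 1 else 0)"
  using V_near[OF A_in_cube, of i j] by (simp add: E_A)

lemma V_isCont: "isCont (V i j) A"
proof -
  have Ec: "isCont (E k l) A" for k l using E_has_derivative has_derivative_continuous by blast
  have "((\<lambda>X. block_const TYPE('n) g * (\<Sum>k\<in>UNIV. \<Sum>l\<in>UNIV. \<bar>E k l X\<bar>) * 2) \<longlongrightarrow>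
      block_const TYPE('n) g * (\<Sum>k\<in>(UNIV::'n set). \<Sum>l\<in>(UNIV::'n set). \<bar>E k l A\<bar>) * 2) (at A)"
    using Ec by (intro tendsto_intros) (simp add: isCont_def)
  then have "((\<lambda>X. block_const TYPE('n) g * (\<Sum>k\<in>UNIV. \<Sum>l\<in>UNIV. \<bar>E k l X\<bar>) * 2) \<longlongrightarrow> 0) (at A)"
    by (simp add: E_A)
  moreover have "\<forall>\<^sub>F X in at A. norm (V i j X - (if i = j then 1 else 0))
      \<le> block_const TYPE('n) g * (\<Sum>k\<in>UNIV. \<Sum>l\<in>UNIV. \<bar>E k l X\<bar>) * 2"
    using eventually_cube_at by (rule eventually_mono) (simp only: real_norm_def V_near)
  ultimately have "((\<lambda>X. V i j X - (if i = j then 1 else 0)) \<longlongrightarrow> 0) (at A)"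
    by (rule Lim_null_comparison[rotated])
  then show ?thesis unfolding isCont_def V_A by (rule LIM_zero_cancel)
qed

text \<open>Outside the blocks the fixed point equation expresses V through products of entries of
  E, which vanish at A, with factors already known to be continuous.\<close>

lemma V_differentiable:
  assumes "D $ i \<noteq> D $ j"
  obtains v' where "(V i j has_derivative v') (at A)"
proof -
  define c where "c = inverse (D $ j - D $ i)"
  define W where "W X = c * ((\<Sum>k\<in>UNIV. E i k X * V k j X) - (\<Sum>l | D $ l = D $ j. \<Sum>k\<in>UNIV. E l k X * (V i l X * V k j X)))" for X
  define W' where "W' H = c * ((\<Sum>k\<in>UNIV. frame_coords q H $ i $ k * V k j A)
      - (\<Sum>l | D $ l = D $ j. \<Sum>k\<in>UNIV. frame_coords q H $ l $ k * (V i l A * V k j A)))" for H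
  have "(W has_derivative W') (at A)"
    unfolding W_def W'_def
    by (intro has_derivative_mult_right has_derivative_diff has_derivative_sum
        has_derivative_mult_vanishing[OF E_has_derivative E_A] continuous_mult V_isCont)
  moreover have eq: "W X = V i j X" if "X \<in> cube_at A r" for X
    using V_fix'[OF that, of i j] assms
    by (simp add: block_map_def W_def c_def sum_distrib_left mult.left_commute)
  have "\<forall>\<^sub>F X in at A. W X = V i j X"
    using eventually_cube_at by (rule eventually_mono) (rule eq)
  ultimately have "(V i j has_derivative W') (at A)"
    by (rule has_derivative_transform_eventually) (use eq[OF A_in_cube] in auto)
  then show ?thesis using that by blast
qed

text \<open>In rows k belonging to the block both factors are constant; in every other row both
  vanish at A, so the product is of second order.\<close>

lemma VV_has_derivative:
  assumes "D $ i = D $ j"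
  shows "((\<lambda>X. V k i X * V k j X) has_derivative (\<lambda>H. 0)) (at A)"
proof (cases "D $ k = D $ i")
  case True
  have "((\<lambda>X. V k i A * V k j A) has_derivative (\<lambda>H. 0)) (at A)" by (rule has_derivative_const)
  moreover have eq: "V k i A * V k j A = V k i X * V k j X" if "X \<in> cube_at A r" for X
    using V_fix'[OF that, of k i] V_fix'[OF that, of k j] True assms by (simp add: block_map_def V_A)
  have "\<forall>\<^sub>F X in at A. V k i A * V k j A = V k i X * V k j X"
    using eventually_cube_at by (rule eventually_mono) (rule eq)
  ultimately show ?thesis by (rule has_derivative_transform_eventually) auto
next
  case False
  then obtain v' where v': "(V k i has_derivative v') (at A)" using V_differentiable by blast
  have "k \<noteq> i" "k \<noteq> j" using False assms by auto
  then show ?thesis using has_derivative_mult_vanishing[OF v' _ V_isCont[of k j]] by (simp add: V_A)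
qed

text \<open>At A the matrix of \<open>Gf\<close> is the identity and its entries within a block have
  derivative 0, so only the derivatives of the two \<open>Sf\<close> factors survive, and these are
  frame entries of H.\<close>

lemma F_has_derivative:
  assumes ij: "D $ i = D $ j" "D $ a = D $ i"
  shows "(F a i j has_derivative (\<lambda>H. frame_coords q H $ i $ j - (if i = j then frame_coords q H $ a $ a else 0))) (at A)"
proof -
  have G: "(Gf i j has_derivative (\<lambda>H. 0)) (at A)" if "D $ i = D $ j" for i j
    using has_derivative_sum[of UNIV "\<lambda>k X. V k i X * V k j X" "\<lambda>k H. 0" "at A"] VV_has_derivative[OF that]
    unfolding Gf_def by simp
  have GA: "Gf i j A = (if i = j then 1 else 0)" for i j
  proof -
    have "Gf i j A = (\<Sum>k\<in>UNIV. if k = i then (if i = j then 1 else 0) else 0)"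
      unfolding Gf_def V_A by (intro sum.cong) auto
    then show ?thesis by simp
  qed
  have S: "(Sf i j has_derivative (\<lambda>H. frame_coords q H $ i $ j)) (at A)" if "D $ i = D $ j" for i j
  proof -
    have "((\<lambda>X. \<Sum>k\<in>UNIV. D $ k * (V k i X * V k j X)) has_derivative (\<lambda>H. \<Sum>k\<in>UNIV. D $ k * 0)) (at A)"
      by (intro has_derivative_sum has_derivative_mult_right VV_has_derivative that)
    moreover have "((\<lambda>X. \<Sum>k\<in>UNIV. \<Sum>l\<in>UNIV. E k l X * (V k i X * V l j X)) has_derivative
        (\<lambda>H. \<Sum>k\<in>UNIV. \<Sum>l\<in>UNIV. frame_coords q H $ k $ l * (V k i A * V l j A))) (at A)"
      by (intro has_derivative_sum has_derivative_mult_vanishing[OF E_has_derivative E_A] continuous_mult V_isCont)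
    ultimately have "(Sf i j has_derivative (\<lambda>H. (\<Sum>k\<in>UNIV. D $ k * 0) +
        (\<Sum>k\<in>UNIV. \<Sum>l\<in>UNIV. frame_coords q H $ k $ l * (V k i A * V l j A)))) (at A)"
      unfolding Sf_def by (rule has_derivative_add)
    moreover have "(\<Sum>k\<in>UNIV. \<Sum>l\<in>UNIV. frame_coords q H $ k $ l * (V k i A * V l j A)) = frame_coords q H $ i $ j" for H
    proof -
      have "(\<Sum>l\<in>UNIV. frame_coords q H $ k $ l * (V k i A * V l j A))
          = (\<Sum>l\<in>UNIV. if l = j then (if k = i then frame_coords q H $ i $ j else 0) else 0)" for k
        by (intro sum.cong) (auto simp: V_A)
      then show ?thesis by simp
    qed
    ultimately show ?thesis by simp
  qed
  have "(F a i j has_derivative (\<lambda>H. (Sf i j A * 0 + frame_coords q H $ i $ j * Gf a a A)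
      - (Sf a a A * 0 + frame_coords q H $ a $ a * Gf i j A))) (at A)"
    unfolding F_def by (intro has_derivative_diff has_derivative_mult S G ij refl)
  then show ?thesis by (simp add: GA if_distrib cong: if_cong)
qed

end

lemma spectral_chart_exists:
  fixes A :: "real^'n::{finite,linorder}^'n::{finite,linorder}"
  assumes A: "A \<in> sym_mats"
  obtains q g \<epsilon> r V where "spectral_chart A q g \<epsilon> r V"
proof -
  obtain q :: "'n \<Rightarrow> real^'n::{finite,linorder}" where on: "\<And>i j. q i \<bullet> q j = (if i = j then 1 else 0)"
    and eig: "\<And>i. A *v q i = (eigvals A $ i) *\<^sub>R q i"
    using eigvals_eigenbasis[OF A] by metis
  \<comment> \<open>The element 1 keeps the minimum over a nonempty set when A has a single
    eigenvalue.\<close>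
  define gs where "gs = insert 1 ((\<lambda>(i, j). \<bar>eigvals A $ i - eigvals A $ j\<bar>) ` {(i, j). eigvals A $ i \<noteq> eigvals A $ j})"
  define g where "g = Min gs"
  have gs: "finite gs" "gs \<noteq> {}" by (simp_all add: gs_def)
  have "g \<in> gs" unfolding g_def using gs by (rule Min_in)
  then have g: "g > 0" by (auto simp: gs_def)
  have gap: "g \<le> \<bar>eigvals A $ i - eigvals A $ j\<bar>" if "eigvals A $ i \<noteq> eigvals A $ j" for i j
    unfolding g_def using gs(1) by (rule Min_le) (use that in \<open>auto simp: gs_def\<close>)
  define n where "n = real CARD('n)"
  have n: "n \<ge> 1" unfolding n_def by (simp add: Suc_leI)
  define K where "K = block_const TYPE('n) g"
  have "n + 4 * n\<^sup>2 > 0" using n by (simp add: add_pos_nonneg)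
  then have K: "K > 0" unfolding K_def block_const_def using g by (simp add: n_def)
  \<comment> \<open>The first bound gives \<open>n * (K * \<epsilon>) \<le> 1 / 4\<close>, hence the
    contraction ratio and \<open>small_V\<close>; the second gives
    \<open>n * (n * \<epsilon>) \<le> g / 8\<close>, hence \<open>small_E\<close>.\<close>
  define \<epsilon> where "\<epsilon> = min (1 / (4 * n * K)) (g / (8 * n * n))"
  have \<epsilon>: "\<epsilon> > 0" unfolding \<epsilon>_def using n K g by simp
  have "\<epsilon> \<le> 1 / (4 * n * K)" by (simp add: \<epsilon>_def)
  then have K\<epsilon>: "n * (K * \<epsilon>) \<le> 1 / 4" using n K by (simp add: field_simps)
  have "1 * (K * \<epsilon>) \<le> n * (K * \<epsilon>)" using n K \<epsilon> by (intro mult_right_mono) auto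
  then have K\<epsilon>': "K * \<epsilon> \<le> 1 / 4" using K\<epsilon> by linarith
  have "\<epsilon> \<le> g / (8 * n * n)" by (simp add: \<epsilon>_def)
  then have "n * (n * \<epsilon>) \<le> g / 8" using n by (simp add: field_simps)
  then have small_E: "n * (n * \<epsilon> * 2) < g / 2" using g by (simp add: mult.assoc[symmetric])
  have small_V: "n * (K * \<epsilon> * 2) < 1" using K\<epsilon> by (simp add: mult.assoc[symmetric])
  define l where "l i j H = q i \<bullet> (H *v q j)" for i j H
  have lin: "linear (l i j)" for i j
    unfolding l_def by (rule linearI) (simp_all add: matrix_vector_mult_add_rdistrib inner_add_right
        scaleR_matrix_vector_assoc[symmetric])
  define C where "C = (\<Sum>i\<in>UNIV. \<Sum>j\<in>UNIV. \<Sum>b\<in>Basis. \<bar>l i j b\<bar>)"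
  have C: "(\<Sum>b\<in>Basis. \<bar>l i j b\<bar>) \<le> C" for i j
  proof -
    have "(\<Sum>b\<in>Basis. \<bar>l i j b\<bar>) \<le> (\<Sum>j\<in>UNIV. \<Sum>b\<in>Basis. \<bar>l i j b\<bar>)"
      by (rule member_le_sum[of j UNIV "\<lambda>j. \<Sum>b\<in>Basis. \<bar>l i j b\<bar>"]) (auto intro: sum_nonneg)
    also have "\<dots> \<le> C" unfolding C_def
      by (rule member_le_sum[of i UNIV "\<lambda>i. \<Sum>j\<in>UNIV. \<Sum>b\<in>Basis. \<bar>l i j b\<bar>"]) (auto intro!: sum_nonneg)
    finally show ?thesis .
  qed
  have C0: "C \<ge> 0" unfolding C_def by (intro sum_nonneg) auto
  \<comment> \<open>A radius at which the linear entries of E have weighted norm at most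
    \<open>\<epsilon>\<close>: C dominates their coefficient sums, and the summand 1 avoids division
    by zero.\<close>
  define r where "r = \<epsilon> / (C + 1)"
  have r: "r > 0" unfolding r_def using \<epsilon> C0 by simp
  have E: "power_series_bound (\<lambda>X. l i j (X - A)) A r \<epsilon>" for i j
  proof (rule power_series_bound_mono[OF power_series_bound_linear[OF lin r]])
    have "r * (\<Sum>b\<in>Basis. \<bar>l i j b\<bar>) \<le> r * (C + 1)"
      using r C[of i j] by (intro mult_left_mono) auto
    also have "\<dots> = \<epsilon>" using C0 by (simp add: r_def)
    finally show "r * (\<Sum>b\<in>Basis. \<bar>l i j b\<bar>) \<le> \<epsilon>" .
  qed
  have small: "block_const TYPE('n) g * \<epsilon> \<le> 1 / 4" using K\<epsilon>' by (simp add: K_def)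
  obtain V where V: "\<And>i j. power_series_bound (V i j) A r 2"
    "\<And>i j X. X \<in> cube_at A r \<Longrightarrow> V i j X = block_map (eigvals A) (\<lambda>i j. l i j (X - A)) (\<lambda>i j. V i j X) i j"
    by (rule block_map_fixed_point[OF r g gap E small], assumption) (rule that)
  have "spectral_chart A q g \<epsilon> r V"
    by unfold_locales
      (fact A on eig g gap r E[unfolded l_def] small_V[unfolded n_def K_def] small_E[unfolded n_def] V(1) V(2)[unfolded l_def])+
  then show ?thesis by (rule that)
qed

text \<open>\<open>whole\<close> makes each class with two elements a full cluster of equal
  eigenvalues of A, which is the kind of coincidence that the block criterion expresses; singleton
  classes impose no equation.\<close>

lemma spectral_lift:
  fixes A :: "real^'n::{finite,linorder}^'n::{finite,linorder}" and R :: "('n::{finite,linorder} \<times> 'n) set"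
  assumes A: "A \<in> sym_mats" and R: "equiv UNIV R"
    and R_sub: "\<And>i j. (i, j) \<in> R \<Longrightarrow> eigvals A $ i = eigvals A $ j"
    and whole: "\<And>i j k. (i, j) \<in> R \<Longrightarrow> i \<noteq> j \<Longrightarrow> eigvals A $ k = eigvals A $ i \<Longrightarrow> (i, k) \<in> R"
    and \<rho>: "\<rho> > 0" and B: "ball (eigvals A) \<rho> \<subseteq> B"
  shows "analytic_submanifold_around sym_mats {X\<in>sym_mats. eigvals X \<in> class_const R \<inter> B} A
    (int (dim (sym_mats :: (real^'n::{finite,linorder}^'n::{finite,linorder}) set)) - int (card (equation_indices R)))"
proof -
  obtain q g \<epsilon> r V where "spectral_chart A q g \<epsilon> r V" using spectral_chart_exists[OF A] by metis
  then interpret spectral_chart A q g \<epsilon> r V .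
  define \<eta> where "\<eta> = min \<rho> (g / 2)"
  have "\<eta> > 0" unfolding \<eta>_def using \<rho> g by simp
  then obtain \<rho>1 where \<rho>1: "\<rho>1 > 0" "\<And>X. X \<in> sym_mats \<Longrightarrow> dist X A < \<rho>1 \<Longrightarrow> dist (eigvals X) D < \<eta>"
    using eigvals_continuous[OF A] unfolding continuous_within_eps_delta by blast
  \<comment> \<open>Half the radius leaves room to expand the series about every point of U;
    \<open>\<rho>1\<close> keeps the spectrum close to D and inside B.\<close>
  define U where "U = ball A (min (r / 2) \<rho>1)"
  have U: "open U" "A \<in> U" using r \<rho>1(1) by (simp_all add: U_def)
  have near: "X \<in> cube_at A r" "\<bar>eigvals X $ i - D $ i\<bar> < g / 2" "eigvals X \<in> B"
    if X: "X \<in> sym_mats" "X \<in> U" for X i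
  proof -
    have "X \<in> ball A r" using X(2) r by (auto simp: U_def)
    then show "X \<in> cube_at A r" using ball_subset_cube_at by blast
    have d: "dist (eigvals X) D < \<eta>" using \<rho>1(2)[OF X(1)] X(2) by (simp add: U_def dist_commute)
    then show "eigvals X \<in> B" using B by (auto simp: \<eta>_def dist_commute)
    have "\<bar>eigvals X $ i - D $ i\<bar> \<le> dist (eigvals X) D"
      using component_le_norm_cart[of "eigvals X - D" i] by (simp add: dist_norm)
    then show "\<bar>eigvals X $ i - D $ i\<bar> < g / 2" using d by (simp add: \<eta>_def)
  qed
  define J where "J = equation_indices R"
  define a where "a i = Min (R `` {i})" for i
  have ia: "(i, a i) \<in> R" for i
    using Min_in[of "R `` {i}"] equiv_class_self[OF R, of i] unfolding a_def by fastforce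
  have a_cong: "a i = a j" if "(i, j) \<in> R" for i j
    using equiv_class_eq[OF R that] by (simp add: a_def)
  have J_iff: "(i, j) \<in> J \<longleftrightarrow> (i, j) \<in> R \<and> i \<le> j \<and> \<not> (i = j \<and> i = a i)" for i j
    by (simp add: J_def equation_indices_def a_def)
  \<comment> \<open>A pair in J forces a class with two elements: either i and j differ, or i
    differs from the least element of its class. So \<open>whole\<close> applies.\<close>
  have J_block: "(i, k) \<in> R \<longleftrightarrow> D $ k = D $ i" if "(i, j) \<in> J" for i j k
  proof
    assume "D $ k = D $ i"
    moreover have "i \<noteq> j \<or> i \<noteq> a i" using that by (auto simp: J_iff)
    ultimately show "(i, k) \<in> R" using whole[of i j k] whole[of i "a i" k] ia[of i] that by (auto simp: J_iff)
  qed (use R_sub in metis)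
  have zero_iff: "eigvals X \<in> class_const R \<longleftrightarrow> (\<forall>(i, j)\<in>J. F (a i) i j X = 0)"
    if X: "X \<in> sym_mats" "X \<in> U" for X
  proof
    note block = eigvals_const_on_block_iff[OF X(1) near(1)[OF X] near(2)[OF X]]
    assume cc: "eigvals X \<in> class_const R"
    have "F (a i) i j X = 0" if ij: "(i, j) \<in> J" for i j
    proof -
      have Da: "D $ a i = D $ i" using R_sub[OF ia[of i]] by simp
      have "eigvals X $ k = eigvals X $ a i" if "D $ k = D $ a i" for k
      proof -
        have "(i, k) \<in> R" using J_block[OF ij] that Da by simp
        then have "eigvals X $ i = eigvals X $ k" "eigvals X $ i = eigvals X $ a i"
          using cc ia[of i] unfolding class_const_def by blast+
        then show ?thesis by simp
      qed
      then have "\<forall>k l. D $ k = D $ a i \<and> D $ l = D $ a i \<longrightarrow> Sf k l X * Gf (a i) (a i) X = Sf (a i) (a i) X * Gf k l X"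
        using block(1)[of "a i"] by blast
      moreover have "D $ j = D $ i" using ij R_sub[of i j] by (simp add: J_iff)
      ultimately show ?thesis using Da unfolding F_def by simp
    qed
    then show "\<forall>(i, j)\<in>J. F (a i) i j X = 0" by blast
  next
    note block = eigvals_const_on_block_iff[OF X(1) near(1)[OF X] near(2)[OF X]]
    assume F0: "\<forall>(i, j)\<in>J. F (a i) i j X = 0"
    have "eigvals X $ i = eigvals X $ j" if ij: "(i, j) \<in> R" for i j
    proof (cases "i = j")
      case False
      define c where "c = a i"
      have Dc: "D $ c = D $ i" using R_sub[OF ia[of i]] by (simp add: c_def)
      have cls: "(i, k) \<in> R" if "D $ k = D $ c" for k
        using whole[OF ij False] that Dc by simp
      have pair: "(k, l) \<in> R" if "D $ k = D $ c" "D $ l = D $ c" for k l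
        using cls[OF that(1)] cls[OF that(2)] R unfolding equiv_def by (meson symE transE)
      \<comment> \<open>J lists only pairs with k \<le> l. Symmetry of \<open>Sf\<close> and
        \<open>Gf\<close> supplies the others below, and for the omitted pair (c, c) the equation is
        trivial.\<close>
      have ord: "Sf k l X * Gf c c X = Sf c c X * Gf k l X" if kl: "D $ k = D $ c" "D $ l = D $ c" "k \<le> l" for k l
      proof (cases "k = l \<and> k = c")
        case False
        have ak: "a k = c" using a_cong[OF cls[OF kl(1)]] by (simp add: c_def)
        then have "(k, l) \<in> J" using pair[OF kl(1,2)] kl(3) False by (auto simp: J_iff)
        then have "F (a k) k l X = 0" using F0 by blast
        then show ?thesis unfolding ak F_def by simp
      qed auto
      have "Sf k l X * Gf c c X = Sf c c X * Gf k l X" if "D $ k = D $ c" "D $ l = D $ c" for k l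
        using ord[of k l] ord[of l k] that block(2)[of k l] block(3)[of k l] linear[of k l] by auto
      then have "\<forall>k. D $ k = D $ c \<longrightarrow> eigvals X $ k = eigvals X $ c"
        using block(1)[of c] by blast
      then have "eigvals X $ i = eigvals X $ c" "eigvals X $ j = eigvals X $ c"
        using Dc R_sub[OF ij] by metis+
      then show ?thesis by simp
    qed simp
    then show "eigvals X \<in> class_const R" unfolding class_const_def by blast
  qed
  have fin: "finite J" by simp
  obtain h where h: "bij_betw h {0..<card J} J" using ex_bij_betw_nat_finite[OF fin] by blast
  define f where "f m = (case h m of (i, j) \<Rightarrow> F (a i) i j)" for m
  define f' where "f' m = (case h m of (i, j) \<Rightarrow>
    (\<lambda>H. frame_coords q H $ i $ j - (if i = j then frame_coords q H $ a i $ a i else 0)))" for m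
  have hJ: "h m \<in> J" if "m < card J" for m using h that by (auto simp: bij_betw_def)
  have analytic: "real_analytic_at (f m) X" if "X \<in> U" for m X
    unfolding f_def using that by (cases "h m") (auto intro!: F_real_analytic simp: U_def)
  have deriv: "(f m has_derivative f' m) (at A)" if m: "m < card J" for m
  proof -
    obtain i j where ij: "h m = (i, j)" by (cases "h m")
    have "(i, j) \<in> R" using hJ[OF m] ij by (simp add: J_iff)
    then have "D $ i = D $ j" "D $ a i = D $ i" using R_sub R_sub[OF ia[of i]] by simp_all
    then show ?thesis unfolding f_def f'_def ij prod.case by (rule F_has_derivative)
  qed
  have surj: "\<exists>H\<in>sym_mats. \<forall>m<card J. f' m H = v m" for v
  proof -
    define w where "w p = v (the_inv_into {0..<card J} h p)" for p
    \<comment> \<open>The frame entries listed in J are prescribed and all others set to 0. As (a i,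
      a i) is not in J, the diagonal entry subtracted in the derivative vanishes, and the prescribed
      values are attained independently.\<close>
    define Z :: "real^'n::{finite,linorder}^'n::{finite,linorder}"
      where "Z = (\<chi> i j. if (min i j, max i j) \<in> J then w (min i j, max i j) else 0)"
    have "Z \<in> sym_mats" by (simp add: Z_def sym_mats_def transpose_def vec_eq_iff min.commute max.commute)
    then obtain H where H: "H \<in> sym_mats" "frame_coords q H = Z" using frame_coords_surj[OF on] by metis
    have "f' m H = v m" if m: "m < card J" for m
    proof -
      obtain i j where ij: "h m = (i, j)" by (cases "h m")
      have J: "(i, j) \<in> J" using hJ[OF m] ij by simp
      then have "i \<le> j" by (simp add: J_iff)
      then have "Z $ i $ j = w (i, j)" using J by (simp add: Z_def min_absorb1 max_absorb2)
      moreover have "w (i, j) = v m"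
        using the_inv_into_f_f[of h "{0..<card J}" m] h m ij by (simp add: w_def bij_betw_def)
      moreover have "Z $ a i $ a i = 0"
      proof -
        have "a (a i) = a i" using a_cong[OF ia[of i]] by simp
        then have "(a i, a i) \<notin> J" by (simp add: J_iff)
        then show ?thesis by (simp add: Z_def)
      qed
      ultimately show ?thesis by (auto simp: f'_def ij H(2))
    qed
    then show ?thesis using H(1) by blast
  qed
  have zero_set: "{X\<in>sym_mats. eigvals X \<in> class_const R \<inter> B} \<inter> U = {X\<in>sym_mats \<inter> U. \<forall>m<card J. f m X = 0}"
  proof -
    have "(\<forall>(i, j)\<in>J. F (a i) i j X = 0) \<longleftrightarrow> (\<forall>m<card J. f m X = 0)" for X
    proof -
      have "h ` {0..<card J} = J" using h by (simp add: bij_betw_def)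
      moreover have "(\<forall>p\<in>h ` {0..<card J}. (case p of (i, j) \<Rightarrow> F (a i) i j) X = 0)
          \<longleftrightarrow> (\<forall>m\<in>{0..<card J}. f m X = 0)"
        unfolding f_def by simp
      ultimately have "(\<forall>p\<in>J. (case p of (i, j) \<Rightarrow> F (a i) i j) X = 0) \<longleftrightarrow> (\<forall>m\<in>{0..<card J}. f m X = 0)"
        by (simp only:)
      moreover have "(\<forall>m\<in>{0..<card J}. f m X = 0) \<longleftrightarrow> (\<forall>m<card J. f m X = 0)" by auto
      ultimately show ?thesis by (simp add: case_prod_beta)
    qed
    then show ?thesis using zero_iff near(3) by blast
  qed
  have "D \<in> class_const R" using R_sub unfolding class_const_def by blast
  moreover have "D \<in> B" using B \<rho> by auto
  ultimately have A_in: "A \<in> {X\<in>sym_mats. eigvals X \<in> class_const R \<inter> B}" using A by simp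
  show ?thesis
    unfolding analytic_submanifold_around_def J_def[symmetric]
  proof (intro conjI exI)
    show "{X\<in>sym_mats. eigvals X \<in> class_const R \<inter> B} \<subseteq> sym_mats" by blast
    show "\<forall>m<card J. (\<forall>Y\<in>U. real_analytic_at (f m) Y) \<and> (f m has_derivative f' m) (at A)"
      using analytic deriv by blast
    show "\<forall>v. \<exists>H\<in>sym_mats. \<forall>m<card J. f' m H = v m" using surj by blast
  qed (fact A_in refl U zero_set)+
qed

section \<open>The eigenvalue preimage of the affine set, and its dimension\<close>

theorem theorem4p16:
  fixes M :: "(real^'n::{finite,linorder}) set"
    and d :: nat
    and \<sigma>s \<sigma> :: "'n::{finite,linorder} \<Rightarrow> 'n::{finite,linorder}"
    and xbar :: "real^'n::{finite,linorder}"
    and \<delta> \<delta>1 \<delta>2 :: real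
  assumes M_manifold: "C2_submanifold M d" and M_conn: "connected M"
    and M_ls: "locally_symmetric M"
    and char: "char_perm M \<sigma>s"
    and \<sigma>_perm: "\<sigma> permutes UNIV"
    and xbar_in: "xbar \<in> M \<inter> stratum \<sigma>"
    and \<delta>_pos: "\<delta> > 0"
    and strata: "\<forall>x\<in>ball xbar \<delta>. \<forall>\<sigma>'. \<sigma>' permutes UNIV \<and> x \<in> stratum \<sigma>' \<longrightarrow>
                    refines (perm_partition \<sigma>') (perm_partition \<sigma>)"
    and sls: "strongly_locally_symmetric (M \<inter> ball xbar \<delta>)"
    and proj: "diffeo_onto_image (\<lambda>y. xbar + orth_proj (tangent_space M xbar) (y - xbar))
                 (M \<inter> ball xbar \<delta>) ((\<lambda>v. xbar + v) ` tangent_space M xbar)"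
    and \<delta>12: "\<delta>1 > 0" "\<delta>2 > 0"
    and B_sub: "{x. part_dist (- supp_perm \<sigma>s) x xbar < \<delta>1 \<and> part_dist (supp_perm \<sigma>s) x xbar < \<delta>2}
                  \<subseteq> ball xbar \<delta>"
  shows "\<forall>Xbar\<in>sym_mats. eigvals Xbar = xbar \<longrightarrow>
    analytic_submanifold_around sym_mats
      {X\<in>sym_mats. eigvals X \<in>
         {xbar + t + m | t m. t \<in> tangent_space M xbar \<and>
                              m \<in> normal_space M xbar \<inter> stratum_perpperp \<sigma>}
         \<inter> {x. part_dist (- supp_perm \<sigma>s) x xbar < \<delta>1 \<and> part_dist (supp_perm \<sigma>s) x xbar < \<delta>2}}
      Xbar
      (int (CARD('n) * (CARD('n) + 1) div 2) + int d
        + int (dim (normal_space M xbar \<inter> stratum_perpperp \<sigma>))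
        - int (card (- supp_perm \<sigma>s))
        - int (\<Sum>I\<in>{I\<in>perm_partition \<sigma>s. card I \<ge> 2}. card I * (card I + 1) div 2))"
proof (intro ballI impI)
  fix Xbar :: "real^'n::{finite,linorder}^'n::{finite,linorder}"
  assume X: "Xbar \<in> sym_mats" and eig: "eigvals Xbar = xbar"
  define R where "R = tied_coords M xbar"
  define N where "N = normal_space M xbar \<inter> stratum_perpperp \<sigma>"
  define B where "B = {x. part_dist (- supp_perm \<sigma>s) x xbar < \<delta>1 \<and> part_dist (supp_perm \<sigma>s) x xbar < \<delta>2}"
  have xM: "xbar \<in> M" and xs: "xbar \<in> stratum \<sigma>" using xbar_in by auto
  have R: "equiv UNIV R" unfolding R_def by (rule equiv_tied_coords)
  have part: "perm_partition \<sigma>s = UNIV // R"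
    unfolding R_def by (rule tied_coords_char_perm[OF M_manifold M_ls M_conn char xM])
  have cc: "{t + m | t m. t \<in> tangent_space M xbar \<and> m \<in> N} = class_const R"
    and dim_cc: "dim (class_const R) = d + dim N"
    using tangent_plus_reduced_normal[OF M_manifold xM xs \<delta>_pos sls] unfolding R_def N_def by simp_all
  \<comment> \<open>\<open>xbar\<close> is itself constant on the tied classes, so translating by it
    does not change the linear space.\<close>
  have aff: "{xbar + t + m | t m. t \<in> tangent_space M xbar \<and> m \<in> N} = class_const R"
  proof -
    have tie: "xbar $ i = xbar $ j" if "(i, j) \<in> R" for i j
      using that unfolding R_def tied_coords_def by blast
    have shift: "xbar + z \<in> class_const R \<longleftrightarrow> z \<in> class_const R" for z
      using tie unfolding class_const_def by fastforce
    have "{xbar + t + m | t m. t \<in> tangent_space M xbar \<and> m \<in> N} = (+) xbar ` class_const R"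
      unfolding cc[symmetric] by (auto simp: add.assoc)
    also have "\<dots> = class_const R"
    proof (intro Set.equalityI subsetI)
      fix z assume "z \<in> class_const R"
      then have "z - xbar \<in> class_const R" using shift[of "z - xbar"] by simp
      then show "z \<in> (+) xbar ` class_const R" by (intro image_eqI[of _ _ "z - xbar"]) simp_all
    qed (use shift in auto)
    finally show ?thesis .
  qed
  \<comment> \<open>As B is open, continuity of \<open>eigvals\<close> makes membership in B
    automatic near \<open>Xbar\<close>.\<close>
  have "open B"
    unfolding B_def part_dist_def by (intro open_Collect_conj open_Collect_less continuous_intros)
  moreover have "xbar \<in> B" using \<delta>12 by (simp add: B_def part_dist_def)
  ultimately obtain \<rho> where \<rho>: "\<rho> > 0" "ball xbar \<rho> \<subseteq> B" by (meson open_contains_ball)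
  have lift: "analytic_submanifold_around sym_mats {X\<in>sym_mats. eigvals X \<in> class_const R \<inter> B} Xbar
    (int (dim (sym_mats :: (real^'n::{finite,linorder}^'n::{finite,linorder}) set)) - int (card (equation_indices R)))"
  proof (rule spectral_lift[OF X R _ _ \<rho>(1)])
    show "eigvals Xbar $ i = eigvals Xbar $ j" if "(i, j) \<in> R" for i j
      using that unfolding eig R_def tied_coords_def by blast
    show "(i, k) \<in> R" if "(i, j) \<in> R" "i \<noteq> j" "eigvals Xbar $ k = eigvals Xbar $ i" for i j k
      using tied_coords_whole_block[OF M_manifold xM \<delta>_pos sls] that unfolding eig R_def by blast
    show "ball (eigvals Xbar) \<rho> \<subseteq> B" using \<rho>(2) by (simp add: eig)
  qed
  \<comment> \<open>Equations plus classes give the sum of k(k+1)/2 over all classes, from which the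
    singletons are split off; the number of classes equals \<open>d + dim N\<close>, being the
    dimension of \<open>class_const R\<close>.\<close>
  have "int (card (equation_indices R)) + int (d + dim N) = int (card (- supp_perm \<sigma>s))
     + int (\<Sum>I\<in>{I\<in>perm_partition \<sigma>s. card I \<ge> 2}. card I * (card I + 1) div 2)"
    using card_equation_indices[OF R] perm_partition_sum[OF R part] dim_class_const[OF R] dim_cc by linarith
  then have dims: "int (dim (sym_mats :: (real^'n::{finite,linorder}^'n::{finite,linorder}) set)) - int (card (equation_indices R))
     = int (CARD('n) * (CARD('n) + 1) div 2) + int d + int (dim N) - int (card (- supp_perm \<sigma>s))
        - int (\<Sum>I\<in>{I\<in>perm_partition \<sigma>s. card I \<ge> 2}. card I * (card I + 1) div 2)"
    unfolding dim_sym_mats by linarith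
  show "analytic_submanifold_around sym_mats
      {X\<in>sym_mats. eigvals X \<in>
         {xbar + t + m | t m. t \<in> tangent_space M xbar \<and>
                              m \<in> normal_space M xbar \<inter> stratum_perpperp \<sigma>}
         \<inter> {x. part_dist (- supp_perm \<sigma>s) x xbar < \<delta>1 \<and> part_dist (supp_perm \<sigma>s) x xbar < \<delta>2}}
      Xbar
      (int (CARD('n) * (CARD('n) + 1) div 2) + int d
        + int (dim (normal_space M xbar \<inter> stratum_perpperp \<sigma>))
        - int (card (- supp_perm \<sigma>s))
        - int (\<Sum>I\<in>{I\<in>perm_partition \<sigma>s. card I \<ge> 2}. card I * (card I + 1) div 2))"
    using lift unfolding dims N_def[symmetric] B_def[symmetric] aff .
qed

end
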